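(* Let $n\ge 3$ and $p\in\mathbb R\setminus\{1\}$. A map $\mu:\mathcal P_o^n\to\mathcal M^d(S^{n-1})$ is an $\operatorname{SL}(n)$ contravariant valuation of degree $p$ if and only if there exist nonnegative constants $c_1,c_2\in\mathbb R$ such that $$\mu(P,\cdot)=c_1S_p(P,\cdot)+c_2S_p(-P,\cdot)$$ for every $P\in\mathcal P_o^n$.
   Context: $\mathcal P_o^n$ denotes the set of all convex polytopes in $\mathbb R^n$ (of any dimension, including $\{o\}$) that contain the origin $o$. $S^{n-1}$ is the Euclidean unit sphere of $\mathbb R^n$, $\mathcal M(S^{n-1})$ is the space of finite positive Borel measures on $S^{n-1}$, and $\mathcal M^d(S^{n-1})$ is the set of discrete measures in $\mathcal M(S^{n-1})$, i.e. those $\nu$ for which there is a countable set $N\subset S^{n-1}$ with $\nu(S^{n-1}\setminus N)=0$. A map $\mu:\mathcal P_o^n\to\mathcal M(S^{n-1})$ is a valuation if $\mu(P\cup Q,\cdot)+\mu(P\cap Q,\cdot)=\mu(P,\cdot)+\mu(Q,\cdot)$ whenever $P,Q,P\cup Q,P\cap Q\in\mathcal P_o^n$. For $p\in\mathbb R$, $\mu$ is called $\operatorname{SL}(n)$ contravariant of degree $p$ if $$\int_{S^{n-1}}f\,d\mu(\phi P,\cdot)=\int_{S^{n-1}}f\circ\phi^{-t}\,d\mu(P,\cdot)$$ for every $\phi\in\operatorname{SL}(n)$, every $P\in\mathcal P_o^n$, and every continuous function $f:\mathbb R^n\setminus\{o\}\to\mathbb R$ that is $p$-homogeneous (i.e.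 $f(tx)=t^pf(x)$ for $t>0$). Here $\phi^{-t}$ is the transpose of the inverse of $\phi$. The $L_p$ surface area measure of $P\in\mathcal P_o^n$ is $S_p(P,\cdot)=\sum_{u\in\mathcal N^*(P)}h(P,u)^{1-p}V_{n-1}(F_u)\,\delta_u$, where $\mathcal N^*(P)$ is the set of outer unit normals $u$ of facets ($(n-1)$-dimensional faces) $F_u$ of $P$ that do not contain the origin, $h(P,u)=\max\{u\cdot y: y\in P\}$ is the support function, $V_{n-1}$ is $(n-1)$-dimensional volume, and $\delta_u$ is the Dirac probability measure at $u$. *)

theory Defs
  imports "HOL-Analysis.Analysis"
begin

definition polytopes_o :: "(real ^ 'n) set set" where
  "polytopes_o = {P. polytope P \<and> 0 \<in> P}"

abbreviation sphere_borel :: "(real ^ 'n) measure" where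
  "sphere_borel \<equiv> restrict_space borel (sphere 0 1)"

definition sphere_measures :: "(real ^ 'n) measure set" where
  "sphere_measures = {\<nu>. sets \<nu> = sets sphere_borel \<and> finite_measure \<nu>}"

definition discrete_sphere_measures :: "(real ^ 'n) measure set" where
  "discrete_sphere_measures =
     {\<nu> \<in> sphere_measures. \<exists>N \<subseteq> sphere 0 1. countable N \<and> emeasure \<nu> (sphere 0 1 - N) = 0}"

definition valuation_o :: "((real ^ 'n) set \<Rightarrow> (real ^ 'n) measure) \<Rightarrow> bool" where
  "valuation_o \<mu> \<longleftrightarrow>
     (\<forall>P Q. P \<in> polytopes_o \<longrightarrow> Q \<in> polytopes_o \<longrightarrow> P \<union> Q \<in> polytopes_o \<longrightarrow> P \<inter> Q \<in> polytopes_o \<longrightarrow>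
       (\<forall>A \<in> sets sphere_borel.
          measure (\<mu> (P \<union> Q)) A + measure (\<mu> (P \<inter> Q)) A = measure (\<mu> P) A + measure (\<mu> Q) A))"

text \<open>Functions on the punctured space are rendered as total functions; the value at \<open>0\<close>
  is unconstrained and never used.\<close>

definition homogeneous_of_degree :: "real \<Rightarrow> (real ^ 'n \<Rightarrow> real) \<Rightarrow> bool" where
  "homogeneous_of_degree p f \<longleftrightarrow> (\<forall>t > 0. \<forall>x. x \<noteq> 0 \<longrightarrow> f (t *\<^sub>R x) = t powr p * f x)"

definition SL_contravariant :: "real \<Rightarrow> ((real ^ 'n) set \<Rightarrow> (real ^ 'n) measure) \<Rightarrow> bool" where
  "SL_contravariant p \<mu> \<longleftrightarrow>
     (\<forall>\<phi> :: real ^ 'n ^ 'n. det \<phi> = 1 \<longrightarrow>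
       (\<forall>P \<in> polytopes_o. \<forall>f. continuous_on (- {0}) f \<longrightarrow> homogeneous_of_degree p f \<longrightarrow>
          (\<integral>x. f x \<partial>\<mu> ((\<lambda>y. \<phi> *v y) ` P)) =
          (\<integral>x. f (transpose (matrix_inv \<phi>) *v x) \<partial>\<mu> P)))"

definition support_function :: "(real ^ 'n) set \<Rightarrow> real ^ 'n \<Rightarrow> real" where
  "support_function P u = (SUP y\<in>P. u \<bullet> y)"

definition support_face :: "(real ^ 'n) set \<Rightarrow> real ^ 'n \<Rightarrow> (real ^ 'n) set" where
  "support_face P u = {y \<in> P. u \<bullet> y = support_function P u}"

text \<open>The library's \<open>facet_of\<close> is relative to the dimension of \<open>P\<close>, whereas facets here are
  \<open>(n - 1)\<close>-dimensional faces in every case, so the dimension is stated explicitly.\<close>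

definition facet_normals_off_o :: "(real ^ 'n) set \<Rightarrow> (real ^ 'n) set" where
  "facet_normals_off_o P =
     {u. norm u = 1 \<and> support_face P u face_of P \<and>
         aff_dim (support_face P u) = int CARD('n) - 1 \<and> 0 \<notin> support_face P u}"

definition orthonormal_basis_of :: "(real ^ 'n) set \<Rightarrow> (real ^ 'n) set \<Rightarrow> bool" where
  "orthonormal_basis_of U B \<longleftrightarrow> pairwise orthogonal B \<and> (\<forall>b\<in>B. norm b = 1) \<and> span B = U"

text \<open>Volume of \<open>F\<close> within its affine hull: the Lebesgue measure of the coordinates of \<open>F\<close> with
  respect to an orthonormal basis of the direction space of the affine hull. By the invariance of
  Lebesgue measure under isometries the choice of the basis is immaterial. If \<open>F\<close> has affine
  dimension \<open>n - 1\<close>, this is its \<open>(n - 1)\<close>-dimensional volume.\<close>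

definition flat_volume :: "(real ^ 'n) set \<Rightarrow> real" where
  "flat_volume F =
     (let B = (SOME B. orthonormal_basis_of (span {x - y | x y. x \<in> F \<and> y \<in> F}) B)
      in measure (\<Pi>\<^sub>M b\<in>B. lborel) ((\<lambda>x. \<lambda>b\<in>B. x \<bullet> b) ` F))"

definition Lp_surface_area_measure :: "real \<Rightarrow> (real ^ 'n) set \<Rightarrow> (real ^ 'n) measure" where
  "Lp_surface_area_measure p P =
     measure_of (sphere 0 1) (sets sphere_borel)
       (\<lambda>A. \<Sum>u\<in>facet_normals_off_o P.
          ennreal (support_function P u powr (1 - p) * flat_volume (support_face P u)) * indicator A u)"

text \<open>The set function above is countably additive, so that \<open>measure_of\<close> does not degenerate.\<close>

lemma sets_Lp_surface_area_measure [simp]: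
  fixes P :: "(real ^ 'n) set"
  shows "sets (Lp_surface_area_measure p P) = sets sphere_borel"
proof -
  have "sets sphere_borel \<subseteq> Pow (sphere 0 1 :: (real ^ 'n) set)"
    using sets.space_closed[of sphere_borel] by (simp add: space_restrict_space)
  then have "sets (Lp_surface_area_measure p P) = sigma_sets (sphere 0 1) (sets sphere_borel)"
    unfolding Lp_surface_area_measure_def by (rule sets_measure_of)
  then show ?thesis
    using sets.sigma_sets_eq[of "sphere_borel :: (real ^ 'n) measure"]
    by (simp add: space_restrict_space)
qed

lemma emeasure_Lp_surface_area_measure:
  assumes "A \<in> sets sphere_borel"
  shows "emeasure (Lp_surface_area_measure p P) A =
    (\<Sum>u\<in>facet_normals_off_o P.
       ennreal (support_function P u powr (1 - p) * flat_volume (support_face P u)) * indicator A u)"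
proof (rule emeasure_measure_of[OF Lp_surface_area_measure_def])
  show "sets sphere_borel \<subseteq> Pow (sphere 0 1)"
    using sets.space_closed[of sphere_borel] by (simp add: space_restrict_space)
  show "A \<in> sets (Lp_surface_area_measure p P)" using assms by simp
  show "positive (sets (Lp_surface_area_measure p P)) (\<lambda>A. \<Sum>u\<in>facet_normals_off_o P.
       ennreal (support_function P u powr (1 - p) * flat_volume (support_face P u)) * indicator A u)"
    by (simp add: positive_def)
  show "countably_additive (sets (Lp_surface_area_measure p P)) (\<lambda>A. \<Sum>u\<in>facet_normals_off_o P.
       ennreal (support_function P u powr (1 - p) * flat_volume (support_face P u)) * indicator A u)"
    by (auto simp: countably_additive_def suminf_sum suminf_indicator)
qed

lemma orthonormal_basis_of_exists: "\<exists>B. orthonormal_basis_of (span S) B"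
  using orthonormal_basis_subspace[OF subspace_span[of S]]
  unfolding orthonormal_basis_of_def by metis

lemma support_function_nonneg:
  assumes "P \<in> polytopes_o"
  shows "0 \<le> support_function P u"
proof -
  have "compact ((\<lambda>y. u \<bullet> y) ` P)"
    using assms by (intro compact_continuous_image continuous_intros)
      (auto simp: polytopes_o_def polytope_imp_compact)
  then have "bdd_above ((\<lambda>y. u \<bullet> y) ` P)"
    by (simp add: bounded_imp_bdd_above compact_imp_bounded)
  then have "u \<bullet> 0 \<le> support_function P u"
    unfolding support_function_def using assms
    by (intro cSUP_upper) (auto simp: polytopes_o_def)
  then show ?thesis by simp
qed

text \<open>In particular, the sum defining the \<open>L\<^sub>p\<close> surface area measure is a finite one.\<close>

lemma finite_facet_normals_off_o:
  fixes P :: "(real ^ 'n) set"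
  assumes "P \<in> polytopes_o"
  shows "finite (facet_normals_off_o P)"
proof (rule inj_on_finite)
  show "finite {F. F face_of P}"
    using assms by (simp add: polytopes_o_def finite_polytope_faces)
  show "support_face P ` facet_normals_off_o P \<subseteq> {F. F face_of P}"
    by (auto simp: facet_normals_off_o_def)
  show "inj_on (support_face P) (facet_normals_off_o P)"
  proof (rule inj_onI)
    fix u v assume u: "u \<in> facet_normals_off_o P" and v: "v \<in> facet_normals_off_o P"
      and eq: "support_face P u = support_face P v"
    have hull: "affine hull support_face P w = {x. w \<bullet> x = support_function P w}"
      and pos: "support_function P w > 0" and nw: "norm w = 1"
      if "w \<in> facet_normals_off_o P" for w
    proof -
      have w: "norm w = 1" "aff_dim (support_face P w) = int CARD('n) - 1" "0 \<notin> support_face P w"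
        using that by (auto simp: facet_normals_off_o_def)
      have "support_face P w \<noteq> {}"
        using w(2) by auto
      moreover have "aff_dim {x. w \<bullet> x = support_function P w} = int CARD('n) - 1"
        using w(1) by (subst aff_dim_hyperplane) auto
      moreover have "affine hull support_face P w \<subseteq> {x. w \<bullet> x = support_function P w}"
        by (rule hull_minimal) (auto simp: support_face_def affine_hyperplane)
      ultimately show "affine hull support_face P w = {x. w \<bullet> x = support_function P w}"
        using w(2) by (intro affine_dim_equal) (auto simp: affine_hyperplane aff_dim_affine_hull)
      have "0 \<in> P" using assms by (simp add: polytopes_o_def)
      then have "support_function P w \<noteq> 0"
        using w(3) by (auto simp: support_face_def)
      then show "support_function P w > 0"
        using support_function_nonneg[OF assms, of w] by linarith
      show "norm w = 1" by (fact w(1))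
    qed
    define h where "h = support_function P u"
    define k where "k = support_function P v"
    have pos: "h > 0" "k > 0" using pos u v by (auto simp: h_def k_def)
    have hyp: "u \<bullet> x = h \<longleftrightarrow> v \<bullet> x = k" for x
    proof -
      have "{x. u \<bullet> x = h} = {x. v \<bullet> x = k}"
        unfolding h_def k_def using hull[OF u] hull[OF v] eq by simp
      then show ?thesis by (simp add: set_eq_iff)
    qed
    have uu: "u \<bullet> u = 1" and vv: "v \<bullet> v = 1"
      using nw[OF u] nw[OF v] by (simp_all add: dot_square_norm)
    have 1: "h * (u \<bullet> v) = k"
      using hyp[of "h *\<^sub>R u"] uu by (simp add: inner_commute)
    have 2: "k * (u \<bullet> v) = h"
      using hyp[of "k *\<^sub>R v"] vv by simp
    have "u \<bullet> v > 0" using 1 pos zero_less_mult_pos[of h "u \<bullet> v"] by simp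
    moreover have "(u \<bullet> v) * (u \<bullet> v) = 1"
    proof -
      have "h * ((u \<bullet> v) * (u \<bullet> v)) = h" using 1 2 by (simp flip: mult.assoc)
      then show ?thesis using pos by simp
    qed
    ultimately have "u \<bullet> v = 1"
      by (simp add: square_eq_1_iff)
    then have "(u - v) \<bullet> (u - v) = 0"
      using uu vv by (simp add: inner_diff inner_commute)
    then show "u = v" by simp
  qed
qed

end

theory Submission imports Defs begin

text \<open>
  A discrete measure on the sphere is determined by its atoms. Writing
  \<open>m P a = |a| powr (- p) * \<mu>(P, {a / |a|})\<close> for \<open>a \<noteq> 0\<close>, contravariance of degree \<open>p\<close> becomes
  \<open>m (\<phi> P) a = m P (\<phi>\<^sup>t a)\<close>: the vector \<open>a\<close> transforms like the linear functional of a facet equation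
  \<open>a \<bullet> x = 1\<close>. The whole argument concerns such families of atoms (locale \<open>centroaffine_atoms\<close>).

  The \<open>L\<^sub>p\<close> surface area measure fits into this picture because a facet \<open>F\<close> at distance \<open>h\<close> from the
  origin satisfies \<open>h * V(F) = n * vol(cone over F)\<close> (\<open>cone_volume\<close>). So, up to the factor \<open>n\<close>, its
  atom in direction \<open>a\<close> is a power of the support function times a cone volume. Linear maps of determinant
  \<open>1\<close> preserve cone volumes, and if \<open>P \<union> Q\<close> is convex then the support faces of \<open>P \<union> Q\<close> and
  \<open>P \<inter> Q\<close> are those of \<open>P\<close> and \<open>Q\<close>, or else their union and intersection. Hence the cone atoms form a
  family of the required kind (\<open>cone_atoms\<close>), and so do nonnegative combinations of the cone atoms of
  \<open>P\<close> and \<open>- P\<close>. This gives one direction of the theorem.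

  For the other direction it suffices that a family of atoms is determined by two numbers
  (\<open>centroaffine_atoms_unique\<close>). Cuts by hyperplanes through the origin reduce everything to simplices
  with a vertex at the origin (\<open>zero_if_zero_on_simplices\<close>). On these, discreteness is used through
  transvections: a one-parameter group of transvections that fixes a lower-dimensional simplex, or that
  slides a simplex inside a larger one, moves an atom along a line; a nonzero atom would thus produce
  uncountably many atoms of one measure. What survives are atoms orthogonal to a simplex of dimension
  \<open>n - 1\<close> and atoms at positive or negative multiples of the normal of the facet opposite to the origin of
  a simplex of dimension \<open>n\<close>. The former vanish: bisecting an edge splits the simplex into two copies
  whose atoms are both \<open>2 powr (- p)\<close> times the original one, and \<open>2 * 2 powr (- p) \<noteq> 1\<close> as \<open>p \<noteq> 1\<close>.
  The latter depend on the determinant of the simplex only, and cutting the simplex shows that they do so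
  additively; being nonnegative, they are linear in the determinant. The two signs of the normal leave
  two free constants, which are matched by the cone atoms of \<open>P\<close> and of \<open>- P\<close>.
\<close>

section \<open>Cutting polytopes into simplices\<close>

text \<open>The cells of an arrangement of hyperplanes through the origin: \<open>D\<close> fixes a sign for each functional of the
  arrangement, and listing both \<open>c\<close> and \<open>- c\<close> selects the hyperplane itself.\<close>

definition cell :: "(real ^ 'n) set \<Rightarrow> (real ^ 'n) set" where
  "cell D = {x. \<forall>d\<in>D. d \<bullet> x \<le> 0}"

lemma cell_Un: "cell (D \<union> E) = cell D \<inter> cell E"
  by (auto simp: cell_def)

lemma zero_in_cell: "0 \<in> cell D"
  by (simp add: cell_def)

lemma polyhedron_shifted_cell:
  assumes "finite D"
  shows "polyhedron {x. x - v \<in> cell D}"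
proof -
  have "{x. x - v \<in> cell D} = (\<Inter>d\<in>D. {x. d \<bullet> x \<le> d \<bullet> v})"
    by (auto simp: cell_def inner_diff_right)
  then show ?thesis
    using assms by (auto intro!: polyhedron_Inter simp: polyhedron_halfspace_le)
qed

lemma polyhedron_cell: "finite D \<Longrightarrow> polyhedron (cell D)"
  using polyhedron_shifted_cell[of D 0] by simp

lemma convex_cell: "convex (cell D)"
  unfolding convex_alt cell_def
  by (auto simp: inner_add_right mult_nonneg_nonpos intro!: add_nonpos_nonpos)

lemma polytopes_o_Int_cell:
  "P \<in> polytopes_o \<Longrightarrow> finite D \<Longrightarrow> P \<inter> cell D \<in> polytopes_o"
  by (auto simp: polytopes_o_def zero_in_cell intro: polytope_Int_polyhedron polyhedron_cell)

lemma hull_in_polytopes_o: "finite V \<Longrightarrow> convex hull insert 0 V \<in> polytopes_o"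
  by (auto simp: polytopes_o_def polytope_def hull_inc intro!: exI[of _ "insert 0 V"])

text \<open>A cut through \<open>W\<close> of the join of \<open>W\<close> and \<open>K\<close> cuts \<open>K\<close> only: a point of the join is a convex combination
  of a point on which all functionals of \<open>D\<close> vanish and a point of \<open>K\<close>, so their signs are decided by the
  latter.\<close>

lemma join_Int_cell:
  assumes "convex K" and W: "\<And>d w. d \<in> D \<Longrightarrow> w \<in> W \<Longrightarrow> d \<bullet> w = 0"
  shows "convex hull (W \<union> K) \<inter> cell D = convex hull (W \<union> (K \<inter> cell D))"
proof
  have hW: "d \<bullet> s = 0" if "d \<in> D" "s \<in> convex hull W" for d s
  proof -
    have "convex hull W \<subseteq> {x. d \<bullet> x = 0}"
      using W that(1) by (intro hull_minimal convex_hyperplane) auto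
    then show ?thesis using that(2) by auto
  qed
  have "W \<subseteq> cell D" using W by (auto simp: cell_def)
  then have "convex hull (W \<union> (K \<inter> cell D)) \<subseteq> cell D"
    by (intro hull_minimal convex_cell) auto
  moreover have "convex hull (W \<union> (K \<inter> cell D)) \<subseteq> convex hull (W \<union> K)"
    by (intro hull_mono) auto
  ultimately show "convex hull (W \<union> (K \<inter> cell D)) \<subseteq> convex hull (W \<union> K) \<inter> cell D"
    by blast
  show "convex hull (W \<union> K) \<inter> cell D \<subseteq> convex hull (W \<union> (K \<inter> cell D))"
  proof
    fix x assume x: "x \<in> convex hull (W \<union> K) \<inter> cell D"
    show "x \<in> convex hull (W \<union> (K \<inter> cell D))"
    proof (cases "W = {} \<or> K = {}")
      case True
      then show ?thesis
        using x \<open>convex K\<close> by (auto simp: hull_same convex_Int convex_cell)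
    next
      case False
      have "convex hull (W \<union> K) = convex hull (convex hull W \<union> K)"
        by (metis Un_commute hull_Un_left)
      then obtain u t s k where u: "u \<ge> 0" "t \<ge> 0" "u + t = 1" "s \<in> convex hull W" "k \<in> K"
        and xeq: "x = u *\<^sub>R s + t *\<^sub>R k"
        using x convex_hull_union_two[of "convex hull W" K] False \<open>convex K\<close> by auto
      have s: "s \<in> convex hull (W \<union> (K \<inter> cell D))"
        using u(4) hull_mono[of W "W \<union> (K \<inter> cell D)"] by blast
      show ?thesis
      proof (cases "t = 0")
        case True
        then show ?thesis using s xeq u by simp
      next
        case nz: False
        have "d \<bullet> k \<le> 0" if "d \<in> D" for d
        proof -
          have "t * (d \<bullet> k) \<le> 0"
            using x that hW[OF that u(4)] by (auto simp: xeq cell_def inner_add_right)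
          then show ?thesis using nz u(2) by (simp add: mult_le_0_iff)
        qed
        then have "k \<in> convex hull (W \<union> (K \<inter> cell D))"
          using u(5) by (intro hull_inc) (auto simp: cell_def)
        then show ?thesis
          unfolding xeq using s u by (intro convexD[OF convex_convex_hull])
      qed
    qed
  qed
qed

text \<open>The valuation property for the two parts of \<open>P\<close> on either side of a hyperplane through the origin. These
  are the only instances that the reduction to simplices needs.\<close>

definition cut_additive :: "((real ^ 'n) set \<Rightarrow> real) \<Rightarrow> bool" where
  "cut_additive Z \<longleftrightarrow> (\<forall>P\<in>polytopes_o. \<forall>c.
     Z P + Z (P \<inter> cell {c, - c}) = Z (P \<inter> cell {c}) + Z (P \<inter> cell {- c}))"

text \<open>Cutting successively by the hyperplanes orthogonal to the members of \<open>C\<close> leaves pieces on which none of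
  these functionals changes sign; the lower-dimensional pieces are those where \<open>D\<close> contains some \<open>c\<close>
  together with \<open>- c\<close>.\<close>

lemma zero_if_zero_on_cells:
  assumes "cut_additive Z" "finite C" "P \<in> polytopes_o"
    and "\<And>D. D \<subseteq> C \<union> uminus ` C \<Longrightarrow> \<forall>c\<in>C. c \<in> D \<or> - c \<in> D \<Longrightarrow> Z (P \<inter> cell D) = 0"
  shows "Z P = 0"
  using assms(2-)
proof (induction C arbitrary: P)
  case empty
  then show ?case by (auto simp: cell_def)
next
  case (insert c C)
  have "Z (P \<inter> cell E) = 0" if E: "E \<subseteq> {c, - c}" "E \<noteq> {}" for E
  proof (rule insert.IH)
    show "P \<inter> cell E \<in> polytopes_o"
      using E insert.prems by (intro polytopes_o_Int_cell) (auto intro: finite_subset)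
    fix D assume D: "D \<subseteq> C \<union> uminus ` C" "\<forall>c\<in>C. c \<in> D \<or> - c \<in> D"
    have "Z (P \<inter> cell (E \<union> D)) = 0"
      using D E by (intro insert.prems) auto
    then show "Z (P \<inter> cell E \<inter> cell D) = 0"
      by (simp add: cell_Un Int_assoc)
  qed
  then have "Z (P \<inter> cell {c}) = 0" "Z (P \<inter> cell {- c}) = 0" "Z (P \<inter> cell {c, - c}) = 0"
    by auto
  moreover have "Z P + Z (P \<inter> cell {c, - c}) = Z (P \<inter> cell {c}) + Z (P \<inter> cell {- c})"
    using assms(1) insert.prems(1) unfolding cut_additive_def by blast
  ultimately show ?case by simp
qed

lemma finite_total_preorder_has_greatest:
  assumes "finite I" "I \<noteq> {}"
    and "\<And>i j. i \<in> I \<Longrightarrow> j \<in> I \<Longrightarrow> R i j \<or> R j i"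
    and "\<And>i j k. R i j \<Longrightarrow> R j k \<Longrightarrow> R i k"
  shows "\<exists>m\<in>I. \<forall>i\<in>I. R i m"
  using assms(1,2,3)
proof (induction I rule: finite_ne_induct)
  case (insert x F)
  then obtain m where m: "m \<in> F" "\<forall>i\<in>F. R i m" by blast
  show ?case
  proof (cases "R x m")
    case False
    then have "R m x" using insert.prems m by blast
    moreover have "R x x" using insert.prems by blast
    ultimately show ?thesis using m assms(4) by blast
  qed (use m in blast)
qed blast

lemma bounded_contains_no_ray:
  fixes v w :: "'a :: real_normed_vector"
  assumes "bounded K" "\<And>t. t \<ge> 0 \<Longrightarrow> v + t *\<^sub>R w \<in> K"
  shows "w = 0"
proof (rule ccontr)
  assume "w \<noteq> 0"
  obtain B where B: "\<And>x. x \<in> K \<Longrightarrow> norm x \<le> B"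
    using assms(1) by (auto simp: bounded_iff)
  define t where "t = (\<bar>B\<bar> + norm v + 1) / norm w"
  have "t \<ge> 0" by (simp add: t_def)
  have "norm (t *\<^sub>R w) \<le> norm (v + t *\<^sub>R w) + norm v"
    by (metis add_diff_cancel_left' norm_triangle_ineq4)
  also have "\<dots> \<le> B + norm v" using B[OF assms(2)[OF \<open>t \<ge> 0\<close>]] by simp
  finally show False using \<open>w \<noteq> 0\<close> \<open>t \<ge> 0\<close> by (simp add: t_def)
qed

text \<open>Write \<open>K\<close> as \<open>g \<bullet> (x - v) \<le> 1\<close> for finitely many \<open>g\<close> together with homogeneous inequalities at \<open>v\<close>.
  Cutting by all hyperplanes \<open>(g - g') \<bullet> (x - v) = 0\<close> through \<open>v\<close> makes one \<open>g\<close> dominate on each cell, and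
  then only this inequality limits the cell: it is a pyramid with apex \<open>v\<close> and base in \<open>g \<bullet> (x - v) = 1\<close>. The base is empty when
  the cell is just \<open>{v}\<close>.\<close>

lemma fan_dissection:
  fixes K :: "(real ^ 'n) set"
  assumes "polytope K" "v \<in> K"
  obtains C where "finite C"
    and "\<And>D. D \<subseteq> C \<union> uminus ` C \<Longrightarrow> \<forall>c\<in>C. c \<in> D \<or> - c \<in> D \<Longrightarrow>
          \<exists>K' a. polytope K' \<and> K' \<subseteq> K \<and> (\<forall>x\<in>K'. a \<bullet> (x - v) = 1) \<and>
                 K \<inter> {x. x - v \<in> cell D} = convex hull insert v K'"
proof -
  obtain F where F: "finite F" "K = \<Inter>F" "\<forall>h\<in>F. \<exists>a b. a \<noteq> 0 \<and> h = {x. a \<bullet> x \<le> b}"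
    using polytope_imp_polyhedron[OF assms(1)] unfolding polyhedron_def by blast
  then obtain a b where ab: "\<And>h. h \<in> F \<Longrightarrow> h = {x. a h \<bullet> x \<le> b h}"
    by metis
  define \<beta> where "\<beta> h = b h - a h \<bullet> v" for h
  have inK: "x \<in> K \<longleftrightarrow> (\<forall>h\<in>F. a h \<bullet> (x - v) \<le> \<beta> h)" for x
    using ab unfolding F(2) \<beta>_def inner_diff_right by auto
  have \<beta>: "\<beta> h \<ge> 0" if "h \<in> F" for h
    using assms(2) that inK by force
  define I where "I = {h \<in> F. \<beta> h > 0}"
  define g where "g h = (1 / \<beta> h) *\<^sub>R a h" for h
  have inK: "x \<in> K \<longleftrightarrow> (\<forall>h\<in>I. g h \<bullet> (x - v) \<le> 1) \<and> (\<forall>h\<in>F - I. a h \<bullet> (x - v) \<le> 0)" for x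
    unfolding inK using \<beta> by (force simp: I_def g_def pos_divide_le_eq not_less)
  define C where "C = (\<lambda>(h, k). g h - g k) ` (I \<times> I)"
  have "finite I" using F(1) by (simp add: I_def)
  show thesis
  proof (rule that)
    show "finite C" using \<open>finite I\<close> by (simp add: C_def)
    fix D assume D: "D \<subseteq> C \<union> uminus ` C" "\<forall>c\<in>C. c \<in> D \<or> - c \<in> D"
    have "finite D" using D(1) \<open>finite C\<close> by (auto intro: finite_subset)
    define X where "X = K \<inter> {x. x - v \<in> cell D}"
    have "polytope X"
      unfolding X_def using assms(1) \<open>finite D\<close> by (intro polytope_Int_polyhedron polyhedron_shifted_cell)
    have vX: "v \<in> X" using assms(2) by (simp add: X_def zero_in_cell)
    \<comment> \<open>On the cell the functionals \<open>g h\<close> are linearly ordered, so one of them dominates.\<close>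
    have total: "(\<forall>x\<in>X. g h \<bullet> (x - v) \<le> g k \<bullet> (x - v)) \<or> (\<forall>x\<in>X. g k \<bullet> (x - v) \<le> g h \<bullet> (x - v))"
      if "h \<in> I" "k \<in> I" for h k
    proof -
      have "g h - g k \<in> C" using that by (auto simp: C_def)
      with D(2) have "g h - g k \<in> D \<or> g k - g h \<in> D" by fastforce
      then show ?thesis by (auto simp: X_def cell_def inner_diff_left)
    qed
    obtain m where m: "I \<noteq> {} \<Longrightarrow> m \<in> I \<and> (\<forall>h\<in>I. \<forall>x\<in>X. g h \<bullet> (x - v) \<le> g m \<bullet> (x - v))"
    proof (cases "I = {}")
      case False
      then have "\<exists>m\<in>I. \<forall>h\<in>I. \<forall>x\<in>X. g h \<bullet> (x - v) \<le> g m \<bullet> (x - v)"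
        using \<open>finite I\<close> total by (intro finite_total_preorder_has_greatest) (blast intro: order_trans)+
      then show ?thesis using that by blast
    qed (use that in blast)
    define K' where "K' = (if I = {} then {} else X \<inter> {x. g m \<bullet> x = g m \<bullet> v + 1})"
    have "polytope K'"
      using \<open>polytope X\<close> polytope_Int_polyhedron[OF _ polyhedron_hyperplane]
      by (simp add: K'_def) (auto simp: polytope_def)
    moreover have "K' \<subseteq> X" by (auto simp: K'_def)
    moreover have "\<forall>x\<in>K'. g m \<bullet> (x - v) = 1" by (auto simp: K'_def inner_diff_right split: if_splits)
    moreover have "X = convex hull insert v K'"
    proof
      show "convex hull insert v K' \<subseteq> X"
        using vX \<open>K' \<subseteq> X\<close> \<open>polytope X\<close> by (intro hull_minimal) (auto simp: polytope_imp_convex)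
      show "X \<subseteq> convex hull insert v K'"
      proof
        fix x assume x: "x \<in> X"
        show "x \<in> convex hull insert v K'"
        proof (cases "x = v")
          case True
          then show ?thesis by (simp add: hull_inc)
        next
          case False
          have aF: "a h \<bullet> (x - v) \<le> 0" if "h \<in> F - I" for h
            using x that inK by (auto simp: X_def)
          have "\<exists>h\<in>I. g h \<bullet> (x - v) > 0"
          proof (rule ccontr)
            assume neg: "\<not> ?thesis"
            have "v + t *\<^sub>R (x - v) \<in> K" if "t \<ge> 0" for t
            proof -
              have "t * (g h \<bullet> (x - v)) \<le> 1" if "h \<in> I" for h
                using neg that \<open>t \<ge> 0\<close> by (meson mult_nonneg_nonpos not_less order_trans zero_le_one)
              moreover have "t * (a h \<bullet> (x - v)) \<le> 0" if "h \<in> F - I" for h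
                using aF[OF that] \<open>t \<ge> 0\<close> by (simp add: mult_nonneg_nonpos)
              ultimately show ?thesis unfolding inK by simp
            qed
            then have "x - v = 0"
              using polytope_imp_bounded[OF assms(1)] by (intro bounded_contains_no_ray)
            then show False using False by simp
          qed
          then obtain h where h: "h \<in> I" "g h \<bullet> (x - v) > 0" by blast
          then have "I \<noteq> {}" by blast
          note m = m[OF this]
          define s where "s = g m \<bullet> (x - v)"
          have s0: "s > 0" using m h x unfolding s_def by (meson less_le_trans)
          have s1: "s \<le> 1" using m x inK by (auto simp: s_def X_def)
          define y where "y = v + (1 / s) *\<^sub>R (x - v)"
          have "y \<in> X"
          proof -
            have "g k \<bullet> (y - v) \<le> 1" if "k \<in> I" for k
              using m x that s0 by (simp add: y_def s_def pos_divide_le_eq)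
            moreover have "a k \<bullet> (y - v) \<le> 0" if "k \<in> F - I" for k
              using aF[OF that] s0 by (simp add: y_def divide_nonpos_pos)
            moreover have "y - v \<in> cell D"
              using x s0 by (auto simp: X_def cell_def y_def divide_nonpos_pos)
            ultimately show ?thesis unfolding X_def using inK by blast
          qed
          moreover have "g m \<bullet> y = g m \<bullet> v + 1"
            using s0 by (simp add: y_def inner_add_right flip: s_def)
          ultimately have "y \<in> K'" using \<open>I \<noteq> {}\<close> by (simp add: K'_def)
          have "x = (1 - s) *\<^sub>R v + s *\<^sub>R y"
            using s0 by (simp add: y_def algebra_simps)
          also have "\<dots> \<in> convex hull insert v K'"
            using s0 s1 \<open>y \<in> K'\<close>
            by (intro convexD_alt[OF convex_convex_hull]) (auto simp: hull_inc)
          finally show ?thesis .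
        qed
      qed
    qed
    ultimately show "\<exists>K' a. polytope K' \<and> K' \<subseteq> K \<and> (\<forall>x\<in>K'. a \<bullet> (x - v) = 1) \<and>
                 K \<inter> {x. x - v \<in> cell D} = convex hull insert v K'"
      unfolding X_def by blast
  qed
qed

text \<open>\<open>S\<close> and \<open>K\<close> are in such general position that every affine function on \<open>K\<close> is the restriction of a
  linear functional vanishing on \<open>S\<close>. Thus all hyperplane cuts of \<open>K\<close> extend to cuts of the join of
  \<open>K\<close> with the origin and \<open>S\<close>.\<close>

definition affinely_free_over :: "(real ^ 'n) set \<Rightarrow> (real ^ 'n) set \<Rightarrow> bool" where
  "affinely_free_over S K \<longleftrightarrow>
     (\<forall>c \<beta>. \<exists>e. (\<forall>s\<in>S. e \<bullet> s = 0) \<and> (\<forall>x\<in>K. e \<bullet> x = c \<bullet> x + \<beta>))"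

lemma polytope_zero_join_in_polytopes_o:
  assumes "finite S" "polytope K"
  shows "convex hull insert 0 (S \<union> K) \<in> polytopes_o"
proof -
  obtain V where "finite V" "K = convex hull V" using assms(2) by (auto simp: polytope_def)
  moreover have "convex hull insert 0 (S \<union> convex hull V) = convex hull insert 0 (S \<union> V)"
    by (metis Un_insert_left hull_Un_right)
  ultimately show ?thesis
    using assms(1) hull_in_polytopes_o[of "S \<union> V"] by simp
qed

text \<open>A fan dissection of \<open>K\<close> at one of its points \<open>v\<close> splits the join of \<open>0\<close>, \<open>S\<close> and \<open>K\<close> into joins
  with \<open>v\<close> moved from \<open>K\<close> to \<open>S\<close>. As \<open>S\<close> stays independent, this ends after at most \<open>n\<close> steps, with
  \<open>K\<close> empty and the join a simplex.\<close>

lemma zero_on_joins: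
  fixes Z :: "(real ^ 'n) set \<Rightarrow> real"
  assumes cut: "cut_additive Z"
    and simplex: "\<And>B. independent B \<Longrightarrow> Z (convex hull insert 0 B) = 0"
    and "independent S" "polytope K" "affinely_free_over S K"
  shows "Z (convex hull insert 0 (S \<union> K)) = 0"
  using assms(3-)
proof (induction "CARD('n) - card S" arbitrary: S K rule: less_induct)
  case less
  show ?case
  proof (cases "K = {}")
    case True
    then show ?thesis using simplex less.prems by simp
  next
    case False
    then obtain v where v: "v \<in> K" by blast
    have "finite S" using less.prems(1) by (rule independent_imp_finite)
    obtain e where e: "\<forall>s\<in>S. e \<bullet> s = 0" "\<forall>x\<in>K. e \<bullet> x = 0 \<bullet> x + 1"
      using less.prems(3) unfolding affinely_free_over_def by blast
    have "v \<notin> span S"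
    proof
      assume "v \<in> span S"
      then have "e \<bullet> v = 0"
        using e(1) span_induct[of v S "\<lambda>x. e \<bullet> x = 0"] by (auto simp: subspace_hyperplane)
      then show False using e(2) v by simp
    qed
    then have indep: "independent (insert v S)" and "v \<notin> S"
      using less.prems(1) by (auto simp: independent_insert span_base)
    have smaller: "CARD('n) - card (insert v S) < CARD('n) - card S"
    proof -
      have "card (insert v S) \<le> CARD('n)"
        using independent_bound[OF indep] by simp
      then show ?thesis using \<open>finite S\<close> \<open>v \<notin> S\<close> by simp
    qed
    obtain C where C: "finite C"
      and fan: "\<And>D. D \<subseteq> C \<union> uminus ` C \<Longrightarrow> \<forall>c\<in>C. c \<in> D \<or> - c \<in> D \<Longrightarrow>
          \<exists>K' a. polytope K' \<and> K' \<subseteq> K \<and> (\<forall>x\<in>K'. a \<bullet> (x - v) = 1) \<and>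
                 K \<inter> {x. x - v \<in> cell D} = convex hull insert v K'"
      using fan_dissection[OF less.prems(2) v] by metis
    have "\<exists>e. (\<forall>s\<in>S. e \<bullet> s = 0) \<and> (\<forall>x\<in>K. e \<bullet> x = c \<bullet> x + - (c \<bullet> v))" for c
      using less.prems(3) unfolding affinely_free_over_def by blast
    then obtain ext where ext: "\<And>c s. s \<in> S \<Longrightarrow> ext c \<bullet> s = 0"
      "\<And>c x. x \<in> K \<Longrightarrow> ext c \<bullet> x = c \<bullet> (x - v)"
      by (simp add: inner_diff_right) metis
    show ?thesis
    proof (rule zero_if_zero_on_cells[OF cut, of "ext ` C"])
      show "finite (ext ` C)" using C by simp
      show "convex hull insert 0 (S \<union> K) \<in> polytopes_o"
        using \<open>finite S\<close> less.prems(2) by (rule polytope_zero_join_in_polytopes_o)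
      fix E assume E: "E \<subseteq> ext ` C \<union> uminus ` ext ` C" "\<forall>c\<in>ext ` C. c \<in> E \<or> - c \<in> E"
      define D where "D = {c \<in> C. ext c \<in> E} \<union> {- c | c. c \<in> C \<and> - ext c \<in> E}"
      have "\<exists>K' a. polytope K' \<and> K' \<subseteq> K \<and> (\<forall>x\<in>K'. a \<bullet> (x - v) = 1) \<and>
                 K \<inter> {x. x - v \<in> cell D} = convex hull insert v K'"
        using E(2) by (intro fan) (auto simp: D_def)
      then obtain K' a where K': "polytope K'" "K' \<subseteq> K" "\<forall>x\<in>K'. a \<bullet> (x - v) = 1"
        "K \<inter> {x. x - v \<in> cell D} = convex hull insert v K'" by blast
      have "K \<inter> cell E = K \<inter> {x. x - v \<in> cell D}"
      proof -
        have "x \<in> cell E \<longleftrightarrow> x - v \<in> cell D" if x: "x \<in> K" for x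
        proof
          assume "x \<in> cell E"
          then show "x - v \<in> cell D"
            using ext(2)[OF x] by (force simp: cell_def D_def)
        next
          assume xD: "x - v \<in> cell D"
          show "x \<in> cell E"
            unfolding cell_def
          proof clarify
            fix f assume f: "f \<in> E"
            then consider c where "c \<in> C" "f = ext c" | c where "c \<in> C" "f = - ext c"
              using E(1) by blast
            then show "f \<bullet> x \<le> 0"
            proof cases
              case 1
              then have "c \<in> D" using f by (simp add: D_def)
              then show ?thesis using xD 1 ext(2)[OF x] by (simp add: cell_def)
            next
              case 2
              then have "- c \<in> D" using f by (auto simp: D_def)
              then have "- c \<bullet> (x - v) \<le> 0" using xD by (simp only: cell_def mem_Collect_eq)
              then show ?thesis using 2 ext(2)[OF x] by simp
            qed
          qed
        qed
        then show ?thesis by blast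
      qed
      moreover have "convex hull insert 0 (S \<union> K) \<inter> cell E = convex hull (insert 0 S \<union> (K \<inter> cell E))"
        using join_Int_cell[of K E "insert 0 S"] E(1) ext(1) polytope_imp_convex[OF less.prems(2)]
        by fastforce
      moreover have "convex hull (insert 0 S \<union> convex hull insert v K') = convex hull insert 0 (insert v S \<union> K')"
        using hull_Un_right[of convex "insert 0 S" "insert v K'"] by (simp add: insert_commute)
      moreover have "Z (convex hull insert 0 (insert v S \<union> K')) = 0"
      proof (rule less.hyps[OF smaller indep K'(1)])
        show "affinely_free_over (insert v S) K'"
          unfolding affinely_free_over_def
        proof (intro allI)
          fix c \<beta>
          \<comment> \<open>On \<open>K'\<close> the affine function \<open>c \<bullet> x + \<beta>\<close> may be changed by a multiple of
            \<open>1 - a \<bullet> (x - v)\<close>, which makes it vanish at \<open>v\<close>.\<close>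
          define \<gamma> where "\<gamma> = c \<bullet> v + \<beta>"
          obtain e where e: "\<forall>s\<in>S. e \<bullet> s = 0"
            "\<forall>x\<in>K. e \<bullet> x = (c + \<gamma> *\<^sub>R a) \<bullet> x + (\<beta> - \<gamma> - \<gamma> * (a \<bullet> v))"
            using less.prems(3) unfolding affinely_free_over_def by blast
          have "e \<bullet> v = 0" using e(2) v by (simp add: \<gamma>_def inner_add_left)
          moreover have "e \<bullet> x = c \<bullet> x + \<beta>" if "x \<in> K'" for x
          proof -
            have "a \<bullet> x = 1 + a \<bullet> v"
              using bspec[OF K'(3) that] by (simp add: inner_diff_right)
            moreover have "e \<bullet> x = (c + \<gamma> *\<^sub>R a) \<bullet> x + (\<beta> - \<gamma> - \<gamma> * (a \<bullet> v))"
              using e(2) K'(2) that by blast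
            ultimately show ?thesis by (simp add: inner_add_left algebra_simps)
          qed
          ultimately show "\<exists>e. (\<forall>s\<in>insert v S. e \<bullet> s = 0) \<and> (\<forall>x\<in>K'. e \<bullet> x = c \<bullet> x + \<beta>)"
            using e(1) by blast
        qed
      qed
      ultimately show "Z (convex hull insert 0 (S \<union> K) \<inter> cell E) = 0"
        using K'(4) by metis
    qed
  qed
qed

text \<open>A fan dissection at the origin replaces \<open>P\<close> by pyramids over polytopes that lie in affine hyperplanes
  missing the origin, which are joins as treated before.\<close>

theorem zero_if_zero_on_simplices:
  fixes Z :: "(real ^ 'n) set \<Rightarrow> real"
  assumes cut: "cut_additive Z"
    and simplex: "\<And>B. independent B \<Longrightarrow> Z (convex hull insert 0 B) = 0"
    and P: "P \<in> polytopes_o"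
  shows "Z P = 0"
proof -
  have P': "polytope P" "0 \<in> P" using P by (auto simp: polytopes_o_def)
  obtain C where C: "finite C"
      and fan: "\<And>D. D \<subseteq> C \<union> uminus ` C \<Longrightarrow> \<forall>c\<in>C. c \<in> D \<or> - c \<in> D \<Longrightarrow>
          \<exists>K' a. polytope K' \<and> K' \<subseteq> P \<and> (\<forall>x\<in>K'. a \<bullet> (x - 0) = 1) \<and>
                 P \<inter> {x. x - 0 \<in> cell D} = convex hull insert 0 K'"
    using fan_dissection[OF P'] by metis
  show ?thesis
  proof (rule zero_if_zero_on_cells[OF cut C P])
    fix D assume "D \<subseteq> C \<union> uminus ` C" "\<forall>c\<in>C. c \<in> D \<or> - c \<in> D"
    from fan[OF this] obtain K' a where K': "polytope K'" "\<forall>x\<in>K'. a \<bullet> x = 1"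
      "P \<inter> cell D = convex hull insert 0 K'" by auto
    have "affinely_free_over {} K'"
      unfolding affinely_free_over_def
    proof (intro allI)
      fix c \<beta>
      show "\<exists>e. (\<forall>s\<in>{}. e \<bullet> s = 0) \<and> (\<forall>x\<in>K'. e \<bullet> x = c \<bullet> x + \<beta>)"
        using K'(2) by (intro exI[of _ "c + \<beta> *\<^sub>R a"]) (simp add: inner_add_left)
    qed
    then have "Z (convex hull insert 0 ({} \<union> K')) = 0"
      using K'(1) by (intro zero_on_joins[OF cut simplex] independent_empty)
    then show "Z (P \<inter> cell D) = 0" using K'(3) by simp
  qed
qed

section \<open>Rank-one updates and subdivided simplices\<close>

text \<open>The matrix of \<open>x \<mapsto> x + (\<xi> \<bullet> x) w\<close>. If \<open>w\<close> and \<open>\<xi>\<close> are orthogonal, it is a transvection.\<close>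

definition rank_one_update :: "real ^ 'n \<Rightarrow> real ^ 'n \<Rightarrow> real ^ 'n ^ 'n" where
  "rank_one_update w \<xi> = mat 1 + (\<chi> i j. w $ i * \<xi> $ j)"

lemma rank_one_update_mult: "rank_one_update w \<xi> *v x = x + (\<xi> \<bullet> x) *\<^sub>R w"
proof -
  have "(\<chi> i j. w $ i * \<xi> $ j) *v x = (\<xi> \<bullet> x) *\<^sub>R w"
    by (simp add: vec_eq_iff matrix_vector_mult_def inner_vec_def sum_distrib_left sum_distrib_right ac_simps)
  then show ?thesis
    by (simp add: rank_one_update_def matrix_vector_mult_add_rdistrib)
qed

lemma transpose_rank_one_update: "transpose (rank_one_update w \<xi>) = rank_one_update \<xi> w"
  by (simp add: rank_one_update_def transpose_def mat_def vec_eq_iff mult.commute)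

lemma det_rank_one_update:
  fixes w \<xi> :: "real ^ 'n"
  shows "det (rank_one_update w \<xi>) = 1 + w \<bullet> \<xi>"
proof (cases "w = 0")
  case True
  then show ?thesis by (simp add: rank_one_update_def zero_vec_def[symmetric] det_I)
next
  case False
  obtain k :: 'n where True by blast
  obtain A where A: "orthogonal_matrix A" "A *v axis k 1 = sgn w"
    using orthogonal_matrix_exists_basis[of "sgn w" k] False by (auto simp: norm_sgn)
  have tA: "transpose A ** A = mat 1" "A ** transpose A = mat 1"
    using A(1) by (auto simp: orthogonal_matrix_def)
  have dA: "det (transpose A) * det A = 1"
    using tA(1) by (metis det_I det_mul)
  define \<eta> where "\<eta> = norm w *\<^sub>R (transpose A *v \<xi>)"
  \<comment> \<open>In an orthonormal frame containing the direction of \<open>w\<close>, the update changes one row only.\<close>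
  have "transpose A ** rank_one_update w \<xi> ** A = rank_one_update (axis k 1) \<eta>"
  proof (rule matrix_eq[THEN iffD2], rule allI)
    fix x
    have "transpose A *v w = norm w *\<^sub>R axis k 1"
    proof -
      have "transpose A *v sgn w = axis k 1"
        unfolding A(2)[symmetric] by (simp add: matrix_vector_mul_assoc tA)
      moreover have "w = norm w *\<^sub>R sgn w" using False by (simp add: sgn_div_norm)
      ultimately show ?thesis by (metis matrix_vector_mult_scaleR)
    qed
    moreover have "\<xi> \<bullet> (A *v x) = (transpose A *v \<xi>) \<bullet> x"
      by (metis dot_lmul_matrix vector_transpose_matrix transpose_transpose)
    ultimately show "transpose A ** rank_one_update w \<xi> ** A *v x = rank_one_update (axis k 1) \<eta> *v x"
      by (simp add: matrix_vector_mul_assoc[symmetric] rank_one_update_mult matrix_vector_right_distrib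
          matrix_vector_mult_scaleR \<eta>_def del: transpose_matrix_vector)
         (simp add: matrix_vector_mul_assoc tA mult.commute del: transpose_matrix_vector)
  qed
  then have "det (transpose A) * det (rank_one_update w \<xi>) * det A = det (rank_one_update (axis k 1) \<eta>)"
    by (metis det_mul)
  then have 1: "det (rank_one_update w \<xi>) = det (rank_one_update (axis k 1) \<eta>)"
    using dA by (metis mult.assoc mult.commute mult_1)
  have unit_rows: "(\<Sum>j\<in>UNIV. v $ j *s row j (mat 1)) = v" for v :: "real ^ 'n"
    by (simp add: vec_eq_iff row_def mat_def if_distrib[of "\<lambda>t. _ * t"] cong: if_cong)
  have "rank_one_update (axis k 1) \<eta> =
      (\<chi> i. if i = k then \<Sum>j\<in>UNIV. (axis k 1 + \<eta>) $ j *s row j (mat 1) else row i (mat 1))"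
    unfolding unit_rows by (auto simp: rank_one_update_def vec_eq_iff row_def mat_def axis_def)
  then have "det (rank_one_update (axis k 1) \<eta>) = 1 + \<eta> $ k"
    by (simp only: cramer_lemma_transpose det_I) (simp add: axis_def)
  also have "\<eta> $ k = w \<bullet> \<xi>"
  proof -
    have "(transpose A *v \<xi>) $ k = (transpose A *v \<xi>) \<bullet> axis k 1" by (simp add: inner_axis)
    also have "\<dots> = \<xi> \<bullet> sgn w"
      by (metis A(2) dot_lmul_matrix vector_transpose_matrix transpose_transpose)
    finally show ?thesis
      using False by (simp add: \<eta>_def sgn_div_norm inner_commute)
  qed
  finally show ?thesis using 1 by simp
qed

lemma independent_dual_vector:
  fixes B :: "(real ^ 'n) set" and g :: "real ^ 'n \<Rightarrow> real"
  assumes "independent B"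
  shows "\<exists>c. \<forall>b\<in>B. c \<bullet> b = g b"
proof -
  obtain f :: "real ^ 'n \<Rightarrow> real" where f: "linear f" "\<forall>b\<in>B. f b = g b"
    using linear_independent_extend[OF assms] by metis
  have "adjoint f 1 \<bullet> b = f b" for b
    using adjoint_works[OF f(1), of b 1] by (simp add: inner_commute)
  then show ?thesis using f(2) by metis
qed

lemma independent_replace:
  fixes B :: "(real ^ 'n) set"
  assumes "independent B" "x \<in> B" "z = r *\<^sub>R x + s" "r \<noteq> 0" "s \<in> span (B - {x})"
  shows "independent (insert z (B - {x}))" "z \<notin> B - {x}" "card (insert z (B - {x})) = card B"
proof -
  have "finite B" using assms(1) by (rule independent_imp_finite)
  have "x \<notin> span (B - {x})" using assms(1,2) by (auto simp: dependent_def)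
  moreover have "x = (1 / r) *\<^sub>R (z - s)" using assms(3,4) by simp
  ultimately have "z \<notin> span (B - {x})"
    using assms(5) by (metis span_diff span_scale)
  moreover have "independent (B - {x})" using assms(1) by (rule independent_mono) auto
  ultimately show "independent (insert z (B - {x}))" and z: "z \<notin> B - {x}"
    using span_base[of z "B - {x}"] by (auto simp: independent_insert)
  then show "card (insert z (B - {x})) = card B"
    using \<open>finite B\<close> assms(2) by (metis card.remove card_insert_disjoint finite_Diff)
qed

lemma independent_subdivide:
  fixes C :: "(real ^ 'n) set"
  assumes C: "independent C" "u \<in> C" "v \<in> C" "u \<noteq> v"
    and \<theta>: "0 < \<theta>" "\<theta> < 1" and z: "z = (1 - \<theta>) *\<^sub>R u + \<theta> *\<^sub>R v"
  shows "independent (insert z (C - {u}))" "independent (insert z (C - {v}))" "z \<notin> C - {u}" "z \<notin> C - {v}"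
proof -
  have u: "(1 - \<theta>) *\<^sub>R u \<in> span (C - {v})" and v: "\<theta> *\<^sub>R v \<in> span (C - {u})"
    by (rule span_scale, rule span_base, use C in blast)+
  have z': "z = \<theta> *\<^sub>R v + (1 - \<theta>) *\<^sub>R u" using z by (simp add: add.commute)
  show "independent (insert z (C - {u}))" "z \<notin> C - {u}"
    using independent_replace[OF C(1,2) z _ v] \<theta> by auto
  show "independent (insert z (C - {v}))" "z \<notin> C - {v}"
    using independent_replace[OF C(1,3) z' _ u] \<theta> by auto
qed

text \<open>The hyperplane through \<open>z\<close> and all vertices other than \<open>x\<close> and \<open>y\<close> splits the simplex into the two
  simplices in which \<open>z\<close> replaces one end of the edge.\<close>

lemma simplex_cut:
  fixes Z :: "(real ^ 'n) set \<Rightarrow> real"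
  assumes Z: "cut_additive Z" and B: "independent B" "x \<in> B" "y \<in> B" "x \<noteq> y"
    and \<theta>: "0 < \<theta>" "\<theta> < 1" and z: "z = (1 - \<theta>) *\<^sub>R x + \<theta> *\<^sub>R y"
  shows "Z (convex hull insert 0 B) + Z (convex hull insert 0 (insert z (B - {x, y}))) =
    Z (convex hull insert 0 (insert z (B - {x}))) + Z (convex hull insert 0 (insert z (B - {y})))"
proof -
  obtain c where c: "\<forall>b\<in>B. c \<bullet> b = (if b = x then \<theta> else if b = y then \<theta> - 1 else 0)"
    using independent_dual_vector[OF B(1), of "\<lambda>b. if b = x then \<theta> else if b = y then \<theta> - 1 else 0"]
    by blast
  then have cx: "c \<bullet> x = \<theta>" and cy: "c \<bullet> y = \<theta> - 1" using B by auto
  define W where "W = insert 0 (B - {x, y})"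
  have W: "c \<bullet> w = 0" if "w \<in> W" for w using that c by (auto simp: W_def)
  have seg: "c \<bullet> ((1 - t) *\<^sub>R x + t *\<^sub>R y) = \<theta> - t" for t
    by (simp add: inner_add_right cx cy algebra_simps)
  have part: "(1 - t) *\<^sub>R x + t *\<^sub>R y \<in> closed_segment z y" if t: "\<theta> \<le> t" "t \<le> 1" for t
  proof -
    define u where "u = (t - \<theta>) / (1 - \<theta>)"
    have "(1 - u) * (1 - \<theta>) = 1 - t" "(1 - u) * \<theta> + u = t"
      using \<theta> by (auto simp: u_def divide_simps) (simp add: algebra_simps)
    moreover have "(1 - u) *\<^sub>R z + u *\<^sub>R y = ((1 - u) * (1 - \<theta>)) *\<^sub>R x + ((1 - u) * \<theta> + u) *\<^sub>R y"
      by (simp add: z scaleR_add_right scaleR_add_left)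
    ultimately have "(1 - t) *\<^sub>R x + t *\<^sub>R y = (1 - u) *\<^sub>R z + u *\<^sub>R y" by simp
    moreover have "0 \<le> u" "u \<le> 1" using \<theta> t by (auto simp: u_def)
    ultimately show ?thesis unfolding in_segment by blast
  qed
  have part': "(1 - t) *\<^sub>R x + t *\<^sub>R y \<in> closed_segment x z" if t: "t \<le> \<theta>" "0 \<le> t" for t
  proof -
    define u where "u = t / \<theta>"
    have "1 - u + u * (1 - \<theta>) = 1 - t" "u * \<theta> = t"
      using \<theta> by (auto simp: u_def divide_simps) (simp add: algebra_simps)
    moreover have "(1 - u) *\<^sub>R x + u *\<^sub>R z = (1 - u + u * (1 - \<theta>)) *\<^sub>R x + (u * \<theta>) *\<^sub>R y"
      by (simp add: z scaleR_add_right scaleR_add_left)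
    ultimately have "(1 - t) *\<^sub>R x + t *\<^sub>R y = (1 - u) *\<^sub>R x + u *\<^sub>R z" by simp
    moreover have "0 \<le> u" "u \<le> 1" using \<theta> t by (auto simp: u_def)
    ultimately show ?thesis unfolding in_segment by blast
  qed
  have zseg: "z \<in> closed_segment x y"
    using \<theta> less_imp_le unfolding z in_segment by blast
  have cz: "c \<bullet> z = 0" using seg[of \<theta>] z by simp
  have sub: "closed_segment z y \<subseteq> closed_segment x y" "closed_segment x z \<subseteq> closed_segment x y"
    using zseg by (auto simp: subset_closed_segment)
  have 1: "closed_segment x y \<inter> cell {c} = closed_segment z y"
  proof
    show "closed_segment z y \<subseteq> closed_segment x y \<inter> cell {c}"
      using sub cz cy \<theta> by (intro Int_greatest sub closed_segment_subset convex_cell) (auto simp: cell_def)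
    show "closed_segment x y \<inter> cell {c} \<subseteq> closed_segment z y"
      using part by (auto simp: in_segment(1)[of _ x y] cell_def seg)
  qed
  have 2: "closed_segment x y \<inter> cell {- c} = closed_segment x z"
  proof
    show "closed_segment x z \<subseteq> closed_segment x y \<inter> cell {- c}"
      using sub cz cx \<theta> by (intro Int_greatest sub closed_segment_subset convex_cell) (auto simp: cell_def)
    show "closed_segment x y \<inter> cell {- c} \<subseteq> closed_segment x z"
      using part' by (auto simp: in_segment(1)[of _ x y] cell_def seg)
  qed
  have 3: "closed_segment x y \<inter> cell {c, - c} = {z}"
  proof
    show "closed_segment x y \<inter> cell {c, - c} \<subseteq> {z}"
      by (auto simp: in_segment(1)[of _ x y] cell_def seg z)
    show "{z} \<subseteq> closed_segment x y \<inter> cell {c, - c}"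
      using zseg cz by (simp add: cell_def)
  qed
  have hull: "convex hull (W \<union> closed_segment s t) = convex hull (W \<union> {s, t})" for s t
    by (simp add: segment_convex_hull hull_Un_right[symmetric])
  have cell: "convex hull (W \<union> closed_segment x y) \<inter> cell D =
      convex hull (W \<union> (closed_segment x y \<inter> cell D))" if "D \<subseteq> {c, - c}" for D
    using that W by (intro join_Int_cell) auto
  have eqs: "W \<union> {x, y} = insert 0 B" "W \<union> {z, y} = insert 0 (insert z (B - {x}))"
    "W \<union> {x, z} = insert 0 (insert z (B - {y}))" "W \<union> {z} = insert 0 (insert z (B - {x, y}))"
    using B by (auto simp: W_def)
  define J where "J = convex hull insert 0 B"
  have J: "J = convex hull (W \<union> closed_segment x y)"
    unfolding J_def hull eqs ..
  have "J \<in> polytopes_o"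
    unfolding J_def using independent_imp_finite[OF B(1)] by (rule hull_in_polytopes_o)
  then have "Z J + Z (J \<inter> cell {c, - c}) = Z (J \<inter> cell {c}) + Z (J \<inter> cell {- c})"
    using Z unfolding cut_additive_def by blast
  moreover have "J \<inter> cell {c, - c} = convex hull insert 0 (insert z (B - {x, y}))"
    using cell[of "{c, - c}"] unfolding J 3 eqs by blast
  moreover have "J \<inter> cell {c} = convex hull insert 0 (insert z (B - {x}))"
    using cell[of "{c}"] unfolding J 1 hull eqs by blast
  moreover have "J \<inter> cell {- c} = convex hull insert 0 (insert z (B - {y}))"
    using cell[of "{- c}"] unfolding J 2 hull eqs by blast
  ultimately show ?thesis unfolding J_def[symmetric] by simp
qed

lemma linear_image_simplex:
  "(\<lambda>y. (\<phi> :: real ^ 'n ^ 'n) *v y) ` (convex hull insert 0 B) = convex hull insert 0 ((\<lambda>y. \<phi> *v y) ` B)"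
  using convex_hull_linear_image[OF matrix_vector_mul_linear[of \<phi>], of "insert 0 B"] by simp

lemma simplex_in_polytopes_o:
  fixes B :: "(real ^ 'n) set"
  shows "independent B \<Longrightarrow> convex hull insert 0 B \<in> polytopes_o"
  by (simp add: hull_in_polytopes_o independent_imp_finite)

lemma simplex_in_hyperplane:
  fixes B :: "(real ^ 'n) set"
  assumes "\<forall>b\<in>B. \<xi> \<bullet> b = 0" "x \<in> convex hull insert 0 B"
  shows "\<xi> \<bullet> x = 0"
proof -
  have "convex hull insert 0 B \<subseteq> {x. \<xi> \<bullet> x = 0}"
    using assms(1) by (intro hull_minimal convex_hyperplane) auto
  then show ?thesis using assms(2) by auto
qed

section \<open>Families of atoms on lower-dimensional simplices\<close>

text \<open>The properties that the atoms of a discrete \<open>SL(n)\<close> contravariant valuation of degree \<open>p\<close> have once they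
  are extended from the sphere as a homogeneous function of degree \<open>- p\<close>. Discreteness of the measures
  appears as countability of the set of unit vectors carrying an atom.\<close>

locale centroaffine_atoms =
  fixes p :: real and m :: "(real ^ 'n) set \<Rightarrow> real ^ 'n \<Rightarrow> real"
  assumes nonneg: "P \<in> polytopes_o \<Longrightarrow> a \<noteq> 0 \<Longrightarrow> 0 \<le> m P a"
    and valuation: "a \<noteq> 0 \<Longrightarrow> P \<in> polytopes_o \<Longrightarrow> Q \<in> polytopes_o \<Longrightarrow> P \<union> Q \<in> polytopes_o \<Longrightarrow>
      P \<inter> Q \<in> polytopes_o \<Longrightarrow> m (P \<union> Q) a + m (P \<inter> Q) a = m P a + m Q a"
    and contravariant: "det \<phi> = 1 \<Longrightarrow> P \<in> polytopes_o \<Longrightarrow> a \<noteq> 0 \<Longrightarrow>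
      m ((\<lambda>y. \<phi> *v y) ` P) a = m P (transpose \<phi> *v a)"
    and homogeneous: "P \<in> polytopes_o \<Longrightarrow> a \<noteq> 0 \<Longrightarrow> 0 < t \<Longrightarrow> m P (t *\<^sub>R a) = t powr (- p) * m P a"
    and countable_support: "P \<in> polytopes_o \<Longrightarrow> countable {u. norm u = 1 \<and> m P u \<noteq> 0}"
begin

lemma cut_additive_atom:
  assumes "a \<noteq> 0"
  shows "cut_additive (\<lambda>P. m P a)"
  unfolding cut_additive_def
proof (intro ballI allI)
  fix P :: "(real ^ 'n) set" and c assume P: "P \<in> polytopes_o"
  have "(P \<inter> cell {c}) \<union> (P \<inter> cell {- c}) = P" "(P \<inter> cell {c}) \<inter> (P \<inter> cell {- c}) = P \<inter> cell {c, - c}"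
    by (auto simp: cell_def)
  then show "m P a + m (P \<inter> cell {c, - c}) a = m (P \<inter> cell {c}) a + m (P \<inter> cell {- c}) a"
    using valuation[OF assms, of "P \<inter> cell {c}" "P \<inter> cell {- c}"] P polytopes_o_Int_cell[OF P]
    by simp
qed

text \<open>The points of the line have pairwise distinct directions, and only countably many directions carry an atom.\<close>

lemma zero_somewhere_on_line:
  assumes P: "P \<in> polytopes_o" and w: "\<xi> \<bullet> w = 0" "a \<bullet> w \<noteq> 0" and "\<xi> \<noteq> 0"
  obtains \<alpha> where "0 < \<alpha>" "\<alpha> < 1" "m P (a + \<alpha> *\<^sub>R \<xi>) = 0"
proof -
  define f where "f \<alpha> = sgn (a + \<alpha> *\<^sub>R \<xi>)" for \<alpha>
  have aw: "(a + \<alpha> *\<^sub>R \<xi>) \<bullet> w = a \<bullet> w" for \<alpha> using w by (simp add: inner_add_left)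
  then have nz: "a + \<alpha> *\<^sub>R \<xi> \<noteq> 0" for \<alpha> using w(2) by (metis inner_zero_left)
  have "inj f"
  proof (rule injI)
    fix \<alpha> \<beta> assume eq: "f \<alpha> = f \<beta>"
    define r where "r \<alpha> = inverse (norm (a + \<alpha> *\<^sub>R \<xi>))" for \<alpha>
    have f: "f \<alpha> = r \<alpha> *\<^sub>R (a + \<alpha> *\<^sub>R \<xi>)" for \<alpha> by (simp add: f_def r_def sgn_div_norm)
    have r: "r \<alpha> \<noteq> 0" for \<alpha> using nz by (simp add: r_def)
    have "r \<alpha> * (a \<bullet> w) = r \<beta> * (a \<bullet> w)"
      using arg_cong[OF eq, of "\<lambda>x. x \<bullet> w"] by (simp add: f aw)
    then have "r \<alpha> = r \<beta>" using w(2) by simp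
    then have "a + \<alpha> *\<^sub>R \<xi> = a + \<beta> *\<^sub>R \<xi>" using eq r by (simp add: f)
    then show "\<alpha> = \<beta>" using \<open>\<xi> \<noteq> 0\<close> by simp
  qed
  then have "uncountable (f ` {0<..<1})"
    by (metis countable_image_inj_on inj_on_subset subset_UNIV uncountable_open_interval zero_less_one)
  then have "\<not> f ` {0<..<1} \<subseteq> {u. norm u = 1 \<and> m P u \<noteq> 0}"
    using countable_support[OF P] countable_subset by blast
  then obtain \<alpha> where "\<alpha> \<in> {0<..<1}" "\<not> (norm (f \<alpha>) = 1 \<and> m P (f \<alpha>) \<noteq> 0)"
    by blast
  then have \<alpha>: "0 < \<alpha>" "\<alpha> < 1" and "\<not> (norm (f \<alpha>) = 1 \<and> m P (f \<alpha>) \<noteq> 0)"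
    by auto
  then have "m P (f \<alpha>) = 0" using nz by (simp add: f_def norm_sgn)
  moreover have "m P (f \<alpha>) = inverse (norm (a + \<alpha> *\<^sub>R \<xi>)) powr (- p) * m P (a + \<alpha> *\<^sub>R \<xi>)"
    using P nz by (simp add: f_def sgn_div_norm homogeneous)
  ultimately have "m P (a + \<alpha> *\<^sub>R \<xi>) = 0" using nz by simp
  then show ?thesis using \<alpha> that by blast
qed

text \<open>The transvections \<open>x \<mapsto> x + \<alpha> (\<xi> \<bullet> x) w\<close> fix \<open>P\<close> pointwise, whereas their transposes move \<open>a\<close> along the
  line in direction \<open>\<xi>\<close>. So \<open>m P\<close> is constant on this line, and it vanishes somewhere on it.\<close>

lemma zero_in_hyperplane:
  assumes P: "P \<in> polytopes_o" "\<And>x. x \<in> P \<Longrightarrow> \<xi> \<bullet> x = 0" and "\<xi> \<noteq> 0"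
    and w: "\<xi> \<bullet> w = 0" "a \<bullet> w \<noteq> 0"
  shows "m P a = 0"
proof -
  obtain \<alpha> where \<alpha>: "m P (a + \<alpha> *\<^sub>R ((w \<bullet> a) *\<^sub>R \<xi>)) = 0"
    using zero_somewhere_on_line[OF P(1), of "(w \<bullet> a) *\<^sub>R \<xi>" w a] w \<open>\<xi> \<noteq> 0\<close>
    by (auto simp: inner_commute)
  have "det (rank_one_update (\<alpha> *\<^sub>R w) \<xi>) = 1"
    using w by (simp add: det_rank_one_update inner_commute)
  moreover have "(\<lambda>y. rank_one_update (\<alpha> *\<^sub>R w) \<xi> *v y) ` P = P"
    using P(2) by (auto simp: rank_one_update_mult)
  moreover have "a \<noteq> 0" using w by auto
  ultimately have "m P a = m P (transpose (rank_one_update (\<alpha> *\<^sub>R w) \<xi>) *v a)"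
    using contravariant P(1) by metis
  also have "\<dots> = m P (a + \<alpha> *\<^sub>R ((w \<bullet> a) *\<^sub>R \<xi>))"
    unfolding transpose_rank_one_update rank_one_update_mult by simp
  finally show ?thesis using \<alpha> by simp
qed

text \<open>The simplex lies in a hyperplane whose normal is orthogonal to \<open>a\<close> too, so that \<open>zero_in_hyperplane\<close>
  applies with \<open>w = a\<close>.\<close>

lemma zero_on_codim2_simplex:
  assumes "independent B" "card B + 2 \<le> CARD('n)" "a \<noteq> 0"
  shows "m (convex hull insert 0 B) a = 0"
proof -
  have "finite B" using assms(1) by (rule independent_imp_finite)
  have "dim (insert a B) \<le> card (insert a B)"
    using \<open>finite B\<close> by (intro dim_le_card') simp
  also have "\<dots> < CARD('n)" using assms(2) \<open>finite B\<close> by (simp add: card_insert_if)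
  finally obtain \<xi> where \<xi>: "\<xi> \<noteq> 0" "span (insert a B) \<subseteq> {x. \<xi> \<bullet> x = 0}"
    using lowdim_subset_hyperplane[of "insert a B"] by auto
  then have "\<forall>b\<in>B. \<xi> \<bullet> b = 0" "\<xi> \<bullet> a = 0" using span_base[of _ "insert a B"] by blast+
  then show ?thesis
    using \<xi>(1) assms(1,3)
    by (intro zero_in_hyperplane[of _ \<xi> a]) (auto intro: simplex_in_polytopes_o simplex_in_hyperplane)
qed

text \<open>By \<open>zero_in_hyperplane\<close> only a normal vector \<open>a\<close> of the hyperplane of the simplex can carry an atom.
  The halves of the simplex obtained by bisecting an edge are images of it under maps of determinant
  \<open>1\<close> whose transposes double \<open>a\<close>. Hence the atom \<open>t\<close> satisfies \<open>t = 2 powr (1 - p) * t\<close>. The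
  assumption on the dimension provides an edge not containing the origin.\<close>

lemma zero_on_codim1_simplex:
  assumes n: "CARD('n) \<ge> 3" and p: "p \<noteq> 1"
    and B: "independent B" "card B + 1 = CARD('n)" and "a \<noteq> 0"
  shows "m (convex hull insert 0 B) a = 0"
proof -
  have "finite B" using B(1) by (rule independent_imp_finite)
  have "dim B < CARD('n)" using B dim_eq_card_independent by force
  then obtain \<xi> where \<xi>: "\<xi> \<noteq> 0" "span B \<subseteq> {x. \<xi> \<bullet> x = 0}"
    using lowdim_subset_hyperplane[of B] by auto
  then have \<xi>B: "\<forall>b\<in>B. \<xi> \<bullet> b = 0" by (auto intro: span_base)
  define w where "w = a - ((\<xi> \<bullet> a) / (\<xi> \<bullet> \<xi>)) *\<^sub>R \<xi>"
  have \<xi>w: "\<xi> \<bullet> w = 0" using \<xi>(1) by (simp add: w_def inner_diff_right)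
  show ?thesis
  proof (cases "w = 0")
    case False
    have "a \<bullet> w = w \<bullet> w" using \<xi>w by (simp add: w_def inner_diff_left)
    then show ?thesis
      using \<xi>w \<xi>(1) \<xi>B False B(1)
      by (intro zero_in_hyperplane[of _ \<xi> w]) (auto intro: simplex_in_polytopes_o simplex_in_hyperplane)
  next
    case True
    then have "a = ((\<xi> \<bullet> a) / (\<xi> \<bullet> \<xi>)) *\<^sub>R \<xi>" by (simp add: w_def)
    then have aB: "a \<bullet> b = 0" if "b \<in> B" for b using \<xi>B that by (metis inner_scaleR_left mult_zero_right)
    have "a \<notin> span B"
    proof
      assume "a \<in> span B"
      then have "a \<bullet> a = 0"
        using span_induct[of a B "\<lambda>x. a \<bullet> x = 0"] aB by (auto simp: subspace_hyperplane)
      then show False using \<open>a \<noteq> 0\<close> by simp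
    qed
    then have aB_indep: "independent (insert a B)" and "a \<notin> B"
      using B(1) by (auto simp: independent_insert span_base)
    have half: "m (convex hull insert 0 (insert ((1 / 2) *\<^sub>R (x + y)) (B - {x}))) a =
        2 powr (- p) * m (convex hull insert 0 B) a"
      if xy: "x \<in> B" "y \<in> B" "x \<noteq> y" for x y
    proof -
      obtain \<eta> where \<eta>: "\<forall>b\<in>insert a B. \<eta> \<bullet> b = (if b = x then 1 else 0)"
        using independent_dual_vector[OF aB_indep, of "\<lambda>b. if b = x then 1 else 0"] by blast
      then have \<eta>a: "\<eta> \<bullet> a = 0" and \<eta>x: "\<eta> \<bullet> x = 1" and \<eta>b: "\<And>b. b \<in> B \<Longrightarrow> b \<noteq> x \<Longrightarrow> \<eta> \<bullet> b = 0"
        using \<open>a \<notin> B\<close> xy by auto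
      \<comment> \<open>Move \<open>x\<close> to the midpoint and compensate by stretching the normal direction.\<close>
      define \<phi>1 where "\<phi>1 = rank_one_update ((1 / 2) *\<^sub>R (y - x)) \<eta>"
      define \<phi>2 where "\<phi>2 = rank_one_update ((1 / (a \<bullet> a)) *\<^sub>R a) a"
      define \<phi> where "\<phi> = \<phi>1 ** \<phi>2"
      have \<phi>: "\<phi> *v b = b + (\<eta> \<bullet> b) *\<^sub>R ((1 / 2) *\<^sub>R (y - x))" if "b \<in> B" for b
        using aB[OF that] by (simp add: \<phi>_def \<phi>1_def \<phi>2_def rank_one_update_mult flip: matrix_vector_mul_assoc)
      have "det \<phi> = 1"
        using xy \<eta>x \<eta>b[of y] \<open>a \<noteq> 0\<close>
        by (simp add: \<phi>_def \<phi>1_def \<phi>2_def det_mul det_rank_one_update inner_commute inner_diff_right)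
      have "x + (1 / 2) *\<^sub>R (y - x) = (1 / 2) *\<^sub>R (x + y)" by (simp add: vec_eq_iff field_simps)
      then have "\<phi> *v x = (1 / 2) *\<^sub>R (x + y)"
        using \<phi>[OF xy(1)] \<eta>x by simp
      moreover have "(\<lambda>v. \<phi> *v v) ` (B - {x}) = id ` (B - {x})"
        using \<phi> \<eta>b by (intro image_cong) auto
      ultimately have "(\<lambda>v. \<phi> *v v) ` insert x (B - {x}) = insert ((1 / 2) *\<^sub>R (x + y)) (B - {x})"
        unfolding image_insert by simp
      then have img: "(\<lambda>v. \<phi> *v v) ` (convex hull insert 0 B) =
          convex hull insert 0 (insert ((1 / 2) *\<^sub>R (x + y)) (B - {x}))"
        using xy by (simp add: linear_image_simplex insert_absorb)
      have "transpose \<phi> *v a = 2 *\<^sub>R a"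
      proof -
        have "transpose \<phi>1 *v a = a"
          using aB[OF xy(1)] aB[OF xy(2)]
          by (simp add: \<phi>1_def transpose_rank_one_update rank_one_update_mult inner_diff_left
              inner_commute[of _ a] inner_diff_right del: transpose_matrix_vector)
        moreover have "transpose \<phi>2 *v a = 2 *\<^sub>R a"
          using \<open>a \<noteq> 0\<close> by (simp add: \<phi>2_def transpose_rank_one_update rank_one_update_mult scaleR_2
              del: transpose_matrix_vector)
        ultimately show ?thesis
          by (simp add: \<phi>_def matrix_transpose_mul flip: matrix_vector_mul_assoc del: transpose_matrix_vector)
      qed
      then show ?thesis
        using contravariant[OF \<open>det \<phi> = 1\<close> simplex_in_polytopes_o[OF B(1)] \<open>a \<noteq> 0\<close>]
          homogeneous[OF simplex_in_polytopes_o[OF B(1)] \<open>a \<noteq> 0\<close>, of 2]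
        by (simp add: img del: transpose_matrix_vector)
    qed
    have "2 \<le> card B" using n B(2) by simp
    then obtain x y where xy: "x \<in> B" "y \<in> B" "x \<noteq> y"
      by (metis (no_types, lifting) card_2_iff' ex_card subsetD)
    define z where "z = (1 / 2) *\<^sub>R (x + y)"
    have z: "z = (1 - 1 / 2) *\<^sub>R x + (1 / 2) *\<^sub>R y" by (simp add: z_def algebra_simps)
    have sp: "(1 / 2) *\<^sub>R y \<in> span (B - {x})" using xy by (intro span_scale span_base) auto
    note rep = independent_replace[OF B(1) xy(1) z _ sp]
    have "m (convex hull insert 0 (insert z (B - {x, y}))) a = 0"
    proof (rule zero_on_codim2_simplex)
      show "independent (insert z (B - {x, y}))"
        using rep(1) by (rule independent_mono) auto
      have "card (B - {x, y}) = card B - 2" using xy \<open>finite B\<close> by (simp add: card_Diff_subset)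
      moreover have "card (insert z (B - {x, y})) \<le> Suc (card (B - {x, y}))"
        using \<open>finite B\<close> by (simp add: card_insert_if)
      ultimately show "card (insert z (B - {x, y})) + 2 \<le> CARD('n)"
        using n B(2) by linarith
    qed fact
    moreover have "m (convex hull insert 0 B) a + m (convex hull insert 0 (insert z (B - {x, y}))) a =
      m (convex hull insert 0 (insert z (B - {x}))) a + m (convex hull insert 0 (insert z (B - {y}))) a"
      by (rule simplex_cut[OF cut_additive_atom[OF \<open>a \<noteq> 0\<close>] B(1) xy _ _ z]) auto
    ultimately have "m (convex hull insert 0 B) a = 2 * (2 powr (- p) * m (convex hull insert 0 B) a)"
      using half[OF xy] half[of y x] xy by (simp add: z_def add.commute)
    also have "\<dots> = 2 powr (1 - p) * m (convex hull insert 0 B) a"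
      by (simp add: powr_diff powr_minus field_simps)
    finally show ?thesis using p by (simp add: powr_eq_one_iff_gen)
  qed
qed

end

section \<open>Atoms of full-dimensional simplices\<close>

definition std_simplex :: "(real ^ 'n) set" where
  "std_simplex = convex hull insert 0 (range (\<lambda>i. axis i 1))"

context centroaffine_atoms
begin

text \<open>Suppose that \<open>a\<close> takes different values at the vertices \<open>x\<close> and \<open>y\<close>. Extend the edge from \<open>x\<close> to \<open>y\<close> to
  twice its length. The transvections that slide the original edge inside the longer one map the
  simplex to pieces of one larger simplex. The atom of the original simplex at \<open>a\<close> is therefore a lower
  bound for the atoms of the larger one at all points \<open>a'\<close> of a segment, and one of these is zero by
  \<open>zero_somewhere_on_line\<close>.\<close>

lemma zero_off_facet_normal:
  assumes n: "CARD('n) \<ge> 3" and p: "p \<noteq> 1"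
    and B: "independent B" "card B = CARD('n)" and xy: "x \<in> B" "y \<in> B" "a \<bullet> x \<noteq> a \<bullet> y"
  shows "m (convex hull insert 0 B) a = 0"
proof -
  have "finite B" using B(1) by (rule independent_imp_finite)
  have "x \<noteq> y" "a \<noteq> 0" using xy by auto
  \<comment> \<open>The transvections along \<open>w\<close> slide the edge from \<open>x\<close> to \<open>y\<close> along its own line.\<close>
  define w where "w = y - x"
  obtain \<xi> where \<xi>: "\<forall>b\<in>B. \<xi> \<bullet> b = (if b = x \<or> b = y then 1 else 0)"
    using independent_dual_vector[OF B(1), of "\<lambda>b. if b = x \<or> b = y then 1 else 0"] by blast
  then have \<xi>w: "\<xi> \<bullet> w = 0" and "\<xi> \<noteq> 0"
    using xy by (auto simp: w_def inner_diff_right)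
  have aw: "a \<bullet> w \<noteq> 0" using xy by (simp add: w_def inner_diff_right)
  \<comment> \<open>The larger simplex, whose edge from \<open>x - w\<close> to \<open>y\<close> has midpoint \<open>x\<close>.\<close>
  define B' where "B' = insert (x - w) (B - {x})"
  have yS: "y \<in> span (B - {x})" using xy \<open>x \<noteq> y\<close> by (intro span_base) auto
  have "x - w = 2 *\<^sub>R x + - y" by (simp add: w_def scaleR_2)
  note B' = independent_replace[OF B(1) xy(1) this _ span_neg[OF yS], folded B'_def]
  have yB': "y \<in> B'" "x - w \<in> B'" "x - w \<noteq> y"
    using xy \<open>x \<noteq> y\<close> B'(2) by (auto simp: B'_def)
  obtain \<alpha> where \<alpha>: "0 < \<alpha>" "\<alpha> < 1"
    and zero: "m (convex hull insert 0 B') (a + \<alpha> *\<^sub>R ((w \<bullet> a) *\<^sub>R \<xi>)) = 0"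
    using zero_somewhere_on_line[OF simplex_in_polytopes_o[OF B'(1)], of "(w \<bullet> a) *\<^sub>R \<xi>" w a]
      \<xi>w aw \<open>\<xi> \<noteq> 0\<close> by (auto simp: inner_commute)
  define a' where "a' = a + \<alpha> *\<^sub>R ((w \<bullet> a) *\<^sub>R \<xi>)"
  have a'w: "a' \<bullet> w = a \<bullet> w" using \<xi>w by (simp add: a'_def inner_add_left)
  have "a' \<noteq> 0" using a'w aw by auto
  define x' where "x' = x - \<alpha> *\<^sub>R w"
  define y' where "y' = y - \<alpha> *\<^sub>R w"
  \<comment> \<open>Cutting a simplex through a point of an edge cannot increase atoms.\<close>
  have mono: "m (convex hull insert 0 (insert z (C - {u}))) a' \<le> m (convex hull insert 0 C) a'"
    if C: "independent C" "card C = CARD('n)" "u \<in> C" "v \<in> C" "u \<noteq> v"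
      and \<theta>: "0 < \<theta>" "\<theta> < 1" and z: "z = (1 - \<theta>) *\<^sub>R u + \<theta> *\<^sub>R v" for C u v z \<theta>
  proof -
    have "finite C" using C(1) by (rule independent_imp_finite)
    note rep = independent_subdivide[OF C(1,3,4,5) \<theta> z]
    have "m (convex hull insert 0 (insert z (C - {u, v}))) a' = 0"
    proof (rule zero_on_codim1_simplex[OF n p])
      show ind: "independent (insert z (C - {u, v}))" using rep(1) by (rule independent_mono) auto
      have "z \<notin> C - {u, v}" using rep(3) by blast
      moreover have "card (C - {u, v}) = card C - 2"
        using C \<open>finite C\<close> by (simp add: card_Diff_subset)
      ultimately show "card (insert z (C - {u, v})) + 1 = CARD('n)"
        using n C(2) \<open>finite C\<close> by simp
    qed fact
    moreover have "m (convex hull insert 0 (insert z (C - {v}))) a' \<ge> 0"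
      using rep \<open>a' \<noteq> 0\<close> by (intro nonneg simplex_in_polytopes_o)
    ultimately show ?thesis
      using simplex_cut[OF cut_additive_atom[OF \<open>a' \<noteq> 0\<close>] C(1,3,4,5) \<theta> z] by linarith
  qed
  have x': "x' = (1 - (1 - \<alpha>) / 2) *\<^sub>R (x - w) + ((1 - \<alpha>) / 2) *\<^sub>R y"
    by (simp add: x'_def w_def vec_eq_iff field_simps)
  have BC: "B' - {x - w} = B - {x}" using B'(2) by (auto simp: B'_def)
  define B1 where "B1 = insert x' (B - {x})"
  have "m (convex hull insert 0 B1) a' \<le> m (convex hull insert 0 B') a'"
    using mono[OF B'(1) _ yB'(2,1,3) _ _ x'] B'(3) B(2) \<alpha> unfolding BC B1_def by simp
  moreover have x'': "x' = (1 + \<alpha>) *\<^sub>R x + - \<alpha> *\<^sub>R y"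
    by (simp add: x'_def w_def vec_eq_iff field_simps)
  have "1 + \<alpha> \<noteq> 0" "- \<alpha> *\<^sub>R y \<in> span (B - {x})" using \<alpha> span_scale[OF yS, of "- \<alpha>"] by auto
  note B1 = independent_replace[OF B(1) xy(1) x'' this, folded B1_def]
  have "m (convex hull insert 0 (insert y' (B1 - {y}))) a' \<le> m (convex hull insert 0 B1) a'"
  proof (rule mono)
    show "y' = (1 - \<alpha> / (1 + \<alpha>)) *\<^sub>R y + (\<alpha> / (1 + \<alpha>)) *\<^sub>R x'"
    proof -
      have "y - x' = (1 + \<alpha>) *\<^sub>R w" by (simp add: x'_def w_def algebra_simps)
      then have "(\<alpha> / (1 + \<alpha>)) *\<^sub>R (y - x') = \<alpha> *\<^sub>R w" using \<alpha> by simp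
      then show ?thesis by (simp add: y'_def algebra_simps)
    qed
    show "y \<in> B1" "x' \<in> B1" "y \<noteq> x'" using xy \<open>x \<noteq> y\<close> B1(2) by (auto simp: B1_def)
    show "0 < \<alpha> / (1 + \<alpha>)" "\<alpha> / (1 + \<alpha>) < 1" using \<alpha> by auto
  qed (use B1 B(2) in auto)
  moreover have "m (convex hull insert 0 (insert y' (B1 - {y}))) a' = m (convex hull insert 0 B) a"
  proof -
    define \<phi> where "\<phi> = rank_one_update (- \<alpha> *\<^sub>R w) \<xi>"
    have "(\<lambda>v. \<phi> *v v) ` B = insert y' (B1 - {y})"
    proof -
      have "\<phi> *v x = x'" "\<phi> *v y = y'"
        using \<xi> xy by (auto simp: \<phi>_def rank_one_update_mult x'_def y'_def)
      moreover have "(\<lambda>v. \<phi> *v v) ` (B - {x, y}) = id ` (B - {x, y})"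
        using \<xi> by (intro image_cong) (auto simp: \<phi>_def rank_one_update_mult)
      moreover have "B1 - {y} = insert x' (B - {x, y})" using B1(2) xy \<open>x \<noteq> y\<close> by (auto simp: B1_def)
      ultimately have *: "(\<lambda>v. \<phi> *v v) ` insert x (insert y (B - {x, y})) = insert y' (B1 - {y})"
        unfolding image_insert by (simp add: insert_commute)
      have B: "insert x (insert y (B - {x, y})) = B" using xy by auto
      from * show ?thesis unfolding B .
    qed
    then have img: "(\<lambda>v. \<phi> *v v) ` (convex hull insert 0 B) = convex hull insert 0 (insert y' (B1 - {y}))"
      by (simp add: linear_image_simplex)
    have "det \<phi> = 1" using \<xi>w by (simp add: \<phi>_def det_rank_one_update inner_commute)
    moreover have "transpose \<phi> *v a' = a"
      unfolding \<phi>_def transpose_rank_one_update rank_one_update_mult using a'w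
      by (simp add: inner_commute) (simp add: a'_def inner_commute)
    ultimately show ?thesis
      using contravariant[OF _ simplex_in_polytopes_o[OF B(1)] \<open>a' \<noteq> 0\<close>, of \<phi>] by (metis img)
  qed
  moreover have "m (convex hull insert 0 B) a \<ge> 0"
    using B(1) \<open>a \<noteq> 0\<close> by (intro nonneg simplex_in_polytopes_o)
  ultimately show ?thesis using zero by (simp add: a'_def)
qed

end

text \<open>Cauchy's functional equation on the positive half-line; nonnegativity forces monotonicity. Comparing
  \<open>g (N * d)\<close> with \<open>g\<close> at the neighbouring integers bounds \<open>N * |g d - d * g 1|\<close> by \<open>g 1\<close> for
  every positive integer \<open>N\<close>.\<close>

lemma additive_nonneg_imp_linear:
  fixes g :: "real \<Rightarrow> real"
  assumes nonneg: "\<And>x. 0 < x \<Longrightarrow> 0 \<le> g x"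
    and add: "\<And>x y. 0 < x \<Longrightarrow> 0 < y \<Longrightarrow> g (x + y) = g x + g y"
    and "0 < d"
  shows "g d = d * g 1"
proof -
  have mult: "g (real (Suc n) * x) = real (Suc n) * g x" if "0 < x" for n x
  proof (induction n)
    case (Suc n)
    have "g (real (Suc n) * x + x) = real (Suc n) * g x + g x"
      using Suc that add by simp
    then show ?case by (simp add: algebra_simps)
  qed simp
  have mono: "g x \<le> g y" if "0 < x" "x \<le> y" for x y
  proof (cases "x = y")
    case False
    then show ?thesis using add[of x "y - x"] nonneg[of "y - x"] that by simp
  qed simp
  have bound: "real (Suc n) * \<bar>g d - d * g 1\<bar> \<le> g 1" for n
  proof -
    define N where "N = real (Suc n)"
    define k where "k = nat \<lfloor>N * d\<rfloor>"
    have "0 \<le> N * d" using \<open>0 < d\<close> by (simp add: N_def)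
    then have k: "real k \<le> N * d" "N * d \<le> real (Suc k)"
      by (simp_all add: k_def of_nat_nat) linarith+
    have gN: "g (N * d) = N * g d" using mult[OF \<open>0 < d\<close>] by (simp add: N_def)
    have "N * d > 0" using \<open>0 < d\<close> by (simp add: N_def)
    have up: "N * g d \<le> real (Suc k) * g 1"
      using mono[OF \<open>N * d > 0\<close> k(2)] mult[of 1 k] gN by simp
    have low: "real k * g 1 \<le> N * g d"
    proof (cases k)
      case 0
      then show ?thesis using nonneg[OF \<open>0 < d\<close>] by (simp add: N_def)
    next
      case (Suc j)
      then show ?thesis using mono[of "real k" "N * d"] k(1) mult[of 1 j] gN by simp
    qed
    have g1: "0 \<le> g 1" by (simp add: nonneg)
    have "real k * g 1 \<le> N * d * g 1" "N * d * g 1 \<le> real (Suc k) * g 1"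
      using k g1 by (auto intro: mult_right_mono)
    with up low have "\<bar>N * g d - N * d * g 1\<bar> \<le> g 1"
      by (simp add: algebra_simps abs_le_iff)
    also have "\<bar>N * g d - N * d * g 1\<bar> = N * \<bar>g d - d * g 1\<bar>"
      by (simp add: N_def abs_mult right_diff_distrib[symmetric] mult.assoc)
    finally show ?thesis by (simp add: N_def)
  qed
  have "\<bar>g d - d * g 1\<bar> = 0"
  proof (rule ccontr)
    assume "\<not> ?thesis"
    then have "0 < \<bar>g d - d * g 1\<bar>" by simp
    then obtain n where "g 1 < real n * \<bar>g d - d * g 1\<bar>"
      using ex_less_of_nat_mult by blast
    also have "\<dots> \<le> real (Suc n) * \<bar>g d - d * g 1\<bar>" by (intro mult_right_mono) auto
    finally show False using bound[of n] by simp
  qed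
  then show ?thesis by simp
qed

lemma range_axis_eq_Basis: "range (\<lambda>i :: 'n :: finite. axis i (1 :: real)) = Basis"
  by (auto simp: Basis_vec_def)

lemma image_std_simplex:
  "(\<lambda>v. X *v v) ` (std_simplex :: (real ^ 'n) set) = convex hull insert 0 (range (\<lambda>i. X *v axis i 1))"
  for X :: "real ^ 'n ^ 'n"
  by (simp add: std_simplex_def linear_image_simplex image_image)

lemma independent_columns:
  fixes X :: "real ^ 'n ^ 'n"
  assumes "det X \<noteq> 0"
  shows "independent (range (\<lambda>i. X *v axis i 1))" "inj (\<lambda>i. X *v axis i 1)"
proof -
  have inj: "inj ((*v) X)"
    using assms by (simp add: inj_matrix_vector_mult invertible_det_nz)
  have "independent ((*v) X ` Basis)"
    using inj by (intro linear_independent_injective_image) (auto simp: independent_Basis intro: inj_on_subset)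
  then show "independent (range (\<lambda>i. X *v axis i 1))"
    by (simp add: range_axis_eq_Basis[symmetric] image_image)
  show "inj (\<lambda>i. X *v axis i 1)"
  proof (rule injI)
    fix i j assume "X *v axis i 1 = X *v axis j 1"
    with inj have "axis i (1 :: real) = axis j 1" by (rule injD)
    then show "i = j" by (simp add: axis_eq_axis)
  qed
qed

text \<open>A negative determinant is repaired by exchanging two vertices.\<close>

lemma simplex_eq_image_std_simplex:
  fixes B :: "(real ^ 'n) set"
  assumes "CARD('n) \<ge> 2" "independent B" "card B = CARD('n)"
  shows "\<exists>X. det X > 0 \<and> B = range (\<lambda>i. X *v axis i 1)"
proof -
  have "finite B" using assms(2) by (rule independent_imp_finite)
  then obtain f :: "'n \<Rightarrow> real ^ 'n" where f: "bij_betw f UNIV B"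
    using assms(3) finite_same_card_bij[of "UNIV :: 'n set" B] by auto
  have "\<exists>d. \<forall>b\<in>B. d \<bullet> b = (if b = f j then 1 else 0)" for j
    by (rule independent_dual_vector[OF assms(2)])
  then obtain d where d: "\<And>j b. b \<in> B \<Longrightarrow> d j \<bullet> b = (if b = f j then 1 else 0)" by metis
  have fB: "f i \<in> B" for i using f by (auto simp: bij_betw_def)
  have finj: "f i = f j \<longleftrightarrow> i = j" for i j using f by (auto simp: bij_betw_def inj_on_def)
  define X where "X = (\<chi> i j. f j $ i)"
  have "(\<chi> i j. d i $ j) ** X = mat 1"
  proof -
    have "(\<Sum>k\<in>UNIV. d i $ k * f j $ k) = (if i = j then 1 else 0)" for i j
      using d[OF fB[of j], of i] finj[of j i] by (simp add: inner_vec_def eq_commute)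
    then show ?thesis by (simp add: matrix_matrix_mult_def X_def mat_def vec_eq_iff)
  qed
  then have "det X \<noteq> 0" by (metis det_I det_mul mult_zero_right zero_neq_one)
  have X: "X *v axis i 1 = f i" for i
    by (simp add: matrix_vector_mult_basis X_def column_def vec_eq_iff)
  show ?thesis
  proof (cases "det X > 0")
    case True
    then show ?thesis using X f by (intro exI[of _ X]) (auto simp: bij_betw_def)
  next
    case False
    obtain k l :: 'n where "k \<noteq> l"
      using assms(1) by (metis (full_types) UNIV_I card_le_Suc0_iff_eq finite not_less_eq_eq numeral_2_eq_2)
    define q where "q = Transposition.transpose k l"
    have q: "q permutes UNIV" by (simp add: q_def permutes_swap_id)
    define Y where "Y = (\<chi> i j. X $ i $ q j)"
    have "det Y = - det X"
      unfolding Y_def det_permute_columns[OF q] by (simp add: q_def sign_swap_id \<open>k \<noteq> l\<close>)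
    then have "det Y > 0" using False \<open>det X \<noteq> 0\<close> by simp
    moreover have "Y *v axis i 1 = f (q i)" for i
      by (simp add: matrix_vector_mult_basis Y_def X_def column_def vec_eq_iff)
    moreover have "range (\<lambda>i. f (q i)) = B"
      using f permutes_surj[OF q] by (metis bij_betw_def image_image)
    ultimately show ?thesis by (intro exI[of _ Y]) auto
  qed
qed

context centroaffine_atoms
begin

text \<open>The linear map taking one simplex to the other has determinant \<open>1\<close>, and its transpose takes \<open>a\<close> to \<open>b\<close>.\<close>

lemma atom_depends_on_det:
  assumes det: "det X = det Y" "det X \<noteq> 0"
    and a: "transpose X *v a = c" "a \<noteq> 0" and b: "transpose Y *v b = c"
  shows "m ((\<lambda>v. X *v v) ` std_simplex) a = m ((\<lambda>v. Y *v v) ` std_simplex) b"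
proof -
  obtain Y' where Y': "Y' ** Y = mat 1" "Y ** Y' = mat 1"
    using det invertible_det_nz[of Y] by (auto simp: invertible_def)
  define \<phi> where "\<phi> = X ** Y'"
  have "det Y' * det Y = 1" using Y'(1) by (metis det_I det_mul)
  then have "det \<phi> = 1" using det by (simp add: \<phi>_def det_mul mult.commute)
  moreover have "(\<lambda>v. \<phi> *v v) ` (\<lambda>v. Y *v v) ` std_simplex = (\<lambda>v. X *v v) ` std_simplex"
    by (simp add: image_image \<phi>_def matrix_vector_mul_assoc Y' flip: matrix_mul_assoc)
  moreover have "transpose \<phi> *v a = b"
  proof -
    have "transpose \<phi> *v a = transpose Y' *v (transpose Y *v b)"
      using a b by (simp add: \<phi>_def matrix_transpose_mul flip: matrix_vector_mul_assoc del: transpose_matrix_vector)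
    also have "\<dots> = b"
      by (simp add: matrix_vector_mul_assoc Y' transpose_mat flip: matrix_transpose_mul del: transpose_matrix_vector)
    finally show ?thesis .
  qed
  moreover have "(\<lambda>v. Y *v v) ` std_simplex \<in> polytopes_o"
    unfolding image_std_simplex by (intro hull_in_polytopes_o) simp
  ultimately show ?thesis using contravariant a(2) by metis
qed

text \<open>Here \<open>a\<close> has the constant value \<open>\<epsilon>\<close> on the vertices of the simplex. A cut through the edge between two
  vertices produces two simplices on whose vertices \<open>a\<close> still has the value \<open>\<epsilon>\<close>, and whose determinants
  add up to the determinant of the whole. So the atom is an additive function of the determinant, and
  \<open>additive_nonneg_imp_linear\<close> applies.\<close>

lemma atom_on_simplex:
  fixes c :: "real ^ 'n"
  assumes n: "CARD('n) \<ge> 3" and p: "p \<noteq> 1"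
    and c: "\<And>i. c $ i = \<epsilon>" "\<epsilon> \<noteq> 0"
    and X: "det X > 0" "transpose X *v a = c"
  shows "m ((\<lambda>v. X *v v) ` std_simplex) a = det X * m std_simplex c"
proof -
  obtain k l :: 'n where "k \<noteq> l"
    using n by (metis (full_types) UNIV_I card_le_Suc0_iff_eq finite not_less_eq_eq numeral_3_eq_3 Suc_leD)
  define e :: "real ^ 'n" where "e = axis k 1"
  \<comment> \<open>One simplex for every determinant: \<open>D d\<close> stretches one axis by \<open>d\<close>, and \<open>b d\<close> has the value \<open>\<epsilon>\<close> on all
    vertices of the stretched simplex other than the origin.\<close>
  define D where "D d = rank_one_update ((d - 1) *\<^sub>R e) e" for d
  define b where "b d = rank_one_update ((1 / d - 1) *\<^sub>R e) e *v c" for d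
  define g where "g d = m ((\<lambda>v. D d *v v) ` std_simplex) (b d)" for d
  have ee: "e \<bullet> e = 1" by (simp add: e_def inner_axis_axis)
  have detD: "det (D d) = d" for d by (simp add: D_def det_rank_one_update ee)
  have bD: "transpose (D d) *v b d = c" if "d > 0" for d
    using that ee by (simp add: D_def b_def transpose_rank_one_update rank_one_update_mult inner_add_right
        algebra_simps divide_simps del: transpose_matrix_vector flip: scaleR_add_left)
  have c0: "c \<noteq> 0" using c by (metis zero_index)
  have b0: "b d \<noteq> 0" if "d > 0" for d using bD[OF that] c0 by auto
  have std_o: "(\<lambda>v. Y *v v) ` std_simplex \<in> polytopes_o" for Y :: "real ^ 'n ^ 'n"
    unfolding image_std_simplex by (intro hull_in_polytopes_o) simp
  have g: "m ((\<lambda>v. Y *v v) ` std_simplex) a = g (det Y)"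
    if "det Y > 0" "transpose Y *v a = c" for Y a
    unfolding g_def
  proof (rule atom_depends_on_det)
    show "a \<noteq> 0" using that(2) c0 by auto
  qed (use that bD in \<open>auto simp: detD\<close>)
  have "g (d1 + d2) = g d1 + g d2" if d: "0 < d1" "0 < d2" for d1 d2
  proof -
    define d \<theta> where "d = d1 + d2" and "\<theta> = d2 / d"
    have "d > 0" and \<theta>: "0 < \<theta>" "\<theta> < 1" using d by (auto simp: d_def \<theta>_def)
    define Y where "Y = D d"
    have "det Y > 0" using \<open>d > 0\<close> by (simp add: Y_def detD)
    then have "det Y \<noteq> 0" by simp
    note cols = independent_columns[OF this]
    define y where "y i = Y *v axis i 1" for i
    have rng: "range (\<lambda>i. Y *v axis i 1) = range y" by (simp add: y_def)
    have "inj y" using cols(2) unfolding y_def .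
    then have "y k \<noteq> y l" using \<open>k \<noteq> l\<close> by (simp add: inj_eq)
    define z where "z = (1 - \<theta>) *\<^sub>R y k + \<theta> *\<^sub>R y l"
    have img: "(\<lambda>v. (Y ** rank_one_update (t *\<^sub>R (axis j 1 - axis i 1)) (axis i 1)) *v v) ` std_simplex
        = convex hull insert 0 (insert ((1 - t) *\<^sub>R y i + t *\<^sub>R y j) (range y - {y i}))"
      if "i \<noteq> j" for i j t
    proof -
      define E where "E = rank_one_update (t *\<^sub>R (axis j 1 - axis i 1)) (axis i (1 :: real))"
      have E: "E *v axis h 1 = axis h 1 + (if h = i then t else 0) *\<^sub>R (axis j 1 - axis i 1)" for h
        by (simp add: E_def rank_one_update_mult inner_axis_axis)
      have YE: "(Y ** E) *v axis h 1 = (if h = i then (1 - t) *\<^sub>R y i + t *\<^sub>R y j else y h)" for h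
        by (simp add: E y_def matrix_vector_right_distrib matrix_vector_mult_diff_distrib
            matrix_vector_mult_scaleR algebra_simps flip: matrix_vector_mul_assoc)
      have "range (\<lambda>h. (Y ** E) *v axis h 1) = (\<lambda>h. (Y ** E) *v axis h 1) ` insert i (UNIV - {i})"
        by (simp add: insert_absorb)
      also have "\<dots> = insert ((1 - t) *\<^sub>R y i + t *\<^sub>R y j) ((\<lambda>h. (Y ** E) *v axis h 1) ` (UNIV - {i}))"
        unfolding image_insert YE by simp
      also have "(\<lambda>h. (Y ** E) *v axis h 1) ` (UNIV - {i}) = y ` (UNIV - {i})"
        by (intro image_cong) (auto simp: YE)
      also have "\<dots> = range y - {y i}"
        using cols(2) by (auto simp: y_def inj_on_def)
      finally show ?thesis unfolding image_std_simplex E_def by simp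
    qed
    have trans: "transpose (Y ** rank_one_update (t *\<^sub>R (axis j 1 - axis i 1)) (axis i 1)) *v b d = c" for i j t
      using bD[OF \<open>d > 0\<close>] c(1)
      by (simp add: matrix_transpose_mul Y_def transpose_rank_one_update rank_one_update_mult inner_diff_left
          inner_axis' del: transpose_matrix_vector flip: matrix_vector_mul_assoc)
    have detE: "det (Y ** rank_one_update (t *\<^sub>R (axis j 1 - axis i 1)) (axis i 1)) = d * (1 - t)"
      if "i \<noteq> j" for i j t
      using that by (simp add: det_mul Y_def detD det_rank_one_update inner_diff_left inner_axis_axis)
    have 1: "m (convex hull insert 0 (insert z (range y - {y k}))) (b d) = g d1"
    proof -
      have "d * (1 - \<theta>) = d1" using \<open>d > 0\<close> by (simp add: \<theta>_def right_diff_distrib) (simp add: d_def)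
      then show ?thesis
        using g[OF _ trans[where i = k and j = l and t = \<theta>]] img[OF \<open>k \<noteq> l\<close>, of \<theta>]
          detE[OF \<open>k \<noteq> l\<close>, of \<theta>] d by (simp add: z_def)
    qed
    have 2: "m (convex hull insert 0 (insert z (range y - {y l}))) (b d) = g d2"
    proof -
      have "d * (1 - (1 - \<theta>)) = d2" using \<open>d > 0\<close> by (simp add: \<theta>_def)
      moreover have "z = (1 - (1 - \<theta>)) *\<^sub>R y l + (1 - \<theta>) *\<^sub>R y k" by (simp add: z_def add.commute)
      ultimately show ?thesis
        using g[OF _ trans[where i = l and j = k and t = "1 - \<theta>"]] img[of l k "1 - \<theta>"]
          detE[of l k "1 - \<theta>"] d \<open>k \<noteq> l\<close> by simp
    qed
    have 3: "m (convex hull insert 0 (insert z (range y - {y k, y l}))) (b d) = 0"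
    proof (rule zero_on_codim1_simplex[OF n p])
      note sub = independent_subdivide[OF cols(1)[unfolded rng] _ _ \<open>y k \<noteq> y l\<close> \<theta> z_def]
      show "independent (insert z (range y - {y k, y l}))"
        by (rule independent_mono[OF sub(1)]) auto
      have "z \<notin> range y - {y k, y l}" using sub(3) by blast
      moreover have "card (range y - {y k, y l}) = CARD('n) - 2"
        using \<open>y k \<noteq> y l\<close> card_image[OF \<open>inj y\<close>] by (simp add: card_Diff_subset)
      ultimately show "card (insert z (range y - {y k, y l})) + 1 = CARD('n)"
        using n by simp
    qed (use b0 \<open>d > 0\<close> in auto)
    have "g d = m (convex hull insert 0 (range y)) (b d)"
      unfolding g_def Y_def[symmetric] image_std_simplex rng ..
    then show ?thesis
      using simplex_cut[OF cut_additive_atom[OF b0[OF \<open>d > 0\<close>]] cols(1)[unfolded rng] _ _ \<open>y k \<noteq> y l\<close> \<theta> z_def]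
        1 2 3 by (simp add: d_def)
  qed
  moreover have "0 \<le> g d" if "0 < d" for d
    unfolding g_def using b0[OF that] std_o by (intro nonneg)
  ultimately have "g (det X) = det X * g 1"
    using X(1) by (intro additive_nonneg_imp_linear)
  moreover have "g 1 = m std_simplex c"
    by (simp add: g_def b_def D_def rank_one_update_mult)
  ultimately show ?thesis using g X by simp
qed

end

text \<open>The difference of the two families vanishes on all simplices: on those of lower dimension and off the facet
  normals both families vanish, and in the remaining case homogeneity and \<open>atom_on_simplex\<close> lead back to
  the two values on the standard simplex.\<close>

theorem centroaffine_atoms_unique:
  fixes m m' :: "(real ^ 'n) set \<Rightarrow> real ^ 'n \<Rightarrow> real"
  assumes m: "centroaffine_atoms p m" and m': "centroaffine_atoms p m'"
    and n: "CARD('n) \<ge> 3" and p: "p \<noteq> 1"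
    and pos: "m std_simplex (\<chi> i. 1) = m' std_simplex (\<chi> i. 1)"
    and neg: "m std_simplex (\<chi> i. - 1) = m' std_simplex (\<chi> i. - 1)"
    and P: "P \<in> polytopes_o" and "a \<noteq> 0"
  shows "m P a = m' P a"
proof -
  interpret m: centroaffine_atoms p m by (fact m)
  interpret m': centroaffine_atoms p m' by (fact m')
  have "cut_additive (\<lambda>P. m P a - m' P a)"
    using m.cut_additive_atom[OF \<open>a \<noteq> 0\<close>] m'.cut_additive_atom[OF \<open>a \<noteq> 0\<close>]
    unfolding cut_additive_def by (simp add: algebra_simps)
  moreover have "m (convex hull insert 0 B) a - m' (convex hull insert 0 B) a = 0" if B: "independent B" for B
  proof -
    have "card B \<le> CARD('n)" using independent_bound[OF B] by simp
    then consider "card B + 2 \<le> CARD('n)" | "card B + 1 = CARD('n)" | "card B = CARD('n)" by linarith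
    then show ?thesis
    proof cases
      case 1
      then show ?thesis using m.zero_on_codim2_simplex m'.zero_on_codim2_simplex B \<open>a \<noteq> 0\<close> by simp
    next
      case 2
      then show ?thesis using m.zero_on_codim1_simplex m'.zero_on_codim1_simplex B \<open>a \<noteq> 0\<close> n p by simp
    next
      case 3
      show ?thesis
      proof (cases "\<exists>x\<in>B. \<exists>y\<in>B. a \<bullet> x \<noteq> a \<bullet> y")
        case True
        then show ?thesis
          using m.zero_off_facet_normal[OF n p B 3] m'.zero_off_facet_normal[OF n p B 3] by auto
      next
        case False
        obtain X :: "real ^ 'n ^ 'n" where X: "det X > 0" "B = range (\<lambda>i. X *v axis i 1)"
          using simplex_eq_image_std_simplex[OF _ B 3] n by auto
        then obtain r where r: "\<And>i. a \<bullet> (X *v axis i 1) = r" using False by (metis rangeI)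
        have Xa: "(transpose X *v a) $ i = r" for i
          using r[of i] by (metis cart_eq_inner_axis dot_lmul_matrix transpose_matrix_vector)
        have "r \<noteq> 0"
        proof
          assume "r = 0"
          then have "transpose X *v a = 0" using Xa by (simp add: vec_eq_iff)
          moreover have "inj ((*v) (transpose X))"
            using X(1) by (intro inj_matrix_vector_mult) (simp add: invertible_det_nz)
          ultimately show False
            using \<open>a \<noteq> 0\<close> by (metis injD matrix_vector_mult_0_right)
        qed
        define s where "s = \<bar>r\<bar>"
        have "s > 0" using \<open>r \<noteq> 0\<close> by (simp add: s_def)
        define a' where "a' = (1 / s) *\<^sub>R a"
        have "a' \<noteq> 0" "a = s *\<^sub>R a'" using \<open>a \<noteq> 0\<close> \<open>s > 0\<close> by (auto simp: a'_def)
        have Xa': "transpose X *v a' = (\<chi> i. r / s)"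
          unfolding a'_def matrix_vector_mult_scaleR using Xa by (simp add: vec_eq_iff del: transpose_matrix_vector)
        have "r / s = 1 \<or> r / s = - 1" using \<open>r \<noteq> 0\<close> by (auto simp: s_def abs_if)
        then have c: "m std_simplex (\<chi> i. r / s) = m' std_simplex (\<chi> i. r / s)" using pos neg by auto
        have "m ((\<lambda>v. X *v v) ` std_simplex) a' = m' ((\<lambda>v. X *v v) ` std_simplex) a'"
          using m.atom_on_simplex[OF n p _ _ X(1) Xa', of "r / s"] m'.atom_on_simplex[OF n p _ _ X(1) Xa', of "r / s"]
            c \<open>r \<noteq> 0\<close> \<open>s > 0\<close> by simp
        then have "m (convex hull insert 0 B) a' = m' (convex hull insert 0 B) a'"
          using X(2) by (simp add: image_std_simplex)
        then show ?thesis
          using m.homogeneous[OF simplex_in_polytopes_o[OF B] \<open>a' \<noteq> 0\<close> \<open>s > 0\<close>]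
            m'.homogeneous[OF simplex_in_polytopes_o[OF B] \<open>a' \<noteq> 0\<close> \<open>s > 0\<close>] \<open>a = s *\<^sub>R a'\<close> by simp
      qed
    qed
  qed
  ultimately have "m P a - m' P a = 0" using P by (rule zero_if_zero_on_simplices)
  then show ?thesis by simp
qed

section \<open>Lebesgue measure under linear maps\<close>

text \<open>The change of variables formula for linear maps, for an arbitrary finite index type. It is enough to
  treat elementary matrices; exchanging two coordinates and adding one coordinate to another are
  both rank-one updates, which yields their determinants.\<close>

lemma measure_matrix_image:
  fixes A :: "real ^ 'n ^ 'n"
  assumes "S \<in> lmeasurable"
  shows "(\<lambda>x. A *v x) ` S \<in> lmeasurable \<and>
    measure lebesgue ((\<lambda>x. A *v x) ` S) = \<bar>det A\<bar> * measure lebesgue S"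
proof -
  have sufficient: "\<forall>S\<in>lmeasurable. (\<lambda>x. A *v x) ` S \<in> lmeasurable \<and>
      measure lebesgue ((\<lambda>x. A *v x) ` S) = \<bar>det A\<bar> * measure lebesgue S"
    if box: "\<And>a b. measure lebesgue ((\<lambda>x. A *v x) ` cbox a b) = \<bar>det A\<bar> * measure lebesgue (cbox a b)"
    for A :: "real ^ 'n ^ 'n"
  proof
    fix S :: "(real ^ 'n) set" assume "S \<in> lmeasurable"
    from measure_linear_sufficient[OF matrix_vector_mul_linear[of A] this box]
    show "(\<lambda>x. A *v x) ` S \<in> lmeasurable \<and>
      measure lebesgue ((\<lambda>x. A *v x) ` S) = \<bar>det A\<bar> * measure lebesgue S" by simp
  qed
  have "\<forall>S\<in>lmeasurable. (\<lambda>x. A *v x) ` S \<in> lmeasurable \<and>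
      measure lebesgue ((\<lambda>x. A *v x) ` S) = \<bar>det A\<bar> * measure lebesgue S"
  proof (induction A rule: induct_matrix_elementary_alt)
    case (1 A B)
    have "(\<lambda>x. (A ** B) *v x) ` S = (\<lambda>x. A *v x) ` (\<lambda>x. B *v x) ` S" for S
      by (simp add: image_image matrix_vector_mul_assoc)
    then show ?case using 1 by (simp add: det_mul abs_mult)
  next
    case (2 A i)
    then have "det A = 0" by (auto intro: det_zero_row)
    then have "\<not> inj ((*v) A)"
      using det_nz_iff_inj[OF matrix_vector_mul_linear[of A]] by simp
    then have "negligible ((\<lambda>x. A *v x) ` S)" for S
      by (intro negligible_linear_singular_image matrix_vector_mul_linear)
    then show ?case using \<open>det A = 0\<close>
      by (simp add: negligible_iff_measure)
  next
    case (3 A)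
    have A: "A *v x = (\<chi> k. A $ k $ k * x $ k)" for x
    proof -
      have "(\<Sum>j\<in>UNIV. A $ i $ j * x $ j) = A $ i $ i * x $ i" for i
        using 3 by (simp add: sum.remove[of UNIV i])
      then show ?thesis by (simp add: matrix_vector_mult_def)
    qed
    show ?case
      using measurable_stretch measure_stretch det_diagonal[OF 3] by (auto simp: A)
  next
    case (4 m n)
    let ?t = "Transposition.transpose m n"
    let ?h = "\<lambda>x :: real ^ 'n. \<chi> i. x $ ?t i"
    let ?A = "rank_one_update (axis n 1 - axis m 1) (axis m 1 - axis n (1 :: real))"
    have A: "(\<chi> i j. mat 1 $ i $ ?t j) = ?A"
      using 4 by (auto simp: rank_one_update_def vec_eq_iff mat_def axis_def Transposition.transpose_def)
    have h: "?A *v x = ?h x" for x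
      using 4
      unfolding rank_one_update_mult inner_diff_left inner_axis'
      by (auto simp: vec_eq_iff axis_def Transposition.transpose_def)
    have det: "det ?A = - 1"
      using 4 by (simp add: det_rank_one_update inner_diff_left inner_diff_right inner_axis_axis)
    show ?case unfolding A
    proof (rule sufficient)
      fix a b :: "real ^ 'n"
      have box: "?h ` cbox a b = cbox (?h a) (?h b)"
      proof
        show "?h ` cbox a b \<subseteq> cbox (?h a) (?h b)" by (auto simp: mem_box_cart)
        show "cbox (?h a) (?h b) \<subseteq> ?h ` cbox a b"
        proof
          fix y assume y: "y \<in> cbox (?h a) (?h b)"
          have "a $ i \<le> y $ ?t i \<and> y $ ?t i \<le> b $ i" for i
            using y by (auto simp: mem_box_cart dest!: spec[of _ "?t i"])
          then have "?h y \<in> cbox a b" by (simp add: mem_box_cart)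
          moreover have "y = ?h (?h y)" by (simp add: vec_eq_iff)
          ultimately show "y \<in> ?h ` cbox a b" by blast
        qed
      qed
      have "measure lebesgue (?h ` cbox a b) = measure lebesgue (cbox a b)"
      proof (cases "cbox a b = {}")
        case False
        then have "cbox (?h a) (?h b) \<noteq> {}" unfolding box[symmetric] by blast
        then show ?thesis
          using False prod.permute[OF permutes_swap_id[of m UNIV n], of "\<lambda>i. b $ i - a $ i"]
          by (simp add: box content_cbox_cart o_def)
      qed simp
      then show "measure lebesgue ((\<lambda>x. ?A *v x) ` cbox a b) = \<bar>det ?A\<bar> * measure lebesgue (cbox a b)"
        by (simp add: h det)
    qed
  next
    case (5 m n)
    have A: "(\<chi> i j. of_bool (i = m \<and> j = n \<or> i = j)) = rank_one_update (axis m 1) (axis n (1 :: real))"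
      using 5 by (auto simp: rank_one_update_def vec_eq_iff mat_def axis_def)
    let ?A = "rank_one_update (axis m 1) (axis n (1 :: real))"
    have h: "?A *v x = (\<chi> i. if i = m then x $ m + x $ n else x $ i)" for x
      unfolding rank_one_update_mult inner_axis' by (auto simp: vec_eq_iff axis_def)
    have det: "det ?A = 1" using 5 by (simp add: det_rank_one_update inner_axis_axis)
    show ?case unfolding A
    proof (rule sufficient)
      fix a b :: "real ^ 'n"
      show "measure lebesgue ((\<lambda>x. ?A *v x) ` cbox a b) = \<bar>det ?A\<bar> * measure lebesgue (cbox a b)"
      proof (cases "cbox a b = {}")
        case False
        \<comment> \<open>Translate the box to where its \<open>n\<close>-th coordinates are nonnegative.\<close>
        define v where "v = axis n (- a $ n)"
        have box: "cbox (v + a) (v + b) = (+) v ` cbox a b" by (rule cbox_translation)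
        have "(\<lambda>x. ?A *v x) ` cbox (v + a) (v + b) = (+) (?A *v v) ` (\<lambda>x. ?A *v x) ` cbox a b"
          by (simp add: box image_image matrix_vector_right_distrib)
        then have "measure lebesgue ((\<lambda>x. ?A *v x) ` cbox a b) = measure lebesgue ((\<lambda>x. ?A *v x) ` cbox (v + a) (v + b))"
          by (simp add: measure_translation)
        also have "\<dots> = measure lebesgue (cbox (v + a) (v + b))"
          unfolding h
        proof (rule measure_shear_interval)
          show "cbox (v + a) (v + b) \<noteq> {}" using False by (simp add: box)
          show "0 \<le> (v + a) $ n" by (simp add: v_def)
        qed (rule 5)
        also have "\<dots> = measure lebesgue (cbox a b)" unfolding box by (rule measure_translation)
        finally show ?thesis by (simp add: det)
      qed simp
    qed
  qed
  then show ?thesis using assms by blast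
qed

section \<open>Atoms given by cone volumes\<close>

definition cone_over :: "(real ^ 'n) set \<Rightarrow> (real ^ 'n) set" where
  "cone_over F = {t *\<^sub>R x | t x. 0 \<le> t \<and> t \<le> 1 \<and> x \<in> F}"

text \<open>Up to the factor \<open>n\<close>, this is the atom at a unit vector \<open>a\<close> of the \<open>L\<^sub>p\<close> surface area measure. In this
  form it makes sense for every \<open>a \<noteq> 0\<close>, and its behaviour under linear maps is visible. Faces that
  are not facets contribute nothing, as their cones are null sets; the default value \<open>0\<close> is for the faces
  that contain the origin.\<close>

definition cone_atom :: "real \<Rightarrow> (real ^ 'n) set \<Rightarrow> real ^ 'n \<Rightarrow> real" where
  "cone_atom p P a = (if support_function P a > 0
     then support_function P a powr (- p) * measure lebesgue (cone_over (support_face P a)) else 0)"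

lemma support_function_eqI:
  assumes "y \<in> P" "\<And>x. x \<in> P \<Longrightarrow> a \<bullet> x \<le> a \<bullet> y"
  shows "support_function P a = a \<bullet> y"
  unfolding support_function_def using assms by (intro cSup_eq_maximum) auto

lemma polytopes_o_D:
  assumes "P \<in> polytopes_o"
  shows "compact P" "convex P" "closed P" "0 \<in> P" "P \<noteq> {}"
  using assms
  by (auto simp: polytopes_o_def polytope_imp_compact polytope_imp_convex polytope_imp_closed)

lemma support_attained:
  assumes "P \<in> polytopes_o"
  shows "support_face P a \<noteq> {}" "x \<in> P \<Longrightarrow> a \<bullet> x \<le> support_function P a"
proof -
  have "continuous_on P (\<lambda>x. a \<bullet> x)" by (intro continuous_intros)
  then obtain y where y: "y \<in> P" "\<And>x. x \<in> P \<Longrightarrow> a \<bullet> x \<le> a \<bullet> y"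
    using continuous_attains_sup[of P "\<lambda>x. a \<bullet> x"] polytopes_o_D[OF assms] by blast
  then have h: "support_function P a = a \<bullet> y" by (rule support_function_eqI)
  show "support_face P a \<noteq> {}" using y(1) h by (auto simp: support_face_def)
  show "x \<in> P \<Longrightarrow> a \<bullet> x \<le> support_function P a" using y h by simp
qed

lemma support_face_eq_Int: "support_face P a = P \<inter> {x. a \<bullet> x = support_function P a}"
  by (auto simp: support_face_def)

lemma support_face_of:
  assumes "P \<in> polytopes_o"
  shows "support_face P a face_of P"
  unfolding support_face_eq_Int
  using polytopes_o_D[OF assms] support_attained[OF assms]
  by (intro face_of_Int_supporting_hyperplane_le) auto

lemma compact_support_face:
  assumes "P \<in> polytopes_o"
  shows "compact (support_face P a)" "convex (support_face P a)"
  unfolding support_face_eq_Int using polytopes_o_D[OF assms]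
  by (auto intro!: compact_Int_closed convex_Int closed_hyperplane convex_hyperplane)

lemma compact_cone_over:
  assumes "compact F"
  shows "compact (cone_over F)"
proof -
  have "cone_over F = (\<lambda>(t, x). t *\<^sub>R x) ` ({0..1} \<times> F)" by (force simp: cone_over_def)
  moreover have "compact ((\<lambda>(t, x). t *\<^sub>R x) ` ({0..1} \<times> F))"
    using assms unfolding split_beta by (intro compact_continuous_image continuous_intros compact_Times) auto
  ultimately show ?thesis by simp
qed

lemma lmeasurable_face_cone:
  "P \<in> polytopes_o \<Longrightarrow> cone_over (support_face P a) \<in> lmeasurable"
  by (intro lmeasurable_compact compact_cone_over compact_support_face)

lemma cone_over_Un: "cone_over (F \<union> G) = cone_over F \<union> cone_over G"
  by (auto simp: cone_over_def)

text \<open>Every nonzero point of the cone lies on a unique ray through the hyperplane \<open>a \<bullet> x = h\<close>. Nonemptiness of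
  \<open>F \<inter> G\<close> accounts for the apex.\<close>

lemma cone_over_Int:
  assumes "\<And>x. x \<in> F \<Longrightarrow> a \<bullet> x = h" "\<And>x. x \<in> G \<Longrightarrow> a \<bullet> x = h" "h \<noteq> 0" "F \<inter> G \<noteq> {}"
  shows "cone_over (F \<inter> G) = cone_over F \<inter> cone_over G"
proof
  show "cone_over F \<inter> cone_over G \<subseteq> cone_over (F \<inter> G)"
  proof
    fix z assume "z \<in> cone_over F \<inter> cone_over G"
    then obtain s t x y where z: "z = s *\<^sub>R x" "z = t *\<^sub>R y" "x \<in> F" "y \<in> G" "0 \<le> s" "s \<le> 1"
      unfolding cone_over_def by blast
    have "s * h = t * h" using z assms(1,2) by (metis inner_scaleR_right)
    then have "s = t" using assms(3) by simp
    show "z \<in> cone_over (F \<inter> G)"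
    proof (cases "s = 0")
      case True
      obtain v where "v \<in> F \<inter> G" using assms(4) by blast
      moreover have "z = 0 *\<^sub>R v" using True z by simp
      ultimately show ?thesis unfolding cone_over_def by fastforce
    next
      case False
      then have "x = y" using z \<open>s = t\<close> by simp
      then show ?thesis using z unfolding cone_over_def by blast
    qed
  qed
qed (auto simp: cone_over_def)

lemma cone_over_linear_image: "cone_over ((\<lambda>y. \<phi> *v y) ` F) = (\<lambda>y. \<phi> *v y) ` cone_over F"
  for \<phi> :: "real ^ 'n ^ 'n"
  by (force simp: cone_over_def matrix_vector_mult_scaleR)

lemma support_function_linear_image:
  "support_function ((\<lambda>y. \<phi> *v y) ` P) b = support_function P (transpose \<phi> *v b)"
  for \<phi> :: "real ^ 'n ^ 'n"
  by (simp add: support_function_def image_image dot_lmul_matrix)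

lemma support_face_linear_image:
  "support_face ((\<lambda>y. \<phi> *v y) ` P) b = (\<lambda>y. \<phi> *v y) ` support_face P (transpose \<phi> *v b)"
  for \<phi> :: "real ^ 'n ^ 'n"
  unfolding support_face_def support_function_linear_image by (auto simp: dot_lmul_matrix)

lemma cone_atom_linear_image:
  fixes \<phi> :: "real ^ 'n ^ 'n"
  assumes "\<bar>det \<phi>\<bar> = 1" "P \<in> polytopes_o"
  shows "cone_atom p ((\<lambda>y. \<phi> *v y) ` P) b = cone_atom p P (transpose \<phi> *v b)"
  unfolding cone_atom_def support_function_linear_image support_face_linear_image cone_over_linear_image
  using measure_matrix_image[OF lmeasurable_face_cone[OF assms(2)], of \<phi>] assms(1)
  by simp

lemma cone_atom_homogeneous:
  assumes "0 < t" "P \<in> polytopes_o"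
  shows "cone_atom p P (t *\<^sub>R a) = t powr (- p) * cone_atom p P a"
proof -
  obtain y where y: "y \<in> P" "a \<bullet> y = support_function P a"
    using support_attained(1)[OF assms(2), of a] by (auto simp: support_face_def)
  have "support_function P (t *\<^sub>R a) = (t *\<^sub>R a) \<bullet> y"
    using support_attained(2)[OF assms(2), of _ a] y assms(1) by (intro support_function_eqI) auto
  then have h: "support_function P (t *\<^sub>R a) = t * support_function P a" using y by simp
  moreover have "support_face P (t *\<^sub>R a) = support_face P a"
    using assms(1) by (auto simp: support_face_def h)
  ultimately show ?thesis
    using assms(1) by (simp add: cone_atom_def powr_mult zero_less_mult_iff)
qed

text \<open>Join \<open>y \<in> Q\<close> to a point \<open>x\<close> of the higher face of \<open>P\<close>. Except for \<open>y\<close> itself, this segment is above \<open>Q\<close>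
  but inside the convex set \<open>P \<union> Q\<close>; hence it lies in \<open>P\<close>, and so does its limit point \<open>y\<close>.\<close>

lemma higher_face_in_union:
  assumes P: "P \<in> polytopes_o" and Q: "Q \<in> polytopes_o" and U: "P \<union> Q \<in> polytopes_o"
    and less: "support_function Q a < support_function P a"
  shows "support_face Q a \<subseteq> P"
proof
  fix y assume y: "y \<in> support_face Q a"
  obtain x where x: "x \<in> P" "a \<bullet> x = support_function P a"
    using support_attained(1)[OF P, of a] by (auto simp: support_face_def)
  have y': "y \<in> Q" "a \<bullet> y = support_function Q a" using y by (auto simp: support_face_def)
  have "x \<noteq> y" using x y' less by auto
  have "open_segment y x \<subseteq> P"
  proof
    fix z assume z: "z \<in> open_segment y x"
    then obtain s where s: "0 < s" "z = (1 - s) *\<^sub>R y + s *\<^sub>R x" by (auto simp: in_segment)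
    have "z \<in> P \<union> Q"
      using z x y' segment_open_subset_closed[of y x] closed_segment_subset[OF _ _ polytopes_o_D(2)[OF U], of y x]
      by blast
    have "a \<bullet> z = support_function Q a + s * (support_function P a - support_function Q a)"
      unfolding s(2) by (simp add: inner_add_right x y' algebra_simps)
    moreover have "0 < s * (support_function P a - support_function Q a)" using s(1) less by simp
    ultimately have "z \<notin> Q" using support_attained(2)[OF Q, of z a] by linarith
    with \<open>z \<in> P \<union> Q\<close>
    show "z \<in> P" by blast
  qed
  then have "closure (open_segment y x) \<subseteq> P"
    using polytopes_o_D(3)[OF P] by (rule closure_minimal)
  then show "y \<in> P" using \<open>x \<noteq> y\<close> by (auto simp: closure_open_segment)
qed

text \<open>The union has the face of the higher polytope and the intersection that of the lower one.\<close>

lemma cone_atom_valuation_less: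
  assumes P: "P \<in> polytopes_o" and Q: "Q \<in> polytopes_o" and U: "P \<union> Q \<in> polytopes_o"
    and less: "support_function Q a < support_function P a"
  shows "cone_atom p (P \<union> Q) a + cone_atom p (P \<inter> Q) a = cone_atom p P a + cone_atom p Q a"
proof -
  obtain x where x: "x \<in> P" "a \<bullet> x = support_function P a"
    using support_attained(1)[OF P, of a] by (auto simp: support_face_def)
  obtain y where y: "y \<in> Q" "a \<bullet> y = support_function Q a"
    using support_attained(1)[OF Q, of a] by (auto simp: support_face_def)
  have "y \<in> P" using higher_face_in_union[OF P Q U less] y by (auto simp: support_face_def)
  have "support_function (P \<union> Q) a = a \<bullet> x"
    using x support_attained(2)[OF P, of _ a] support_attained(2)[OF Q, of _ a] less
    by (intro support_function_eqI) fastforce+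
  then have hU: "support_function (P \<union> Q) a = support_function P a" using x by simp
  have "support_function (P \<inter> Q) a = a \<bullet> y"
    using y \<open>y \<in> P\<close> support_attained(2)[OF Q, of _ a] by (intro support_function_eqI) auto
  then have hI: "support_function (P \<inter> Q) a = support_function Q a" using y by simp
  have "support_face (P \<union> Q) a = support_face P a"
    using support_attained(2)[OF Q, of _ a] less by (fastforce simp: support_face_def hU)
  moreover have "support_face (P \<inter> Q) a = support_face Q a"
    using higher_face_in_union[OF P Q U less] by (auto simp: support_face_def hI)
  ultimately show ?thesis by (simp add: cone_atom_def hU hI)
qed

text \<open>The faces of the union and of the intersection are the union and the intersection of the faces, and volume
  is modular.\<close>

lemma cone_atom_valuation_eq:
  assumes P: "P \<in> polytopes_o" and Q: "Q \<in> polytopes_o" and U: "P \<union> Q \<in> polytopes_o"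
    and eq: "support_function P a = support_function Q a"
  shows "cone_atom p (P \<union> Q) a + cone_atom p (P \<inter> Q) a = cone_atom p P a + cone_atom p Q a"
proof -
  obtain x where x: "x \<in> P" "a \<bullet> x = support_function P a"
    using support_attained(1)[OF P, of a] by (auto simp: support_face_def)
  have "support_function (P \<union> Q) a = a \<bullet> x"
    using x support_attained(2)[OF P, of _ a] support_attained(2)[OF Q, of _ a] eq
    by (intro support_function_eqI) auto
  then have hU: "support_function (P \<union> Q) a = support_function Q a" using x eq by simp
  have FU: "support_face (P \<union> Q) a = support_face P a \<union> support_face Q a"
    by (auto simp: support_face_def hU eq)
  \<comment> \<open>The two faces cover a convex, hence connected, set; so they meet.\<close>
  have "connected (support_face P a \<union> support_face Q a)"
    using compact_support_face(2)[OF U, of a] unfolding FU by (rule convex_connected)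
  moreover have "closed (support_face P a)" "closed (support_face Q a)"
    using compact_support_face(1) P Q compact_imp_closed by blast+
  ultimately have "support_face P a \<inter> support_face Q a \<noteq> {}"
    using support_attained(1)[OF P, of a] support_attained(1)[OF Q, of a]
    unfolding connected_closed by blast
  then obtain y where y: "y \<in> support_face P a" "y \<in> support_face Q a" by blast
  then have y': "y \<in> P" "y \<in> Q" "a \<bullet> y = support_function Q a" by (auto simp: support_face_def)
  have "support_function (P \<inter> Q) a = a \<bullet> y"
    using y' support_attained(2)[OF Q, of _ a] by (intro support_function_eqI) auto
  then have hI: "support_function (P \<inter> Q) a = support_function Q a" using y' by simp
  have FI: "support_face (P \<inter> Q) a = support_face P a \<inter> support_face Q a"
    by (auto simp: support_face_def hI eq)
  show ?thesis
  proof (cases "support_function Q a > 0")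
    case True
    let ?F = "support_face P a" and ?G = "support_face Q a"
    have "cone_over (?F \<inter> ?G) = cone_over ?F \<inter> cone_over ?G"
      using True y by (intro cone_over_Int[of _ a "support_function Q a"]) (auto simp: support_face_def eq)
    moreover have "measure lebesgue (cone_over ?F \<union> cone_over ?G) =
        measure lebesgue (cone_over ?F) + measure lebesgue (cone_over ?G)
        - measure lebesgue (cone_over ?F \<inter> cone_over ?G)"
      using lmeasurable_face_cone[OF P] lmeasurable_face_cone[OF Q] by (rule measure_Un3)
    ultimately have sum: "measure lebesgue (cone_over ?F \<union> cone_over ?G) + measure lebesgue (cone_over (?F \<inter> ?G)) =
        measure lebesgue (cone_over ?F) + measure lebesgue (cone_over ?G)" by simp
    show ?thesis
      using True by (simp add: cone_atom_def hU hI FU FI eq cone_over_Un sum flip: distrib_left)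
  qed (simp add: cone_atom_def hU hI eq)
qed

lemma cone_atom_nonzero_imp_facet:
  fixes P :: "(real ^ 'n) set"
  assumes P: "P \<in> polytopes_o" and u: "norm u = 1" and nz: "cone_atom p P u \<noteq> 0"
  shows "u \<in> facet_normals_off_o P"
proof -
  let ?F = "support_face P u"
  have h: "support_function P u > 0" and m: "measure lebesgue (cone_over ?F) \<noteq> 0"
    using nz by (auto simp: cone_atom_def split: if_splits)
  have "aff_dim ?F \<le> aff_dim {x. u \<bullet> x = support_function P u}"
    by (intro aff_dim_subset) (auto simp: support_face_def)
  also have "\<dots> = int CARD('n) - 1" using u by (subst aff_dim_hyperplane) auto
  finally have "aff_dim ?F \<le> int CARD('n) - 1" .
  moreover have "\<not> aff_dim ?F < int CARD('n) - 1"
  proof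
    assume less: "aff_dim ?F < int CARD('n) - 1"
    have "int (dim (insert 0 ?F)) = aff_dim (insert 0 ?F)"
      by (simp add: aff_dim_zero hull_inc)
    also have "\<dots> \<le> aff_dim ?F + 1" by (simp add: aff_dim_insert)
    finally have "dim (insert 0 ?F) < DIM(real ^ 'n)" using less by simp
    then have "dim (span ?F) < DIM(real ^ 'n)" by (metis dim_span span_insert_0)
    then have "negligible (span ?F)" by (rule negligible_lowdim)
    moreover have "cone_over ?F \<subseteq> span ?F" by (auto simp: cone_over_def span_base span_scale)
    ultimately have "negligible (cone_over ?F)" by (rule negligible_subset)
    then show False using m by (simp add: negligible_imp_measure0)
  qed
  ultimately show ?thesis
    using u h support_face_of[OF P, of u] by (auto simp: facet_normals_off_o_def support_face_def)
qed

lemma cone_atoms: "centroaffine_atoms p (cone_atom p :: (real ^ 'n) set \<Rightarrow> _)"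
proof
  fix P :: "(real ^ 'n) set" assume P: "P \<in> polytopes_o"
  show "0 \<le> cone_atom p P a" for a by (simp add: cone_atom_def)
  show "cone_atom p P (t *\<^sub>R a) = t powr (- p) * cone_atom p P a" if "0 < t" for a t
    using that P by (rule cone_atom_homogeneous)
  show "cone_atom p ((\<lambda>y. \<phi> *v y) ` P) a = cone_atom p P (transpose \<phi> *v a)" if "det \<phi> = 1" for \<phi> a
    using that P by (intro cone_atom_linear_image) auto
  have "{u. norm u = 1 \<and> cone_atom p P u \<noteq> 0} \<subseteq> facet_normals_off_o P"
    using cone_atom_nonzero_imp_facet[OF P] by blast
  then show "countable {u. norm u = 1 \<and> cone_atom p P u \<noteq> 0}"
    using finite_facet_normals_off_o[OF P] by (meson countable_finite finite_subset)
  fix Q :: "(real ^ 'n) set" and a assume Q: "Q \<in> polytopes_o" "P \<union> Q \<in> polytopes_o"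
  show "cone_atom p (P \<union> Q) a + cone_atom p (P \<inter> Q) a = cone_atom p P a + cone_atom p Q a"
    using cone_atom_valuation_less[OF P Q, of a p] cone_atom_valuation_less[of Q P a p]
      cone_atom_valuation_eq[OF P Q, of a p] P Q
    by (cases "support_function P a" "support_function Q a" rule: linorder_cases)
       (auto simp: Un_commute Int_commute)
qed

lemma uminus_mult: "- mat 1 *v y = - y" for y :: "real ^ 'n"
proof -
  have "- mat 1 *v y = - (mat 1 *v y)"
    by (simp add: vec_eq_iff matrix_vector_mult_def sum_negf)
  then show ?thesis by simp
qed

lemma uminus_image_eq: "uminus ` P = (\<lambda>y. - mat 1 *v y) ` P" for P :: "(real ^ 'n) set"
  by (simp add: uminus_mult)

lemma abs_det_uminus: "\<bar>det (- mat 1 :: real ^ 'n ^ 'n)\<bar> = 1"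
proof -
  have "(- mat 1 :: real ^ 'n ^ 'n) ** (- mat 1) = mat 1"
    by (simp add: matrix_eq uminus_mult flip: matrix_vector_mul_assoc)
  then have "det (- mat 1 :: real ^ 'n ^ 'n) * det (- mat 1 :: real ^ 'n ^ 'n) = 1"
    by (metis det_I det_mul)
  then show ?thesis by (auto simp: square_eq_1_iff)
qed

lemma uminus_polytopes_o: "P \<in> polytopes_o \<Longrightarrow> uminus ` P \<in> polytopes_o"
  by (force simp: polytopes_o_def intro: polytope_linear_image linear_uminus)

lemma cone_atom_uminus:
  fixes P :: "(real ^ 'n) set"
  assumes "P \<in> polytopes_o"
  shows "cone_atom p (uminus ` P) a = cone_atom p P (- a)"
proof -
  have "transpose (- mat 1) = (- mat 1 :: real ^ 'n ^ 'n)" by (simp add: transpose_def mat_def vec_eq_iff)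
  then show ?thesis
    unfolding uminus_image_eq cone_atom_linear_image[OF abs_det_uminus assms] by (simp only: uminus_mult)
qed

lemma centroaffine_atoms_reflect:
  fixes m :: "(real ^ 'n) set \<Rightarrow> real ^ 'n \<Rightarrow> real"
  assumes "centroaffine_atoms p m"
  shows "centroaffine_atoms p (\<lambda>P. m (uminus ` P))"
proof -
  interpret m: centroaffine_atoms p m by fact
  show ?thesis
  proof
    fix P Q :: "(real ^ 'n) set" and a :: "real ^ 'n"
    assume "a \<noteq> 0" "P \<in> polytopes_o" "Q \<in> polytopes_o" "P \<union> Q \<in> polytopes_o" "P \<inter> Q \<in> polytopes_o"
    then show "m (uminus ` (P \<union> Q)) a + m (uminus ` (P \<inter> Q)) a = m (uminus ` P) a + m (uminus ` Q) a"
      using m.valuation[of a "uminus ` P" "uminus ` Q"] uminus_polytopes_o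
      by (metis image_Int image_Un inj_uminus)
  next
    fix \<phi> :: "real ^ 'n ^ 'n" and P :: "(real ^ 'n) set" and a assume "det \<phi> = 1" "P \<in> polytopes_o" "a \<noteq> (0 :: real ^ 'n)"
    moreover have "uminus ` (\<lambda>y. \<phi> *v y) ` P = (\<lambda>y. \<phi> *v y) ` uminus ` P"
      by (simp add: image_image linear_neg[OF matrix_vector_mul_linear])
    ultimately show "m (uminus ` (\<lambda>y. \<phi> *v y) ` P) a = m (uminus ` P) (transpose \<phi> *v a)"
      using m.contravariant uminus_polytopes_o by metis
  qed (use m.nonneg m.homogeneous m.countable_support uminus_polytopes_o in blast)+
qed

lemma centroaffine_atoms_combine:
  fixes m m' :: "(real ^ 'n) set \<Rightarrow> real ^ 'n \<Rightarrow> real"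
  assumes "centroaffine_atoms p m" "centroaffine_atoms p m'" "0 \<le> c" "0 \<le> c'"
  shows "centroaffine_atoms p (\<lambda>P a. c * m P a + c' * m' P a)"
proof -
  interpret m: centroaffine_atoms p m by fact
  interpret m': centroaffine_atoms p m' by fact
  show ?thesis
  proof
    fix P Q :: "(real ^ 'n) set" and a :: "real ^ 'n"
    assume "a \<noteq> 0" "P \<in> polytopes_o" "Q \<in> polytopes_o" "P \<union> Q \<in> polytopes_o" "P \<inter> Q \<in> polytopes_o"
    from m.valuation[OF this] m'.valuation[OF this]
    show "c * m (P \<union> Q) a + c' * m' (P \<union> Q) a + (c * m (P \<inter> Q) a + c' * m' (P \<inter> Q) a)
      = c * m P a + c' * m' P a + (c * m Q a + c' * m' Q a)"
      by (simp add: algebra_simps) (simp flip: distrib_left)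
  next
    fix P :: "(real ^ 'n) set" assume P: "P \<in> polytopes_o"
    have "{u. norm u = 1 \<and> c * m P u + c' * m' P u \<noteq> 0} \<subseteq>
        {u. norm u = 1 \<and> m P u \<noteq> 0} \<union> {u. norm u = 1 \<and> m' P u \<noteq> 0}" by auto
    then show "countable {u. norm u = 1 \<and> c * m P u + c' * m' P u \<noteq> 0}"
      using m.countable_support[OF P] m'.countable_support[OF P]
      by (meson countable_Un countable_subset)
  qed (use assms(3,4) in \<open>simp_all add: m.nonneg m'.nonneg m.contravariant m'.contravariant
        m.homogeneous m'.homogeneous distrib_left\<close>)
qed

lemma std_simplex_coordinate_sum:
  assumes "x \<in> (std_simplex :: (real ^ 'n) set)"
  shows "0 \<le> (\<chi> i. 1) \<bullet> x" "(\<chi> i. 1) \<bullet> x \<le> 1"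
proof -
  have "std_simplex \<subseteq> {x :: real ^ 'n. 0 \<le> (\<chi> i. 1) \<bullet> x} \<inter> {x. (\<chi> i. 1) \<bullet> x \<le> 1}"
    unfolding std_simplex_def
    by (intro hull_minimal convex_Int convex_halfspace_le convex_halfspace_ge) (auto simp: inner_axis)
  then show "0 \<le> (\<chi> i. 1) \<bullet> x" "(\<chi> i. 1) \<bullet> x \<le> 1" using assms by auto
qed

lemma std_simplex_in_polytopes_o: "(std_simplex :: (real ^ 'n) set) \<in> polytopes_o"
  unfolding std_simplex_def by (intro hull_in_polytopes_o) simp

text \<open>The standard simplex is itself the cone over its facet off the origin.\<close>

lemma cone_atom_std_simplex_pos: "cone_atom p (std_simplex :: (real ^ 'n) set) (\<chi> i. 1) > 0"
proof -
  let ?a = "(\<chi> i. 1) :: real ^ 'n" and ?V = "range (\<lambda>i :: 'n. axis i (1 :: real))"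
  obtain k :: 'n where True by blast
  have k: "axis k 1 \<in> (std_simplex :: (real ^ 'n) set)"
    unfolding std_simplex_def by (intro hull_inc) auto
  have "support_function std_simplex ?a = ?a \<bullet> axis k 1"
    using k std_simplex_coordinate_sum(2) by (intro support_function_eqI) (auto simp: inner_axis)
  then have h: "support_function std_simplex ?a = 1" by (simp add: inner_axis)
  have "std_simplex \<subseteq> cone_over (support_face std_simplex ?a)"
  proof
    fix x assume "x \<in> (std_simplex :: (real ^ 'n) set)"
    then obtain t y where t: "0 \<le> t" "t \<le> 1" "y \<in> convex hull ?V" "x = t *\<^sub>R y"
      unfolding std_simplex_def by (subst (asm) convex_hull_insert) auto
    have "convex hull ?V \<subseteq> std_simplex \<inter> {x. ?a \<bullet> x = 1}"
      unfolding std_simplex_def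
      by (intro Int_greatest hull_mono hull_minimal convex_hyperplane) (auto simp: inner_axis)
    then have "y \<in> support_face std_simplex ?a" using t(3) h by (auto simp: support_face_def)
    then show "x \<in> cone_over (support_face std_simplex ?a)" using t unfolding cone_over_def by blast
  qed
  then have "measure lebesgue (std_simplex :: (real ^ 'n) set) \<le> measure lebesgue (cone_over (support_face std_simplex ?a))"
    using lmeasurable_face_cone[OF std_simplex_in_polytopes_o] polytopes_o_D(1)[OF std_simplex_in_polytopes_o]
    by (intro measure_mono_fmeasurable) (auto intro: fmeasurableD lmeasurable_compact)
  moreover have "measure lebesgue (std_simplex :: (real ^ 'n) set) > 0"
  proof -
    have "(std_simplex :: (real ^ 'n) set) \<in> sets borel"
      using polytopes_o_D(1)[OF std_simplex_in_polytopes_o] by (rule borel_compact)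
    then show ?thesis
      using content_std_simplex[where ?'a = "real ^ 'n"]
      by (simp add: std_simplex_def range_axis_eq_Basis)
  qed
  ultimately show ?thesis by (simp add: cone_atom_def h)
qed

lemma cone_atom_std_simplex_neg: "cone_atom p (std_simplex :: (real ^ 'n) set) (\<chi> i. - 1) = 0"
proof -
  have "(\<chi> i. - 1) = - ((\<chi> i. 1) :: real ^ 'n)" by (simp add: vec_eq_iff)
  then have "support_function (std_simplex :: (real ^ 'n) set) (\<chi> i. - 1) = (\<chi> i. - 1) \<bullet> (0 :: real ^ 'n)"
    using std_simplex_coordinate_sum(1) polytopes_o_D(4)[OF std_simplex_in_polytopes_o]
    by (intro support_function_eqI) auto
  then show ?thesis by (simp add: cone_atom_def)
qed

text \<open>At the normal of the facet of the standard simplex off the origin, the cone atom of the simplex is positive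
  and that of its reflection is zero; at the negative normal it is the other way round. So \<open>c\<close> and \<open>c'\<close>
  can be chosen to match any given pair of nonnegative values.\<close>

theorem centroaffine_atoms_classification:
  fixes m :: "(real ^ 'n) set \<Rightarrow> real ^ 'n \<Rightarrow> real"
  assumes m: "centroaffine_atoms p m" and n: "CARD('n) \<ge> 3" and p: "p \<noteq> 1"
  shows "\<exists>c\<ge>0. \<exists>c'\<ge>0. \<forall>P\<in>polytopes_o. \<forall>a. a \<noteq> 0 \<longrightarrow>
    m P a = c * cone_atom p P a + c' * cone_atom p (uminus ` P) a"
proof -
  interpret m: centroaffine_atoms p m by fact
  define r where "r = cone_atom p (std_simplex :: (real ^ 'n) set) (\<chi> i. 1)"
  define c where "c = m std_simplex (\<chi> i. 1) / r"
  define c' where "c' = m std_simplex (\<chi> i. - 1) / r"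
  have "r > 0" unfolding r_def by (rule cone_atom_std_simplex_pos)
  have nz: "(\<chi> i. 1) \<noteq> (0 :: real ^ 'n)" "(\<chi> i. - 1) \<noteq> (0 :: real ^ 'n)"
    by (simp_all add: vec_eq_iff)
  have neg: "(\<chi> i. - 1) = - ((\<chi> i. 1) :: real ^ 'n)" by (simp add: vec_eq_iff)
  have c: "c \<ge> 0" "c' \<ge> 0"
    using m.nonneg[OF std_simplex_in_polytopes_o] nz \<open>r > 0\<close> by (auto simp: c_def c'_def)
  have "m P a = c * cone_atom p P a + c' * cone_atom p (uminus ` P) a"
    if "P \<in> polytopes_o" "a \<noteq> 0" for P a
  proof (rule centroaffine_atoms_unique[OF m _ n p _ _ that])
    show "centroaffine_atoms p (\<lambda>P a. c * cone_atom p P a + c' * cone_atom p (uminus ` P) a)"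
      using c by (intro centroaffine_atoms_combine cone_atoms centroaffine_atoms_reflect)
    have "cone_atom p (uminus ` std_simplex) ((\<chi> i. 1) :: real ^ 'n) = 0"
      "cone_atom p (uminus ` std_simplex) ((\<chi> i. - 1) :: real ^ 'n) = r"
      unfolding cone_atom_uminus[OF std_simplex_in_polytopes_o]
      using cone_atom_std_simplex_neg[of p, where 'n = 'n] by (simp_all add: neg r_def)
    then show "m std_simplex (\<chi> i. 1) = c * cone_atom p std_simplex ((\<chi> i. 1) :: real ^ 'n) +
        c' * cone_atom p (uminus ` std_simplex) ((\<chi> i. 1) :: real ^ 'n)"
      "m std_simplex (\<chi> i. - 1) = c * cone_atom p std_simplex ((\<chi> i. - 1) :: real ^ 'n) +
        c' * cone_atom p (uminus ` std_simplex) ((\<chi> i. - 1) :: real ^ 'n)"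
      using cone_atom_std_simplex_neg[of p, where 'n = 'n] \<open>r > 0\<close>
      by (simp_all add: c_def c'_def flip: r_def)
  qed
  then show ?thesis using c by blast
qed

section \<open>Cone volume and facet area\<close>

interpretation lborel_product: product_sigma_finite "\<lambda>_. lborel :: real measure"
  by standard

lemma emeasure_lborel_scaled:
  fixes c :: real
  assumes "c > 0" "A \<in> sets borel"
  shows "ennreal c * emeasure lborel ((\<lambda>x. c * x) -` A) = emeasure lborel A"
proof -
  have "emeasure lborel ((\<lambda>x. c * x) -` A) = emeasure (distr lborel borel ((*) c)) A"
    using assms(2) by (simp add: emeasure_distr)
  also have "\<dots> = ennreal (inverse c) * emeasure lborel A"
    using assms by (simp add: lborel_distr_mult emeasure_density nn_integral_cmult_indicator)
  finally show ?thesis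
    using assms(1) by (simp add: mult.assoc[symmetric] flip: ennreal_mult'')
qed

lemma emeasure_PiM_lborel_scaled:
  fixes c :: real
  assumes "c > 0" "finite B" "E \<in> sets (\<Pi>\<^sub>M b\<in>B. lborel)"
  shows "ennreal (c ^ card B) * emeasure (\<Pi>\<^sub>M b\<in>B. lborel)
      {x \<in> space (\<Pi>\<^sub>M b\<in>B. lborel). (\<lambda>b\<in>B. c * x b) \<in> E} = emeasure (\<Pi>\<^sub>M b\<in>B. lborel) E"
proof -
  let ?P = "\<Pi>\<^sub>M b\<in>B. (lborel :: real measure)"
  define D where "D x = (\<lambda>b\<in>B. c * x b)" for x :: "'a \<Rightarrow> real"
  have D [measurable]: "D \<in> ?P \<rightarrow>\<^sub>M ?P" unfolding D_def by measurable
  have "scale_measure (ennreal (c ^ card B)) (distr ?P ?P D) = ?P"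
  proof (rule lborel_product.PiM_eqI[OF assms(2)])
    fix A :: "'a \<Rightarrow> real set" assume A: "\<And>b. b \<in> B \<Longrightarrow> A b \<in> sets lborel"
    have "D -` Pi\<^sub>E B A \<inter> space ?P = Pi\<^sub>E B (\<lambda>b. (\<lambda>x. c * x) -` A b)"
      by (auto simp: D_def space_PiM PiE_iff)
    then have "emeasure (distr ?P ?P D) (Pi\<^sub>E B A) = (\<Prod>b\<in>B. emeasure lborel ((\<lambda>x. c * x) -` A b))"
      using A assms(2) measurable_sets_borel[of "\<lambda>x. c * x" borel]
      by (simp add: emeasure_distr sets_PiM_I_finite) (subst lborel_product.emeasure_PiM, auto)
    then have "emeasure (scale_measure (ennreal (c ^ card B)) (distr ?P ?P D)) (Pi\<^sub>E B A)
       = (\<Prod>b\<in>B. ennreal c * emeasure lborel ((\<lambda>x. c * x) -` A b))"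
      using assms(1) by (simp add: prod.distrib ennreal_power)
    also have "\<dots> = (\<Prod>b\<in>B. emeasure lborel (A b))"
      using A assms(1) by (intro prod.cong emeasure_lborel_scaled) auto
    finally show "emeasure (scale_measure (ennreal (c ^ card B)) (distr ?P ?P D)) (Pi\<^sub>E B A)
       = (\<Prod>b\<in>B. emeasure lborel (A b))" .
  qed simp
  then have "emeasure ?P E = ennreal (c ^ card B) * emeasure (distr ?P ?P D) E"
    by (metis emeasure_scale_measure)
  also have "emeasure (distr ?P ?P D) E = emeasure ?P {x \<in> space ?P. D x \<in> E}"
    using assms(3) by (simp add: emeasure_distr vimage_def Int_def conj_commute)
  finally show ?thesis by (simp add: D_def)
qed

lemma orthonormal_inner:
  assumes "orthonormal_basis_of U B" "b \<in> B" "c \<in> B"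
  shows "b \<bullet> c = (if b = c then 1 else 0)"
  using assms by (auto simp: orthonormal_basis_of_def pairwise_def orthogonal_def dot_square_norm)

lemma orthonormal_independent:
  assumes "orthonormal_basis_of U B"
  shows "independent B"
proof (rule pairwise_orthogonal_independent)
  show "0 \<notin> B" using orthonormal_inner[OF assms, of 0 0] by auto
qed (use assms in \<open>simp add: orthonormal_basis_of_def\<close>)

lemma orthonormal_coordinate:
  fixes B :: "(real ^ 'n) set"
  assumes "orthonormal_basis_of U B" "b \<in> B"
  shows "(\<Sum>c\<in>B. g c *\<^sub>R c) \<bullet> b = g b"
proof -
  have "finite B" using orthonormal_independent[OF assms(1)] by (rule independent_imp_finite)
  have "(\<Sum>c\<in>B. g c *\<^sub>R c) \<bullet> b = (\<Sum>c\<in>B. if c = b then g c else 0)"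
    using orthonormal_inner[OF assms(1) _ assms(2)] by (auto simp: inner_sum_left intro!: sum.cong)
  then show ?thesis using \<open>finite B\<close> assms(2) by simp
qed

lemma orthonormal_expansion:
  fixes B :: "(real ^ 'n) set"
  assumes B: "orthonormal_basis_of UNIV B"
  shows "(\<Sum>b\<in>B. (x \<bullet> b) *\<^sub>R b) = x"
proof -
  have "finite B" using orthonormal_independent[OF B] by (rule independent_imp_finite)
  moreover have "x \<in> span B" using B by (simp add: orthonormal_basis_of_def)
  ultimately obtain g where g: "x = (\<Sum>b\<in>B. g b *\<^sub>R b)" by (auto simp: span_finite)
  then show ?thesis using orthonormal_coordinate[OF B] by (auto intro: sum.cong)
qed

text \<open>In standard coordinates, product measure agrees with Lebesgue measure on boxes, hence everywhere; the
  orthogonal matrix with columns from \<open>B\<close> preserves volume and carries this over to the coordinates of \<open>B\<close>.\<close>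

lemma emeasure_lborel_orthonormal:
  fixes B :: "(real ^ 'n) set"
  assumes B: "orthonormal_basis_of UNIV B" and "compact S"
  shows "emeasure lborel S = emeasure (\<Pi>\<^sub>M b\<in>B. lborel)
    {g \<in> space (\<Pi>\<^sub>M b\<in>B. lborel). (\<Sum>b\<in>B. g b *\<^sub>R b) \<in> S}"
proof -
  let ?P = "\<Pi>\<^sub>M b\<in>B. (lborel :: real measure)"
  have indep: "independent B" using B by (rule orthonormal_independent)
  have "finite B" using indep by (rule independent_imp_finite)
  have "card B = CARD('n)"
    using dim_eq_card[of B "UNIV :: (real ^ 'n) set"] indep B by (simp add: orthonormal_basis_of_def)
  then obtain f :: "'n \<Rightarrow> real ^ 'n" where f: "bij_betw f UNIV B"
    using \<open>finite B\<close> finite_same_card_bij[of "UNIV :: 'n set" B] by auto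
  have fB: "f i \<in> B" and finj: "f i = f j \<longleftrightarrow> i = j" for i j
    using f by (auto simp: bij_betw_def inj_on_def)
  define T where "T g = (\<Sum>i\<in>UNIV. g (f i) *\<^sub>R axis i (1 :: real))" for g :: "real ^ 'n \<Rightarrow> real"
  have T_nth: "T g $ i = g (f i)" for g i
    by (simp add: T_def axis_def if_distrib[of "\<lambda>t. _ * t"] cong: if_cong)
  have [measurable]: "(\<lambda>g. g (f i)) \<in> borel_measurable ?P" for i
    using measurable_component_singleton[OF fB[of i], of "\<lambda>_. lborel :: real measure"] by simp
  have T [measurable]: "T \<in> ?P \<rightarrow>\<^sub>M borel"
    unfolding T_def by measurable
  have lborel: "lborel = distr ?P borel T"
  proof (rule lborel_eqI)
    fix l u :: "real ^ 'n" assume le: "\<And>b. b \<in> Basis \<Longrightarrow> l \<bullet> b \<le> u \<bullet> b"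
    have le': "l $ i \<le> u $ i" for i
      using le[of "axis i 1"] by (simp add: inner_axis axis_in_Basis_iff)
    define k where "k = inv_into UNIV f"
    have kf: "k (f i) = i" for i using f by (simp add: k_def bij_betw_def)
    have fk: "f (k b) = b" if "b \<in> B" for b using f that by (simp add: k_def bij_betw_inv_into_right)
    have "T -` box l u \<inter> space ?P = Pi\<^sub>E B (\<lambda>b. {l $ k b<..<u $ k b})"
    proof (intro equalityI subsetI)
      fix g assume g: "g \<in> T -` box l u \<inter> space ?P"
      have "l $ k b < g b \<and> g b < u $ k b" if "b \<in> B" for b
        using g fk[OF that] by (auto simp: T_nth mem_box_cart dest: spec[of _ "k b"])
      then show "g \<in> Pi\<^sub>E B (\<lambda>b. {l $ k b<..<u $ k b})" using g by (simp add: space_PiM PiE_iff)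
    next
      fix g assume g: "g \<in> Pi\<^sub>E B (\<lambda>b. {l $ k b<..<u $ k b})"
      then have "l $ i < g (f i) \<and> g (f i) < u $ i" for i
        using PiE_mem[OF g fB[of i]] by (simp add: kf)
      then show "g \<in> T -` box l u \<inter> space ?P" using g by (simp add: T_nth mem_box_cart space_PiM PiE_iff)
    qed
    then have "emeasure (distr ?P borel T) (box l u) = (\<Prod>b\<in>B. emeasure lborel {l $ k b<..<u $ k b})"
      using \<open>finite B\<close> by (simp add: emeasure_distr) (subst lborel_product.emeasure_PiM, auto)
    also have "\<dots> = (\<Prod>i\<in>UNIV. emeasure lborel {l $ i<..<u $ i})"
      using prod.reindex_bij_betw[OF f, of "\<lambda>b. emeasure lborel {l $ k b<..<u $ k b}"] by (simp add: kf)
    also have "\<dots> = ennreal (\<Prod>i\<in>UNIV. u $ i - l $ i)"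
      using le' by (simp add: prod_ennreal)
    also have "(\<Prod>i\<in>UNIV. u $ i - l $ i) = (\<Prod>b\<in>Basis. (u - l) \<bullet> b)"
      unfolding range_axis_eq_Basis[symmetric]
      by (subst prod.reindex) (auto simp: inj_on_def axis_eq_axis inner_axis)
    finally show "emeasure (distr ?P borel T) (box l u) = (\<Prod>b\<in>Basis. (u - l) \<bullet> b)" .
  qed simp
  \<comment> \<open>The orthogonal matrix with columns from \<open>B\<close> turns standard coordinates into those of \<open>B\<close>.\<close>
  define Q where "Q = (\<chi> i j. f j $ i)"
  have "transpose Q ** Q = mat 1"
  proof -
    have "(\<Sum>k\<in>UNIV. f i $ k * f j $ k) = (if i = j then 1 else 0)" for i j
      using orthonormal_inner[OF B fB[of i] fB[of j]] finj[of i j] by (simp add: inner_vec_def)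
    then show ?thesis
      by (simp add: Q_def transpose_def matrix_matrix_mult_def mat_def vec_eq_iff)
  qed
  then have Q: "orthogonal_matrix Q" by (simp add: orthogonal_matrix)
  have QT: "Q *v T g = (\<Sum>b\<in>B. g b *\<^sub>R b)" for g
  proof -
    have "Q *v T g = (\<Sum>i\<in>UNIV. g (f i) *\<^sub>R f i)"
      by (simp add: Q_def T_nth matrix_vector_mult_def vec_eq_iff mult.commute)
    then show ?thesis using sum.reindex_bij_betw[OF f, of "\<lambda>b. g b *\<^sub>R b"] by simp
  qed
  define S' where "S' = (\<lambda>x. transpose Q *v x) ` S"
  have S': "x \<in> S' \<longleftrightarrow> Q *v x \<in> S" for x
    using Q unfolding S'_def orthogonal_matrix_def
    by (auto simp: matrix_vector_mul_assoc image_iff simp del: transpose_matrix_vector)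
       (metis matrix_vector_mul_assoc matrix_vector_mul_lid)+
  have "compact S'" unfolding S'_def using \<open>compact S\<close>
    by (intro compact_continuous_image linear_continuous_on matrix_vector_mul_bounded_linear)
  have "\<bar>det (transpose Q)\<bar> = 1" using det_orthogonal_matrix[OF Q] by auto
  then have "measure lebesgue S' = measure lebesgue S"
    using measure_matrix_image[of S "transpose Q"] \<open>compact S\<close>
    unfolding S'_def by (metis lmeasurable_compact mult_1)
  then have "emeasure lborel S = emeasure lborel S'"
    using \<open>compact S\<close> \<open>compact S'\<close> emeasure_compact_finite[of S] emeasure_compact_finite[of S']
    by (simp add: emeasure_eq_ennreal_measure borel_compact less_top)
  also have "\<dots> = emeasure (distr ?P borel T) S'" using lborel by simp
  also have "\<dots> = emeasure ?P {g \<in> space ?P. (\<Sum>b\<in>B. g b *\<^sub>R b) \<in> S}"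
    using \<open>compact S'\<close> by (simp add: emeasure_distr borel_compact vimage_def S' QT Int_def conj_commute)
  finally show ?thesis .
qed


lemma orthonormal_basis_extend_normal:
  fixes F :: "(real ^ 'n) set"
  assumes B: "orthonormal_basis_of (span {x - y | x y. x \<in> F \<and> y \<in> F}) B"
    and u: "norm u = 1" and F: "\<And>x. x \<in> F \<Longrightarrow> u \<bullet> x = h" and dim: "aff_dim F = int CARD('n) - 1"
  shows "orthonormal_basis_of UNIV (insert u B)" "u \<notin> B" "finite B" "card B = CARD('n) - 1"
proof -
  let ?D = "{x - y | x y. x \<in> F \<and> y \<in> F}"
  have indep: "independent B" using B by (rule orthonormal_independent)
  then show "finite B" by (rule independent_imp_finite)
  have "F \<noteq> {}" using dim by auto
  then obtain a where a: "a \<in> F" by blast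
  have "int CARD('n) - 1 = int (dim ((\<lambda>x. x - a) ` F))"
    using dim aff_dim_eq_dim_subtract[of a F] a by (simp add: hull_inc)
  also have "\<dots> \<le> int (dim ?D)" using a by (intro of_nat_mono dim_subset) auto
  also have "dim ?D = dim (span B)" using B by (simp add: orthonormal_basis_of_def)
  also have "\<dots> = card B" using dim_eq_card_independent[OF indep] by simp
  finally have card: "CARD('n) \<le> card B + 1" by simp
  have "span ?D \<subseteq> {x. u \<bullet> x = 0}"
    using F by (intro span_minimal subspace_hyperplane) (auto simp: inner_diff_right)
  then have uB: "u \<bullet> b = 0" if "b \<in> B" for b
    using that B span_base[of b B] by (auto simp: orthonormal_basis_of_def)
  then show "u \<notin> B" using u by (force simp: norm_eq_1)
  have orth: "pairwise orthogonal (insert u B)"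
    using B uB by (auto simp: orthonormal_basis_of_def pairwise_insert orthogonal_def inner_commute)
  have "0 \<notin> insert u B" using B u by (auto simp: orthonormal_basis_of_def)
  then have indep': "independent (insert u B)"
    using orth by (intro pairwise_orthogonal_independent)
  have "card B + 1 = CARD('n)"
    using card independent_bound[OF indep'] \<open>finite B\<close> \<open>u \<notin> B\<close> by simp
  then show "card B = CARD('n) - 1" by simp
  have "UNIV \<subseteq> span (insert u B)"
    using indep' \<open>card B + 1 = CARD('n)\<close> \<open>finite B\<close> \<open>u \<notin> B\<close>
    by (intro card_ge_dim_independent) auto
  then show "orthonormal_basis_of UNIV (insert u B)"
    using B u orth by (auto simp: orthonormal_basis_of_def)
qed

lemma nn_integral_power_ramp:
  fixes h :: real
  assumes "h > 0"
  shows "(\<integral>\<^sup>+y. ennreal ((y / h) ^ k) * indicator {0..h} y \<partial>lborel) = ennreal (h / real (k + 1))"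
proof -
  have "(\<integral>\<^sup>+y. ennreal ((y / h) ^ k) * indicator {0..h} y \<partial>lborel) =
      ennreal (h / real (k + 1) * (h / h) ^ (k + 1) - h / real (k + 1) * (0 / h) ^ (k + 1))"
  proof (rule nn_integral_FTC_Icc)
    fix y :: real assume y: "y \<in> {0..h}"
    have "((\<lambda>y. (y / h) ^ (k + 1)) has_real_derivative real (k + 1) * (1 / h * (y / h) ^ (k + 1 - Suc 0)))
        (at y)"
      using DERIV_power[OF DERIV_cdivide[OF DERIV_ident]] .
    from DERIV_cmult[OF this, of "h / real (k + 1)"]
    show "((\<lambda>y. h / real (k + 1) * (y / h) ^ (k + 1)) has_real_derivative (y / h) ^ k) (at y)"
      using assms by simp
    show "0 \<le> (y / h) ^ k" using y assms by simp
  qed (use assms in auto)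
  then show ?thesis using assms by simp
qed

text \<open>Fubini along the normal direction: the slice of the cone at height \<open>y \<in> {0<..h}\<close> is a copy of \<open>F\<close> scaled by
  \<open>y / h\<close>, so its volume is \<open>(y / h) ^ (n - 1)\<close> times that of \<open>F\<close>, and the integral of this power
  is \<open>h / n\<close>.\<close>

lemma cone_volume:
  fixes F :: "(real ^ 'n) set"
  assumes "compact F" and u: "norm u = 1" and F: "\<And>x. x \<in> F \<Longrightarrow> u \<bullet> x = h" and "h > 0"
    and dim: "aff_dim F = int CARD('n) - 1"
  shows "h * flat_volume F = real CARD('n) * measure lebesgue (cone_over F)"
proof -
  define B where "B = (SOME B. orthonormal_basis_of (span {x - y | x y. x \<in> F \<and> y \<in> F}) B)"
  have "orthonormal_basis_of (span {x - y | x y. x \<in> F \<and> y \<in> F}) B"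
    unfolding B_def by (rule someI_ex[OF orthonormal_basis_of_exists])
  note B = orthonormal_basis_extend_normal[OF this u F dim]
  let ?P = "\<Pi>\<^sub>M b\<in>B. (lborel :: real measure)"
  let ?P' = "\<Pi>\<^sub>M b\<in>insert u B. (lborel :: real measure)"
  define E where "E = (\<lambda>x. \<lambda>b\<in>B. x \<bullet> b) ` F"
  have flat: "flat_volume F = measure ?P E"
    unfolding flat_volume_def Let_def B_def[symmetric] E_def ..
  define \<sigma> where "\<sigma> g = (\<Sum>b\<in>B. g b *\<^sub>R b)" for g :: "real ^ 'n \<Rightarrow> real"
  have sum: "(\<Sum>b\<in>insert u B. (g(u := y)) b *\<^sub>R b) = y *\<^sub>R u + \<sigma> g" for g y
  proof -
    have "(\<Sum>b\<in>B. (g(u := y)) b *\<^sub>R b) = \<sigma> g"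
      unfolding \<sigma>_def using B(2) by (intro sum.cong) auto
    then show ?thesis using B(2,3) by simp
  qed
  have expand: "x = (u \<bullet> x) *\<^sub>R u + \<sigma> (\<lambda>b. x \<bullet> b)" for x
    using orthonormal_expansion[OF B(1), of x] B(2,3) by (simp add: \<sigma>_def inner_commute)
  have u\<sigma>: "u \<bullet> \<sigma> g = 0" for g
    using orthonormal_inner[OF B(1), of u] B(2) unfolding \<sigma>_def
    by (auto simp: inner_sum_right intro!: sum.neutral)
  have \<sigma>_coord: "(t *\<^sub>R u + \<sigma> g) \<bullet> b = g b" if "b \<in> B" for t g b
    using orthonormal_coordinate[OF B(1), of b "g(u := t)"] that B(2) unfolding sum by auto
  have \<sigma>_cong: "\<sigma> g = \<sigma> g'" if "\<And>b. b \<in> B \<Longrightarrow> g b = g' b" for g g'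
    unfolding \<sigma>_def using that by (intro sum.cong) auto
  have \<sigma>_scale: "\<sigma> (\<lambda>b. c * g b) = c *\<^sub>R \<sigma> g" for c g
    by (simp add: \<sigma>_def scaleR_sum_right)
  have inE: "(\<lambda>b\<in>B. g b) \<in> E \<longleftrightarrow> h *\<^sub>R u + \<sigma> g \<in> F" for g
  proof
    assume "(\<lambda>b\<in>B. g b) \<in> E"
    then obtain x where x: "x \<in> F" and eq: "(\<lambda>b\<in>B. g b) = (\<lambda>b\<in>B. x \<bullet> b)"
      unfolding E_def by blast
    have "g b = x \<bullet> b" if "b \<in> B" for b using fun_cong[OF eq, of b] that by simp
    then have "h *\<^sub>R u + \<sigma> g = x" using expand[of x] F[OF x] \<sigma>_cong[of g "\<lambda>b. x \<bullet> b"] by simp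
    then show "h *\<^sub>R u + \<sigma> g \<in> F" using x by simp
  next
    assume "h *\<^sub>R u + \<sigma> g \<in> F"
    moreover have "(\<lambda>b\<in>B. g b) = (\<lambda>b\<in>B. (h *\<^sub>R u + \<sigma> g) \<bullet> b)"
      using \<sigma>_coord by (intro restrict_ext) simp
    ultimately show "(\<lambda>b\<in>B. g b) \<in> E" unfolding E_def by blast
  qed
  have E_sets: "E \<in> sets ?P"
  proof -
    have [measurable]: "F \<in> sets borel" using \<open>compact F\<close> by (rule borel_compact)
    have [measurable]: "(\<lambda>g. h *\<^sub>R u + \<sigma> g) \<in> borel_measurable ?P"
      unfolding \<sigma>_def by measurable
    have "E = {g \<in> space ?P. h *\<^sub>R u + \<sigma> g \<in> F}"
    proof (intro equalityI subsetI)
      fix g assume "g \<in> E"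
      moreover from this have "g \<in> extensional B" by (auto simp: E_def)
      ultimately show "g \<in> {g \<in> space ?P. h *\<^sub>R u + \<sigma> g \<in> F}"
        using inE[of g] by (simp add: space_PiM PiE_def extensional_restrict)
    next
      fix g assume "g \<in> {g \<in> space ?P. h *\<^sub>R u + \<sigma> g \<in> F}"
      then show "g \<in> E" using inE[of g] by (simp add: space_PiM PiE_def extensional_restrict)
    qed
    also have "\<dots> \<in> sets ?P" by measurable
    finally show ?thesis .
  qed
  \<comment> \<open>The slice of the cone at height \<open>y\<close> is a copy of \<open>F\<close> scaled by \<open>y / h\<close>.\<close>
  have slice: "y *\<^sub>R u + \<sigma> g \<in> cone_over F \<longleftrightarrow> y \<le> h \<and> (\<lambda>b\<in>B. (h / y) * g b) \<in> E" if "y > 0" for y g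
  proof -
    have eq: "(h / y) *\<^sub>R (y *\<^sub>R u + \<sigma> g) = h *\<^sub>R u + \<sigma> (\<lambda>b. (h / y) * g b)"
      using \<open>y > 0\<close> by (simp only: \<sigma>_scale scaleR_add_right) simp
    have "y *\<^sub>R u + \<sigma> g \<in> cone_over F \<longleftrightarrow> y \<le> h \<and> (h / y) *\<^sub>R (y *\<^sub>R u + \<sigma> g) \<in> F"
    proof
      assume "y *\<^sub>R u + \<sigma> g \<in> cone_over F"
      then obtain t z where z: "0 \<le> t" "t \<le> 1" "z \<in> F" "y *\<^sub>R u + \<sigma> g = t *\<^sub>R z"
        unfolding cone_over_def by blast
      have "u \<bullet> (y *\<^sub>R u + \<sigma> g) = y" using u u\<sigma> by (simp add: inner_add_right dot_square_norm)
      then have "y = t * h" using z F[OF z(3)] by simp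
      moreover from this have "t \<noteq> 0" using \<open>y > 0\<close> by auto
      ultimately show "y \<le> h \<and> (h / y) *\<^sub>R (y *\<^sub>R u + \<sigma> g) \<in> F"
        using z \<open>h > 0\<close> by (auto simp: mult_le_cancel_right1)
    next
      assume *: "y \<le> h \<and> (h / y) *\<^sub>R (y *\<^sub>R u + \<sigma> g) \<in> F"
      moreover have "y *\<^sub>R u + \<sigma> g = (y / h) *\<^sub>R ((h / y) *\<^sub>R (y *\<^sub>R u + \<sigma> g))"
        using \<open>y > 0\<close> \<open>h > 0\<close> by simp
      moreover have "0 \<le> y / h" "y / h \<le> 1" using * \<open>y > 0\<close> \<open>h > 0\<close> by auto
      ultimately show "y *\<^sub>R u + \<sigma> g \<in> cone_over F" unfolding cone_over_def by blast
    qed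
    then show ?thesis unfolding eq inE by simp
  qed
  have below: "y *\<^sub>R u + \<sigma> g \<notin> cone_over F" if "y < 0" for y g
  proof
    assume "y *\<^sub>R u + \<sigma> g \<in> cone_over F"
    then obtain t z where z: "0 \<le> t" "z \<in> F" "y *\<^sub>R u + \<sigma> g = t *\<^sub>R z"
      unfolding cone_over_def by blast
    have "u \<bullet> (y *\<^sub>R u + \<sigma> g) = y" using u u\<sigma> by (simp add: inner_add_right dot_square_norm)
    then have "y = t * h" using z F by simp
    then show False using z(1) \<open>h > 0\<close> that by (simp add: mult_less_0_iff)
  qed
  have C [measurable]: "cone_over F \<in> sets borel"
    using compact_cone_over[OF \<open>compact F\<close>] by (rule borel_compact)
  have "emeasure lborel (cone_over F) =
      (\<integral>\<^sup>+g. indicator (cone_over F) (\<Sum>b\<in>insert u B. g b *\<^sub>R b) \<partial>?P')"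
  proof -
    let ?C = "{g \<in> space ?P'. (\<Sum>b\<in>insert u B. g b *\<^sub>R b) \<in> cone_over F}"
    have "emeasure lborel (cone_over F) = emeasure ?P' ?C"
      using B(1) compact_cone_over[OF \<open>compact F\<close>] by (rule emeasure_lborel_orthonormal)
    also have "\<dots> = (\<integral>\<^sup>+g. indicator ?C g \<partial>?P')"
      by (rule nn_integral_indicator[symmetric]) measurable
    also have "\<dots> = (\<integral>\<^sup>+g. indicator (cone_over F) (\<Sum>b\<in>insert u B. g b *\<^sub>R b) \<partial>?P')"
      by (intro nn_integral_cong) (simp add: indicator_def)
    finally show ?thesis .
  qed
  also have "\<dots> = (\<integral>\<^sup>+y. (\<integral>\<^sup>+g. indicator (cone_over F) (\<Sum>b\<in>insert u B. (g(u := y)) b *\<^sub>R b) \<partial>?P) \<partial>lborel)"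
    by (rule lborel_product.product_nn_integral_insert_rev[OF B(3,2)]) measurable
  also have "\<dots> = (\<integral>\<^sup>+y. emeasure ?P E * (ennreal ((y / h) ^ card B) * indicator {0..h} y) \<partial>lborel)"
  proof (rule nn_integral_cong_AE, rule AE_mp[OF AE_lborel_singleton[of 0]], rule AE_I2, rule impI)
    fix y :: real assume "y \<noteq> 0"
    show "(\<integral>\<^sup>+g. indicator (cone_over F) (\<Sum>b\<in>insert u B. (g(u := y)) b *\<^sub>R b) \<partial>?P) =
        emeasure ?P E * (ennreal ((y / h) ^ card B) * indicator {0..h} y)"
    proof (cases "0 < y \<and> y \<le> h")
      case True
      let ?S = "{g \<in> space ?P. (\<lambda>b\<in>B. (h / y) * g b) \<in> E}"
      have [measurable]: "(\<lambda>g. \<lambda>b\<in>B. (h / y) * g b) \<in> ?P \<rightarrow>\<^sub>M ?P" by measurable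
      have "?S \<in> sets ?P" using E_sets by measurable
      then have "emeasure ?P ?S = (\<integral>\<^sup>+g. indicator ?S g \<partial>?P)"
        by (rule nn_integral_indicator[symmetric])
      also have "\<dots> = (\<integral>\<^sup>+g. indicator (cone_over F) (\<Sum>b\<in>insert u B. (g(u := y)) b *\<^sub>R b) \<partial>?P)"
        unfolding sum using True slice[of y] by (intro nn_integral_cong) (simp add: indicator_def)
      finally have "(\<integral>\<^sup>+g. indicator (cone_over F) (\<Sum>b\<in>insert u B. (g(u := y)) b *\<^sub>R b) \<partial>?P) = emeasure ?P ?S" ..
      also have "\<dots> = ennreal ((y / h) ^ card B) * (ennreal ((h / y) ^ card B) * emeasure ?P ?S)"
        using True \<open>h > 0\<close>
        by (simp add: mult.assoc[symmetric] flip: ennreal_mult'' power_mult_distrib)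
      also have "ennreal ((h / y) ^ card B) * emeasure ?P ?S = emeasure ?P E"
        using True \<open>h > 0\<close> E_sets B(3) by (intro emeasure_PiM_lborel_scaled) auto
      finally show ?thesis using True by (simp add: mult.commute)
    next
      case False
      then have "y < 0 \<or> y > h" using \<open>y \<noteq> 0\<close> by auto
      then have "y *\<^sub>R u + \<sigma> g \<notin> cone_over F" for g
        using below[of y g] slice[of y g] \<open>h > 0\<close> by auto
      then show ?thesis unfolding sum using \<open>y < 0 \<or> y > h\<close> \<open>h > 0\<close> by auto
    qed
  qed
  also have "\<dots> = emeasure ?P E * ennreal (h / real CARD('n))"
    using nn_integral_power_ramp[OF \<open>h > 0\<close>, of "card B"] B(4)
    by (subst nn_integral_cmult) (auto simp: Suc_diff_1)
  finally have "enn2real (emeasure lborel (cone_over F)) = enn2real (emeasure ?P E * ennreal (h / real CARD('n)))"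
    by simp
  then have "measure lborel (cone_over F) = measure ?P E * (h / real CARD('n))"
    using \<open>h > 0\<close> by (simp add: measure_def enn2real_mult)
  then show ?thesis unfolding flat using C by (simp add: field_simps)
qed

section \<open>Discrete measures and their atoms\<close>

lemma sphere_measureD:
  assumes "\<nu> \<in> sphere_measures"
  shows "sets \<nu> = sets sphere_borel" "space \<nu> = sphere 0 1" "finite_measure \<nu>"
    "A \<subseteq> sphere 0 1 \<Longrightarrow> A \<in> sets borel \<Longrightarrow> A \<in> sets \<nu>"
    "continuous_on (sphere 0 1) f \<Longrightarrow> (f :: _ \<Rightarrow> real) \<in> borel_measurable \<nu>"
proof -
  show s: "sets \<nu> = sets sphere_borel" and "finite_measure \<nu>"
    using assms by (auto simp: sphere_measures_def)
  show "space \<nu> = sphere 0 1"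
    using sets_eq_imp_space_eq[OF s] by (simp add: space_restrict_space)
  show "A \<subseteq> sphere 0 1 \<Longrightarrow> A \<in> sets borel \<Longrightarrow> A \<in> sets \<nu>"
    unfolding s by (auto simp: sets_restrict_space image_iff)
  show "continuous_on (sphere 0 1) f \<Longrightarrow> f \<in> borel_measurable \<nu>"
    unfolding measurable_cong_sets[OF s refl] by (rule borel_measurable_continuous_on_restrict)
qed

lemma sphere_minus_countable_borel:
  fixes N :: "(real ^ 'n) set"
  assumes "countable N"
  shows "sphere 0 1 - N \<in> sets borel"
proof -
  have "N \<in> sets borel" using assms by (rule sets.countable[rotated]) auto
  then show ?thesis by (auto intro: borel_closed)
qed

text \<open>Off \<open>U\<close> the measure lives on a countable set of points of measure zero.\<close>

lemma discrete_measure_finite_support: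
  assumes \<nu>: "\<nu> \<in> discrete_sphere_measures" and U: "finite U"
    and zero: "\<And>u. norm u = 1 \<Longrightarrow> u \<notin> U \<Longrightarrow> measure \<nu> {u} = 0"
    and A: "A \<in> sets \<nu>"
  shows "measure \<nu> A = (\<Sum>u\<in>U. measure \<nu> {u} * indicator A u)"
proof -
  obtain N where s: "\<nu> \<in> sphere_measures" and N: "N \<subseteq> sphere 0 1" "countable N" "emeasure \<nu> (sphere 0 1 - N) = 0"
    using \<nu> by (auto simp: discrete_sphere_measures_def)
  interpret finite_measure \<nu> using s by (rule sphere_measureD)
  have sing: "{u} \<in> sets \<nu>" if "norm u = 1" for u using that by (intro sphere_measureD(4)[OF s]) auto
  have A1: "A \<subseteq> sphere 0 1" using sets.sets_into_space[OF A] sphere_measureD(2)[OF s] by simp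
  have "(\<Union>u\<in>N - U. {u}) \<in> null_sets \<nu>"
  proof (rule null_sets_UN')
    fix u assume "u \<in> N - U"
    then have "norm u = 1" "u \<notin> U" using N(1) by auto
    then show "{u} \<in> null_sets \<nu>" using sing zero by (auto simp: null_sets_def emeasure_eq_measure)
  qed (use N(2) in auto)
  moreover have "sphere 0 1 - N \<in> null_sets \<nu>"
    using N(3) sphere_measureD(4)[OF s _ sphere_minus_countable_borel[OF N(2)]]
    by (auto simp: null_sets_def)
  ultimately have "(N - U) \<union> (sphere 0 1 - N) \<in> null_sets \<nu>" by auto
  moreover have fin: "finite (A \<inter> U)" using U by simp
  have AU: "A \<inter> U \<in> sets \<nu>"
    using A1 fin by (intro sphere_measureD(4)[OF s]) (auto intro: borel_closed finite_imp_closed)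
  then have "A - (A \<inter> U) \<in> sets \<nu>" using A by (rule sets.Diff[rotated])
  ultimately have "A - (A \<inter> U) \<in> null_sets \<nu>"
    using A1 by (elim null_sets_subset) auto
  then have "measure \<nu> (A - (A - (A \<inter> U))) = measure \<nu> A"
    using A by (intro measure_Diff_null_set)
  then have "measure \<nu> A = measure \<nu> (A \<inter> U)" by (simp add: Diff_Diff_Int)
  also have "\<dots> = (\<Sum>u\<in>A \<inter> U. measure \<nu> {u})"
    using A1 sing fin by (intro finite_measure_eq_sum_singleton) auto
  also have "\<dots> = (\<Sum>u\<in>U. measure \<nu> {u} * indicator A u)"
    using U by (intro sum.mono_neutral_cong_left) (auto simp: indicator_def)
  finally show ?thesis .
qed

lemma integral_finite_support:
  fixes f :: "real ^ 'n \<Rightarrow> real"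
  assumes \<nu>: "\<nu> \<in> sphere_measures" and U: "finite U" "U \<subseteq> sphere 0 1"
    and w: "\<And>A. A \<in> sets \<nu> \<Longrightarrow> measure \<nu> A = (\<Sum>u\<in>U. w u * indicator A u)"
    and f: "continuous_on (sphere 0 1) f"
  shows "(\<integral>x. f x \<partial>\<nu>) = (\<Sum>u\<in>U. f u * w u)"
proof -
  interpret finite_measure \<nu> using \<nu> by (rule sphere_measureD)
  have sing: "{u} \<in> sets \<nu>" if "u \<in> U" for u using that U(2) by (intro sphere_measureD(4)[OF \<nu>]) auto
  have "U \<in> sets \<nu>" using U by (intro sphere_measureD(4)[OF \<nu>]) (auto intro: borel_closed finite_imp_closed)
  then have "sphere 0 1 - U \<in> sets \<nu>" using sphere_measureD(2)[OF \<nu>] by (metis sets.compl_sets)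
  moreover from this have "measure \<nu> (sphere 0 1 - U) = 0"
    using w U(2) by (subst w) (auto intro!: sum.neutral simp: indicator_def)
  ultimately have "sphere 0 1 - U \<in> null_sets \<nu>" by (auto simp: null_sets_def emeasure_eq_measure)
  then have "AE x in \<nu>. x \<in> U"
    by (rule AE_I') (auto simp: sphere_measureD(2)[OF \<nu>])
  then have ae: "AE x in \<nu>. f x = (\<Sum>u\<in>U. f u * indicator {u} x)"
    by (rule eventually_mono) (use U(1) in \<open>simp add: indicator_def if_distrib cong: if_cong\<close>)
  have meas: "measure \<nu> {u} = w u" if "u \<in> U" for u
    using w[OF sing[OF that]] U(1) that by (simp add: indicator_def if_distrib cong: if_cong)
  have "(\<integral>x. f x \<partial>\<nu>) = (\<integral>x. (\<Sum>u\<in>U. f u * indicator {u} x) \<partial>\<nu>)"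
    using sphere_measureD(5)[OF \<nu> f] sing ae by (intro integral_cong_AE) auto
  also have "\<dots> = (\<Sum>u\<in>U. \<integral>x. f u * indicator {u} x \<partial>\<nu>)"
    using sing by (intro Bochner_Integration.integral_sum) (auto simp: emeasure_eq_measure)
  also have "\<dots> = (\<Sum>u\<in>U. f u * w u)"
    using sing meas sphere_measureD(2)[OF \<nu>] U(2) by (intro sum.cong) (auto simp: Int_absorb2)
  finally show ?thesis .
qed

text \<open>Homogeneous extensions of functions on the sphere that decrease to the indicator of \<open>u\<close>. They turn the
  integral condition of contravariance into one on atoms.\<close>

definition bump :: "real \<Rightarrow> real ^ 'n \<Rightarrow> nat \<Rightarrow> real ^ 'n \<Rightarrow> real" where
  "bump p u k x = norm x powr p * max 0 (1 - real k * norm (sgn x - u))"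

lemma bump_homogeneous: "homogeneous_of_degree p (bump p u k)"
  unfolding homogeneous_of_degree_def bump_def
  by (auto simp: powr_mult sgn_scaleR)

lemma bump_continuous: "continuous_on (- {0}) (bump p u k)"
  unfolding bump_def sgn_div_norm
  by (intro continuous_intros) auto

lemma integral_bump_tendsto:
  fixes g :: "real ^ 'n \<Rightarrow> real ^ 'n"
  assumes \<nu>: "\<nu> \<in> sphere_measures" and v: "norm v = 1"
    and g: "continuous_on (sphere 0 1) g" "\<And>x. norm x = 1 \<Longrightarrow> g x \<noteq> 0"
    and u: "\<And>x. norm x = 1 \<Longrightarrow> sgn (g x) = u \<longleftrightarrow> x = v"
  shows "(\<lambda>k. \<integral>x. bump p u k (g x) \<partial>\<nu>) \<longlonglongrightarrow> norm (g v) powr p * measure \<nu> {v}"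
proof -
  interpret finite_measure \<nu> using \<nu> by (rule sphere_measureD)
  have sv: "{v} \<in> sets \<nu>" using v by (intro sphere_measureD(4)[OF \<nu>]) auto
  have bump_meas: "(\<lambda>x. bump p u k (g x)) \<in> borel_measurable \<nu>" for k
    using g by (intro sphere_measureD(5)[OF \<nu>] continuous_on_compose2[OF bump_continuous g(1)]) auto
  have cont: "continuous_on (sphere 0 1) (\<lambda>x. norm (g x) powr p)"
    using g by (intro continuous_intros) auto
  obtain C where "\<forall>y\<in>(\<lambda>x. norm (g x) powr p) ` sphere 0 1. norm y \<le> C"
    using compact_imp_bounded[OF compact_continuous_image[OF cont compact_sphere]]
    unfolding bounded_iff by blast
  then have C: "norm (norm (g x) powr p) \<le> C" if "norm x = 1" for x using that by simp
  have "(\<lambda>k. \<integral>x. bump p u k (g x) \<partial>\<nu>) \<longlonglongrightarrow> (\<integral>x. norm (g v) powr p * indicator {v} x \<partial>\<nu>)"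
  proof (rule integral_dominated_convergence[where w = "\<lambda>_. C"])
    show "AE x in \<nu>. (\<lambda>k. bump p u k (g x)) \<longlonglongrightarrow> norm (g v) powr p * indicator {v} x"
    proof (rule AE_I2)
      fix x assume "x \<in> space \<nu>"
      then have x: "norm x = 1" using sphere_measureD(2)[OF \<nu>] by simp
      show "(\<lambda>k. bump p u k (g x)) \<longlonglongrightarrow> norm (g v) powr p * indicator {v} x"
      proof (cases "x = v")
        case True
        then show ?thesis using u[OF v] by (simp add: bump_def)
      next
        case False
        then have "norm (sgn (g x) - u) > 0" using u[OF x] by simp
        then obtain K where K: "1 < real K * norm (sgn (g x) - u)" using ex_less_of_nat_mult by blast
        have "bump p u k (g x) = 0" if "k \<ge> K" for k
        proof -
          have "real K * norm (sgn (g x) - u) \<le> real k * norm (sgn (g x) - u)"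
            using that by (intro mult_right_mono) auto
          then show ?thesis using K by (simp add: bump_def)
        qed
        then have "eventually (\<lambda>k. bump p u k (g x) = 0) sequentially"
          by (auto simp: eventually_sequentially)
        then show ?thesis using False by (simp add: tendsto_eventually)
      qed
    qed
    show "AE x in \<nu>. norm (bump p u k (g x)) \<le> C" for k
    proof (rule AE_I2)
      fix x assume "x \<in> space \<nu>"
      then have x: "norm x = 1" using sphere_measureD(2)[OF \<nu>] by simp
      have "norm (bump p u k (g x)) \<le> norm (g x) powr p * 1"
        unfolding bump_def norm_mult by (intro mult_mono) auto
      then show "norm (bump p u k (g x)) \<le> C" using C[OF x] by simp
    qed
  qed (use bump_meas sv in auto)
  moreover have "(\<integral>x. norm (g v) powr p * indicator {v} x \<partial>\<nu>) = norm (g v) powr p * measure \<nu> {v}"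
  proof -
    have "{v} \<inter> space \<nu> = {v}" using v sphere_measureD(2)[OF \<nu>] by auto
    then show ?thesis by simp
  qed
  ultimately show ?thesis by (simp only:)
qed

lemma matrix_inv_det_1:
  fixes \<phi> :: "real ^ 'n ^ 'n"
  assumes "det \<phi> = 1"
  shows "transpose \<phi> *v (transpose (matrix_inv \<phi>) *v x) = x"
    "transpose (matrix_inv \<phi>) *v (transpose \<phi> *v x) = x"
proof -
  have "\<exists>A'. \<phi> ** A' = mat 1 \<and> A' ** \<phi> = mat 1"
    using assms invertible_det_nz[of \<phi>] by (simp add: invertible_def)
  then have "\<phi> ** matrix_inv \<phi> = mat 1 \<and> matrix_inv \<phi> ** \<phi> = mat 1"
    unfolding matrix_inv_def by (rule someI_ex)
  then show "transpose \<phi> *v (transpose (matrix_inv \<phi>) *v x) = x"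
    "transpose (matrix_inv \<phi>) *v (transpose \<phi> *v x) = x"
    by (simp_all add: matrix_vector_mul_assoc transpose_mat flip: matrix_transpose_mul
        del: transpose_matrix_vector)
qed

text \<open>The powers of the norm make the atoms homogeneous of degree \<open>- p\<close>, which absorbs the factor by which a
  homogeneous test function changes when its argument is scaled back to the sphere.\<close>

definition measure_atom :: "real \<Rightarrow> ((real ^ 'n) set \<Rightarrow> (real ^ 'n) measure) \<Rightarrow> (real ^ 'n) set \<Rightarrow> real ^ 'n \<Rightarrow> real" where
  "measure_atom p \<mu> P a = norm a powr (- p) * measure (\<mu> P) {sgn a}"

text \<open>Let \<open>a\<close> be the image of \<open>b\<close> under the transpose of \<open>\<phi>\<close>. Apply contravariance to the functions
  \<open>bump p u k\<close> with \<open>u = b / |b|\<close> and let \<open>k\<close> tend to infinity. On one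
  side only the atom at \<open>u\<close> remains, on the other side only the atom at \<open>v = a / |a|\<close>, the single unit
  vector that \<open>\<psi>\<close>, the transposed inverse of \<open>\<phi>\<close>, maps to a positive multiple of \<open>u\<close>.\<close>

lemma SL_contravariant_atom:
  fixes \<mu> :: "(real ^ 'n) set \<Rightarrow> (real ^ 'n) measure"
  assumes \<mu>: "SL_contravariant p \<mu>" and det: "det \<phi> = 1" and P: "P \<in> polytopes_o"
    and s: "\<mu> P \<in> sphere_measures" "\<mu> ((\<lambda>y. \<phi> *v y) ` P) \<in> sphere_measures" and "b \<noteq> 0"
  shows "measure_atom p \<mu> ((\<lambda>y. \<phi> *v y) ` P) b = measure_atom p \<mu> P (transpose \<phi> *v b)"
proof -
  define \<psi> where "\<psi> x = transpose (matrix_inv \<phi>) *v x" for x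
  define a where "a = transpose \<phi> *v b"
  define u v where "u = sgn b" and "v = sgn a"
  note inv = matrix_inv_det_1[OF det, folded \<psi>_def]
  have \<psi>a: "\<psi> a = b" unfolding a_def by (rule inv)
  have \<psi>_scale: "\<psi> (t *\<^sub>R x) = t *\<^sub>R \<psi> x" for t x unfolding \<psi>_def by (rule matrix_vector_mult_scaleR)
  have \<psi>0: "\<psi> x \<noteq> 0" if "x \<noteq> 0" for x using inv(1)[of x] that by auto
  have "a \<noteq> 0" using \<psi>a \<open>b \<noteq> 0\<close> by (auto simp: \<psi>_def)
  have uv: "norm u = 1" "norm v = 1" using \<open>a \<noteq> 0\<close> \<open>b \<noteq> 0\<close> by (auto simp: u_def v_def norm_sgn)
  have \<psi>v: "\<psi> v = (1 / norm a) *\<^sub>R b" by (simp add: v_def sgn_div_norm \<psi>_scale \<psi>a divide_inverse)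
  have eq: "sgn (\<psi> x) = u \<longleftrightarrow> x = v" if "norm x = 1" for x
  proof
    assume "x = v"
    then show "sgn (\<psi> x) = u" using \<open>a \<noteq> 0\<close> by (simp add: \<psi>v u_def sgn_scaleR)
  next
    assume "sgn (\<psi> x) = u"
    moreover have "x \<noteq> 0" using that by auto
    then have \<psi>x: "\<psi> x \<noteq> 0" by (rule \<psi>0)
    then have "\<psi> x = norm (\<psi> x) *\<^sub>R sgn (\<psi> x)" by (simp add: sgn_div_norm)
    ultimately have "\<psi> x = (norm (\<psi> x) / norm b) *\<^sub>R b"
      using \<open>b \<noteq> 0\<close> by (simp add: u_def sgn_div_norm divide_inverse)
    then have "x = (norm (\<psi> x) / norm b) *\<^sub>R a"
      using inv(1)[of x] by (metis a_def matrix_vector_mult_scaleR)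
    moreover have "norm (\<psi> x) / norm b > 0" using \<psi>x \<open>b \<noteq> 0\<close> by simp
    ultimately have "sgn x = sgn a" by (metis sgn_scaleR sgn_pos scaleR_one)
    then show "x = v" using that by (simp add: v_def sgn_div_norm)
  qed
  have eqk: "(\<integral>x. bump p u k x \<partial>\<mu> ((\<lambda>y. \<phi> *v y) ` P)) = (\<integral>x. bump p u k (\<psi> x) \<partial>\<mu> P)" for k
    using \<mu> det P bump_continuous bump_homogeneous unfolding SL_contravariant_def \<psi>_def by blast
  have lim1: "(\<lambda>k. \<integral>x. bump p u k x \<partial>\<mu> ((\<lambda>y. \<phi> *v y) ` P)) \<longlonglongrightarrow>
      norm u powr p * measure (\<mu> ((\<lambda>y. \<phi> *v y) ` P)) {u}"
    using uv by (intro integral_bump_tendsto[OF s(2)]) (auto simp: sgn_div_norm intro: continuous_on_id)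
  have lim2: "(\<lambda>k. \<integral>x. bump p u k (\<psi> x) \<partial>\<mu> P) \<longlonglongrightarrow> norm (\<psi> v) powr p * measure (\<mu> P) {v}"
  proof (rule integral_bump_tendsto[OF s(1) uv(2) _ _ eq])
    show "continuous_on (sphere 0 1) \<psi>"
      unfolding \<psi>_def by (intro linear_continuous_on matrix_vector_mul_bounded_linear)
    show "\<psi> x \<noteq> 0" if "norm x = 1" for x
    proof (rule \<psi>0)
      show "x \<noteq> 0" using that by auto
    qed
  qed
  have "measure (\<mu> ((\<lambda>y. \<phi> *v y) ` P)) {u} = norm (\<psi> v) powr p * measure (\<mu> P) {v}"
    using LIMSEQ_unique[OF lim1[unfolded eqk] lim2] uv by simp
  moreover have "norm (\<psi> v) = norm b / norm a" by (simp add: \<psi>v)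
  ultimately show ?thesis
    using \<open>a \<noteq> 0\<close> \<open>b \<noteq> 0\<close> unfolding measure_atom_def a_def[symmetric] u_def v_def
    by (simp add: powr_divide powr_minus field_simps)
qed

lemma linear_image_polytopes_o:
  "P \<in> polytopes_o \<Longrightarrow> (\<lambda>y. (\<phi> :: real ^ 'n ^ 'n) *v y) ` P \<in> polytopes_o"
  unfolding polytopes_o_def by (force intro: polytope_linear_image)

lemma measure_atoms:
  fixes \<mu> :: "(real ^ 'n) set \<Rightarrow> (real ^ 'n) measure"
  assumes d: "\<And>P. P \<in> polytopes_o \<Longrightarrow> \<mu> P \<in> discrete_sphere_measures"
    and val: "valuation_o \<mu>" and SL: "SL_contravariant p \<mu>"
  shows "centroaffine_atoms p (measure_atom p \<mu>)"
proof
  have s: "\<mu> P \<in> sphere_measures" if "P \<in> polytopes_o" for P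
    using d[OF that] by (simp add: discrete_sphere_measures_def)
  show "0 \<le> measure_atom p \<mu> P a" for P a by (simp add: measure_atom_def)
  show "measure_atom p \<mu> (P \<union> Q) a + measure_atom p \<mu> (P \<inter> Q) a = measure_atom p \<mu> P a + measure_atom p \<mu> Q a"
    if "a \<noteq> 0" "P \<in> polytopes_o" "Q \<in> polytopes_o" "P \<union> Q \<in> polytopes_o" "P \<inter> Q \<in> polytopes_o" for P Q a
  proof -
    have "{sgn a} \<in> sets sphere_borel"
      using sphere_measureD(4)[OF s[OF that(2)], of "{sgn a}"] sphere_measureD(1)[OF s[OF that(2)]] that(1)
      by (simp add: norm_sgn)
    then have "measure (\<mu> (P \<union> Q)) {sgn a} + measure (\<mu> (P \<inter> Q)) {sgn a} =
        measure (\<mu> P) {sgn a} + measure (\<mu> Q) {sgn a}"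
      using val that unfolding valuation_o_def by blast
    then show ?thesis by (simp add: measure_atom_def flip: distrib_left)
  qed
  show "measure_atom p \<mu> ((\<lambda>y. \<phi> *v y) ` P) a = measure_atom p \<mu> P (transpose \<phi> *v a)"
    if "det \<phi> = 1" "P \<in> polytopes_o" "a \<noteq> 0" for \<phi> P a
    using that s linear_image_polytopes_o by (intro SL_contravariant_atom[OF SL]) auto
  show "measure_atom p \<mu> P (t *\<^sub>R a) = t powr (- p) * measure_atom p \<mu> P a" if "0 < t" for P a t
    using that by (simp add: measure_atom_def powr_mult sgn_scaleR)
  show "countable {u. norm u = 1 \<and> measure_atom p \<mu> P u \<noteq> 0}" if P: "P \<in> polytopes_o" for P
  proof -
    obtain N where N: "N \<subseteq> sphere 0 1" "countable N" "emeasure (\<mu> P) (sphere 0 1 - N) = 0"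
      using d[OF P] by (auto simp: discrete_sphere_measures_def)
    have "sphere 0 1 - N \<in> sets (\<mu> P)"
      by (rule sphere_measureD(4)[OF s[OF P] _ sphere_minus_countable_borel[OF N(2)]]) auto
    then have "measure (\<mu> P) {u} = 0" if "norm u = 1" "u \<notin> N" for u
      using N(3) that emeasure_mono[of "{u}" "sphere 0 1 - N" "\<mu> P"] by (auto simp: measure_def)
    then have "u \<in> N" if "norm u = 1" "measure_atom p \<mu> P u \<noteq> 0" for u
      using that by (fastforce simp: measure_atom_def sgn_div_norm)
    then have "{u. norm u = 1 \<and> measure_atom p \<mu> P u \<noteq> 0} \<subseteq> N" by blast
    then show ?thesis using N(2) by (rule countable_subset)
  qed
qed

lemma measure_Lp_surface_area_measure:
  fixes P :: "(real ^ 'n) set"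
  assumes P: "P \<in> polytopes_o" and A: "A \<in> sets sphere_borel"
    and U: "finite U" "facet_normals_off_o P \<subseteq> U" "U \<subseteq> sphere 0 1"
  shows "measure (Lp_surface_area_measure p P) A = (\<Sum>u\<in>U. real CARD('n) * cone_atom p P u * indicator A u)"
proof -
  have weight: "support_function P u powr (1 - p) * flat_volume (support_face P u) = real CARD('n) * cone_atom p P u"
    if u: "u \<in> facet_normals_off_o P" for u
  proof -
    have u': "norm u = 1" "aff_dim (support_face P u) = int CARD('n) - 1" "0 \<notin> support_face P u"
      using u by (auto simp: facet_normals_off_o_def)
    have "support_function P u \<noteq> 0" using u'(3) P by (auto simp: support_face_def polytopes_o_def)
    then have h: "support_function P u > 0" using support_function_nonneg[OF P, of u] by simp
    have "support_function P u * flat_volume (support_face P u) =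
        real CARD('n) * measure lebesgue (cone_over (support_face P u))"
      using compact_support_face(1)[OF P] u' h by (intro cone_volume[of _ u]) (auto simp: support_face_def)
    moreover have "support_function P u powr (1 - p) = support_function P u powr (- p) * support_function P u"
      using h powr_add[of "support_function P u" "- p" 1] by (simp add: add.commute)
    ultimately show ?thesis using h by (simp add: cone_atom_def)
  qed
  have nonneg: "0 \<le> cone_atom p P u" for u by (simp add: cone_atom_def)
  have "emeasure (Lp_surface_area_measure p P) A =
      (\<Sum>u\<in>facet_normals_off_o P. ennreal (real CARD('n) * cone_atom p P u * indicator A u))"
    unfolding emeasure_Lp_surface_area_measure[OF A]
    by (intro sum.cong refl) (simp add: weight indicator_def)
  also have "\<dots> = ennreal (\<Sum>u\<in>facet_normals_off_o P. real CARD('n) * cone_atom p P u * indicator A u)"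
    using nonneg by (intro sum_ennreal) (auto simp: indicator_def)
  finally have "measure (Lp_surface_area_measure p P) A =
      (\<Sum>u\<in>facet_normals_off_o P. real CARD('n) * cone_atom p P u * indicator A u)"
    using nonneg by (simp add: measure_def sum_nonneg)
  also have "\<dots> = (\<Sum>u\<in>U. real CARD('n) * cone_atom p P u * indicator A u)"
  proof (rule sum.mono_neutral_left[OF U(1,2)], rule ballI)
    fix u assume u: "u \<in> U - facet_normals_off_o P"
    then have "norm u = 1" using U(3) by auto
    then have "cone_atom p P u = 0" using cone_atom_nonzero_imp_facet[OF P] u by blast
    then show "real CARD('n) * cone_atom p P u * indicator A u = 0" by simp
  qed
  finally show ?thesis .
qed

text \<open>Given a contravariant valuation, the classification describes its atoms, and all of \<open>\<mu> P\<close> is recovered from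
  finitely many of them. Given the formula, both properties are read off from the finite sums over atoms:
  the valuation property termwise, and contravariance by the substitution \<open>u = \<kappa> v\<close>, where \<open>\<kappa>\<close> is the
  bijection of the sphere induced by the transposed inverse of \<open>\<phi>\<close>.\<close>

theorem theorem14:
  fixes p :: real and \<mu> :: "(real ^ 'n) set \<Rightarrow> (real ^ 'n) measure"
  assumes "CARD('n) \<ge> 3" and "p \<noteq> 1"
    and "\<And>P. P \<in> polytopes_o \<Longrightarrow> \<mu> P \<in> discrete_sphere_measures"
  shows "(valuation_o \<mu> \<and> SL_contravariant p \<mu>) \<longleftrightarrow>
    (\<exists>c\<^sub>1 c\<^sub>2 :: real. c\<^sub>1 \<ge> 0 \<and> c\<^sub>2 \<ge> 0 \<and>
      (\<forall>P \<in> polytopes_o. \<forall>A \<in> sets sphere_borel.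
         measure (\<mu> P) A =
           c\<^sub>1 * measure (Lp_surface_area_measure p P) A
         + c\<^sub>2 * measure (Lp_surface_area_measure p (uminus ` P)) A))"
proof -
  let ?n = "real CARD('n)"
  have s: "\<mu> P \<in> sphere_measures" if "P \<in> polytopes_o" for P
    using assms(3)[OF that] by (simp add: discrete_sphere_measures_def)
  define V where "V P = facet_normals_off_o P \<union> facet_normals_off_o (uminus ` P)" for P :: "(real ^ 'n) set"
  have V: "finite (V P)" "V P \<subseteq> sphere 0 1" if "P \<in> polytopes_o" for P
    using finite_facet_normals_off_o[OF that] finite_facet_normals_off_o[OF uminus_polytopes_o[OF that]]
    by (auto simp: V_def facet_normals_off_o_def)
  define M where "M c c' P a = ?n * c * cone_atom p P a + ?n * c' * cone_atom p (uminus ` P) a"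
    for c c' a and P :: "(real ^ 'n) set"
  have V_zero: "M c c' P u = 0" if "P \<in> polytopes_o" "norm u = 1" "u \<notin> V P" for c c' P u
  proof -
    have "cone_atom p P u = 0" "cone_atom p (uminus ` P) u = 0"
      using that cone_atom_nonzero_imp_facet uminus_polytopes_o unfolding V_def by blast+
    then show ?thesis by (simp add: M_def)
  qed
  have rhs: "c * measure (Lp_surface_area_measure p P) A + c' * measure (Lp_surface_area_measure p (uminus ` P)) A
      = (\<Sum>u\<in>U. M c c' P u * indicator A u)"
    if P: "P \<in> polytopes_o" and A: "A \<in> sets sphere_borel" and U: "finite U" "V P \<subseteq> U" "U \<subseteq> sphere 0 1"
    for c c' P A U
    using measure_Lp_surface_area_measure[OF P A U(1) _ U(3), of p]
      measure_Lp_surface_area_measure[OF uminus_polytopes_o[OF P] A U(1) _ U(3), of p] U(2)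
    by (simp add: V_def M_def sum_distrib_left flip: sum.distrib) (simp add: algebra_simps)
  show ?thesis
  proof
    assume "valuation_o \<mu> \<and> SL_contravariant p \<mu>"
    then have "centroaffine_atoms p (measure_atom p \<mu>)"
      using assms(3) by (intro measure_atoms) auto
    from centroaffine_atoms_classification[OF this assms(1,2)]
    obtain c c' where c: "0 \<le> c" "0 \<le> c'" and
      atoms: "\<And>P a. P \<in> polytopes_o \<Longrightarrow> a \<noteq> 0 \<Longrightarrow>
        measure_atom p \<mu> P a = c * cone_atom p P a + c' * cone_atom p (uminus ` P) a" by blast
    have "measure (\<mu> P) A = c / ?n * measure (Lp_surface_area_measure p P) A
         + c' / ?n * measure (Lp_surface_area_measure p (uminus ` P)) A"
      if P: "P \<in> polytopes_o" and A: "A \<in> sets sphere_borel" for P A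
    proof -
      have single: "measure (\<mu> P) {u} = M (c / ?n) (c' / ?n) P u" if "norm u = 1" for u
      proof -
        have "u \<noteq> 0" using that by auto
        then show ?thesis
          using atoms[OF P, of u] that by (simp add: measure_atom_def M_def sgn_div_norm)
      qed
      have "measure (\<mu> P) A = (\<Sum>u\<in>V P. measure (\<mu> P) {u} * indicator A u)"
        using V[OF P] V_zero[OF P] A sphere_measureD(1)[OF s[OF P]] single
        by (intro discrete_measure_finite_support[OF assms(3)[OF P]]) auto
      also have "\<dots> = (\<Sum>u\<in>V P. M (c / ?n) (c' / ?n) P u * indicator A u)"
        using V(2)[OF P] single by (intro sum.cong) auto
      also have "\<dots> = c / ?n * measure (Lp_surface_area_measure p P) A
         + c' / ?n * measure (Lp_surface_area_measure p (uminus ` P)) A"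
        using V[OF P] by (intro rhs[OF P A, symmetric]) auto
      finally show ?thesis .
    qed
    then show "\<exists>c\<^sub>1 c\<^sub>2 :: real. c\<^sub>1 \<ge> 0 \<and> c\<^sub>2 \<ge> 0 \<and>
      (\<forall>P \<in> polytopes_o. \<forall>A \<in> sets sphere_borel.
         measure (\<mu> P) A =
           c\<^sub>1 * measure (Lp_surface_area_measure p P) A
         + c\<^sub>2 * measure (Lp_surface_area_measure p (uminus ` P)) A)"
      using c by (intro exI[of _ "c / ?n"] exI[of _ "c' / ?n"]) auto
  next
    assume "\<exists>c\<^sub>1 c\<^sub>2 :: real. c\<^sub>1 \<ge> 0 \<and> c\<^sub>2 \<ge> 0 \<and>
      (\<forall>P \<in> polytopes_o. \<forall>A \<in> sets sphere_borel.
         measure (\<mu> P) A =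
           c\<^sub>1 * measure (Lp_surface_area_measure p P) A
         + c\<^sub>2 * measure (Lp_surface_area_measure p (uminus ` P)) A)"
    then obtain c c' where c: "0 \<le> c" "0 \<le> c'" and \<mu>: "\<And>P A. P \<in> polytopes_o \<Longrightarrow> A \<in> sets sphere_borel \<Longrightarrow>
        measure (\<mu> P) A = c * measure (Lp_surface_area_measure p P) A
         + c' * measure (Lp_surface_area_measure p (uminus ` P)) A" by blast
    define m where "m = M c c'"
    have \<mu>m: "measure (\<mu> P) A = (\<Sum>u\<in>U. m P u * indicator A u)"
      if "P \<in> polytopes_o" "A \<in> sets sphere_borel" "finite U" "V P \<subseteq> U" "U \<subseteq> sphere 0 1" for P A U
      using \<mu>[OF that(1,2)] rhs[OF that] by (simp add: m_def)
    have "centroaffine_atoms p m"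
      unfolding m_def M_def using c
      by (intro centroaffine_atoms_combine cone_atoms centroaffine_atoms_reflect) auto
    then interpret m: centroaffine_atoms p m .
    have "valuation_o \<mu>"
      unfolding valuation_o_def
    proof (intro allI impI ballI)
      fix P Q A :: "(real ^ 'n) set"
      assume po: "P \<in> polytopes_o" "Q \<in> polytopes_o" "P \<union> Q \<in> polytopes_o" "P \<inter> Q \<in> polytopes_o"
        and A: "A \<in> sets sphere_borel"
      define U where "U = V P \<union> V Q \<union> V (P \<union> Q) \<union> V (P \<inter> Q)"
      have U: "finite U" "U \<subseteq> sphere 0 1" using V po by (auto simp: U_def)
      have "measure (\<mu> X) A = (\<Sum>u\<in>U. m X u * indicator A u)" if "X \<in> {P, Q, P \<union> Q, P \<inter> Q}" for X
        using that po U A by (intro \<mu>m) (auto simp: U_def)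
      moreover have "m (P \<union> Q) u + m (P \<inter> Q) u = m P u + m Q u" if "u \<in> U" for u
      proof -
        have "u \<noteq> 0" using that U(2) by auto
        then show ?thesis using po by (rule m.valuation)
      qed
      then have "(\<Sum>u\<in>U. m (P \<union> Q) u * indicator A u) + (\<Sum>u\<in>U. m (P \<inter> Q) u * indicator A u) =
          (\<Sum>u\<in>U. m P u * indicator A u) + (\<Sum>u\<in>U. m Q u * indicator A u)"
        unfolding sum.distrib[symmetric] distrib_right[symmetric]
        by (intro sum.cong) auto
      ultimately show "measure (\<mu> (P \<union> Q)) A + measure (\<mu> (P \<inter> Q)) A = measure (\<mu> P) A + measure (\<mu> Q) A"
        by simp
    qed
    moreover have "SL_contravariant p \<mu>"
      unfolding SL_contravariant_def
    proof (intro allI impI ballI)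
      fix \<phi> :: "real ^ 'n ^ 'n" and P :: "(real ^ 'n) set" and f :: "real ^ 'n \<Rightarrow> real"
      assume det: "det \<phi> = 1" and P: "P \<in> polytopes_o" and f: "continuous_on (- {0}) f"
        and hom: "homogeneous_of_degree p f"
      let ?\<phi>P = "(\<lambda>y. \<phi> *v y) ` P"
      have \<phi>P: "?\<phi>P \<in> polytopes_o" using P by (rule linear_image_polytopes_o)
      define \<psi> where "\<psi> x = transpose (matrix_inv \<phi>) *v x" for x
      note inv = matrix_inv_det_1[OF det, folded \<psi>_def]
      have \<psi>0: "\<psi> x \<noteq> 0" if "x \<noteq> 0" for x using inv(1)[of x] that by auto
      have \<psi>_scale: "\<psi> (t *\<^sub>R x) = t *\<^sub>R \<psi> x" for t x unfolding \<psi>_def by (rule matrix_vector_mult_scaleR)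
      have contr: "m ?\<phi>P (\<psi> v) = m P v" if "v \<noteq> 0" for v
        using m.contravariant[OF det P \<psi>0[OF that]] inv(1) by simp
      \<comment> \<open>The sum over \<open>W\<close> has to account for the atoms of \<open>P\<close> and, after the substitution by \<open>\<kappa>\<close>, for those
        of the image of \<open>P\<close>; so preimages under \<open>\<kappa>\<close> of normals of the image are included.\<close>
      define \<kappa> where "\<kappa> v = sgn (\<psi> v)" for v
      define W where "W = V P \<union> (\<lambda>u. sgn (transpose \<phi> *v u)) ` V ?\<phi>P"
      have tr0: "transpose \<phi> *v u \<noteq> 0" if "u \<noteq> 0" for u using inv(2)[of u] that by (auto simp: \<psi>_def)
      have "norm (sgn (transpose \<phi> *v u)) = 1" if "u \<in> V ?\<phi>P" for u
      proof -
        have "u \<noteq> 0" using that V(2)[OF \<phi>P] by auto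
        then show ?thesis using tr0 by (simp add: norm_sgn)
      qed
      then have W: "finite W" "W \<subseteq> sphere 0 1"
        using V[OF P] V(1)[OF \<phi>P] by (auto simp: W_def)
      have \<kappa>_inv: "sgn (transpose \<phi> *v \<kappa> v) = v" if "norm v = 1" for v
      proof -
        have "v \<noteq> 0" using that by auto
        have "transpose \<phi> *v \<kappa> v = (1 / norm (\<psi> v)) *\<^sub>R v"
          unfolding \<kappa>_def sgn_div_norm by (simp add: matrix_vector_mult_scaleR inv(1) divide_inverse del: transpose_matrix_vector)
        then show ?thesis using \<psi>0[OF \<open>v \<noteq> 0\<close>] that by (simp add: sgn_scaleR sgn_div_norm del: transpose_matrix_vector)
      qed
      have \<kappa>_surj: "\<kappa> (sgn (transpose \<phi> *v u)) = u" if "norm u = 1" for u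
      proof -
        have "u \<noteq> 0" using that by auto
        have "\<psi> (sgn (transpose \<phi> *v u)) = (1 / norm (transpose \<phi> *v u)) *\<^sub>R u"
          unfolding sgn_div_norm by (simp add: \<psi>_scale inv(2) divide_inverse del: transpose_matrix_vector)
        then show ?thesis using tr0[OF \<open>u \<noteq> 0\<close>] that
          by (simp add: \<kappa>_def sgn_scaleR sgn_div_norm del: transpose_matrix_vector)
      qed
      have inj: "inj_on \<kappa> W"
        using \<kappa>_inv W(2) by (intro inj_on_inverseI[of _ "\<lambda>u. sgn (transpose \<phi> *v u)"]) auto
      have \<kappa>W: "finite (\<kappa> ` W)" "V ?\<phi>P \<subseteq> \<kappa> ` W" "\<kappa> ` W \<subseteq> sphere 0 1"
      proof -
        show "finite (\<kappa> ` W)" using W(1) by simp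
        show "V ?\<phi>P \<subseteq> \<kappa> ` W"
        proof
          fix u assume u: "u \<in> V ?\<phi>P"
          then have "u = \<kappa> (sgn (transpose \<phi> *v u))" using \<kappa>_surj V(2)[OF \<phi>P] by auto
          then show "u \<in> \<kappa> ` W" using u unfolding W_def by blast
        qed
        have "v \<noteq> 0" if "v \<in> W" for v using W(2) that by auto
        then show "\<kappa> ` W \<subseteq> sphere 0 1" using \<psi>0 by (auto simp: \<kappa>_def norm_sgn)
      qed
      have cont: "continuous_on (sphere 0 1) f" using f by (rule continuous_on_subset) auto
      have cont_\<psi>: "continuous_on (sphere 0 1) (\<lambda>x. f (\<psi> x))"
      proof (rule continuous_on_compose2[OF f])
        show "continuous_on (sphere 0 1) \<psi>"
          unfolding \<psi>_def by (intro linear_continuous_on matrix_vector_mul_bounded_linear)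
        have "x \<noteq> 0" if "x \<in> sphere 0 1" for x :: "real ^ 'n" using that by auto
        then show "\<psi> ` sphere 0 1 \<subseteq> - {0}" using \<psi>0 by auto
      qed
      have "(\<integral>x. f x \<partial>\<mu> ?\<phi>P) = (\<Sum>u\<in>\<kappa> ` W. f u * m ?\<phi>P u)"
        using \<mu>m[OF \<phi>P _ \<kappa>W] sphere_measureD(1)[OF s[OF \<phi>P]]
        by (intro integral_finite_support[OF s[OF \<phi>P] \<kappa>W(1,3) _ cont]) auto
      also have "\<dots> = (\<Sum>v\<in>W. f (\<kappa> v) * m ?\<phi>P (\<kappa> v))"
        using inj by (simp add: sum.reindex)
      also have "\<dots> = (\<Sum>v\<in>W. f (\<psi> v) * m P v)"
      proof (intro sum.cong refl)
        fix v assume "v \<in> W"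
        then have "v \<noteq> 0" using W(2) by auto
        define t where "t = inverse (norm (\<psi> v))"
        have "t > 0" using \<psi>0[OF \<open>v \<noteq> 0\<close>] by (simp add: t_def)
        have \<kappa>: "\<kappa> v = t *\<^sub>R \<psi> v" by (simp add: \<kappa>_def t_def sgn_div_norm)
        have "f (\<kappa> v) = t powr p * f (\<psi> v)"
          using hom \<open>t > 0\<close> \<psi>0[OF \<open>v \<noteq> 0\<close>] unfolding homogeneous_of_degree_def \<kappa> by blast
        moreover have "m ?\<phi>P (\<kappa> v) = t powr (- p) * m P v"
          unfolding \<kappa> using m.homogeneous[OF \<phi>P \<psi>0[OF \<open>v \<noteq> 0\<close>] \<open>t > 0\<close>] contr[OF \<open>v \<noteq> 0\<close>] by simp
        moreover have "t powr p * t powr (- p) = 1" using \<open>t > 0\<close> by (simp flip: powr_add)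
        ultimately show "f (\<kappa> v) * m ?\<phi>P (\<kappa> v) = f (\<psi> v) * m P v"
          by (simp add: algebra_simps)
      qed
      also have "\<dots> = (\<integral>x. f (\<psi> x) \<partial>\<mu> P)"
        using \<mu>m[OF P _ W(1) _ W(2)] sphere_measureD(1)[OF s[OF P]]
        by (intro integral_finite_support[OF s[OF P] W _ cont_\<psi>, symmetric]) (auto simp: W_def)
      finally show "(\<integral>x. f x \<partial>\<mu> ?\<phi>P) = (\<integral>x. f (transpose (matrix_inv \<phi>) *v x) \<partial>\<mu> P)"
        unfolding \<psi>_def .
    qed
    ultimately show "valuation_o \<mu> \<and> SL_contravariant p \<mu>" ..
  qed
qed

end
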